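(* For each $n\in\mathbb N$, let $X_{n1}$ be a hanging set on $J_1$ which is permeable with respect to a hutch $D_{n1}$, and $X_{n2}$ a hanging set on $J_{-1}$ which is permeable with respect to a hutch $D_{n2}$. Suppose $\lim_{n\to\infty}\mathrm{diam}(D_{n1})=\lim_{n\to\infty}\mathrm{diam}(D_{n2})=0$ and the discs in $\{D_{n1},D_{n2}:n\in\mathbb N\}$ are pairwise disjoint. Write $X_{\mathbb N}=\bigcup\{X_{n1}\cup X_{n2}:n\in\mathbb N\}$. Let $\mathbb N',\mathbb N''\subset\mathbb N$ be such that for each $n\in\mathbb N'$ there are a floating set $Y_{n1}$ and a cable $L_{n1}$ from $Y_{n1}$ to $J_1$ with $X_{n1}=Y_{n1}\cup L_{n1}$, and for each $n\in\mathbb N''$ there are a floating set $Y_{n2}$ and a cable $L_{n2}$ from $Y_{n2}$ to $J_{-1}$ with $X_{n2}=Y_{n2}\cup L_{n2}$. Let $\{W_n:n\in\mathbb N\}$ be a family of pairwise disjoint countable sets in $(-1,1)^2-X_{\mathbb N}$, each dense in $J^2$. Then there exists a homeomorphism $\psi:J^2\to J^2$ such that: (1) for $n\in\mathbb N-\mathbb N'$ and $w\in W_n$, $\omega_\psi(w)=X_{n1}$; (2) for $n\in\mathbb N'$ and $w\in W_n$, $\omega_\psi(w)=Y_{n1}$; (3) for $n\in\mathbb N-\mathbb N''$ and $w\in W_n$, $\alpha_\psi(w)=X_{n2}$; (4) for $n\in\mathbb N''$ and $w\in W_n$, $\alpha_\psi(w)=Y_{n2}$.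
   Context: $J=[-1,1]$, $J_s=J\times\{s\}$, $\stackrel{\circ}{J_s}=(-1,1)\times\{s\}$ for $s\in\{-1,1\}$, $\partial J^2$ the boundary of the square $J^2$. For an arc $I$, $\stackrel{\circ}{I}$ (also $\mathrm{Int}\,I$) is $I$ minus its endpoints; for a disc $D$, $\stackrel{\circ}{D}$ is its interior, $\partial D$ its boundary circle. A hanging set on $J_s$ is a nonempty compact connected $X\subset J^2$ with $X\cap\partial J^2$ a nonempty connected subset of $\stackrel{\circ}{J_s}$. A floating set is a nonempty compact connected $Y\subset J^2$ with $Y\cap\partial J^2=\emptyset$; a cable from $Y$ to $J_s$ is an arc $L\subset J^2$ with one endpoint in $\stackrel{\circ}{J_s}$, the other in $Y$, and $\stackrel{\circ}{L}\cap(\partial J^2\cup Y)=\emptyset$. A hutch of a hanging set $X$ on $J_s$ is a disc $D\subset J^2$ which is a hanging set on $J_s$ with $D\cap\partial J^2$ an arc, such that $X\cap J_s\subset\mathrm{Int}(D\cap J_s)$ and $X-J_s\subset\stackrel{\circ}{D}$. $X$ is permeable with respect to the hutch $D$ if, with $A=D\cap J_s$, there exists a continuous $\eta:D\to D$ such that (C.1) $\eta|(\partial D-\stackrel{\circ}{A})=\mathrm{id}$, $\eta(A)=A\cup X$, and there is an arc $A'\subset\stackrel{\circ}{A}$ with $X\cap J_s\subset\mathrm{Int}\,A'$, $\eta(A-A')=A-(X\cap J_s)$, $\eta(A')=X$, $\eta|(A-A')$ injective; (C.2) $\eta(\stackrel{\circ}{D})=\stackrel{\circ}{D}-X$ and $\eta|\stackrel{\circ}{D}$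 injective. $\omega_\psi(w)$ and $\alpha_\psi(w)=\omega_{\psi^{-1}}(w)$ are the $\omega$- and $\alpha$-limit sets of $w$ under $\psi$. *)

theory Defs
  imports "HOL-Analysis.Analysis"
begin

type_synonym pt = "real \<times> real"

definition JJ :: "real set" where "JJ = {-1..1}"
definition sq :: "pt set" where "sq = JJ \<times> JJ"
definition bd_sq :: "pt set" where "bd_sq = frontier sq"
definition Jside :: "real \<Rightarrow> pt set" where "Jside s = JJ \<times> {s}"
definition Jside_open :: "real \<Rightarrow> pt set" where "Jside_open s = {-1<..<1} \<times> {s}"

definition is_arc :: "pt set \<Rightarrow> bool" where
  "is_arc A \<longleftrightarrow> (\<exists>g::real \<Rightarrow> pt. arc g \<and> path_image g = A)"

definition arc_int :: "pt set \<Rightarrow> pt set" where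
  "arc_int A = (let g = (SOME g::real \<Rightarrow> pt. arc g \<and> path_image g = A) in
                 A - {pathstart g, pathfinish g})"

text \<open>A (closed topological) disc; its interior and boundary circle are the
  topological interior and frontier in the plane.\<close>
definition is_disc :: "pt set \<Rightarrow> bool" where
  "is_disc D \<longleftrightarrow> D homeomorphic (cball (0::pt) 1)"

definition hanging_set :: "pt set \<Rightarrow> real \<Rightarrow> bool" where
  "hanging_set X s \<longleftrightarrow> X \<noteq> {} \<and> compact X \<and> connected X \<and> X \<subseteq> sq \<and>
     X \<inter> bd_sq \<noteq> {} \<and> connected (X \<inter> bd_sq) \<and> X \<inter> bd_sq \<subseteq> Jside_open s"

definition floating_set :: "pt set \<Rightarrow> bool" where
  "floating_set Y \<longleftrightarrow> Y \<noteq> {} \<and> compact Y \<and> connected Y \<and> Y \<subseteq> sq \<and> Y \<inter> bd_sq = {}"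

definition cable :: "pt set \<Rightarrow> pt set \<Rightarrow> real \<Rightarrow> bool" where
  "cable L Y s \<longleftrightarrow> L \<subseteq> sq \<and> (\<exists>g::real \<Rightarrow> pt. arc g \<and> path_image g = L \<and>
     pathstart g \<in> Jside_open s \<and> pathfinish g \<in> Y \<and>
     (L - {pathstart g, pathfinish g}) \<inter> (bd_sq \<union> Y) = {})"

definition hutch :: "pt set \<Rightarrow> pt set \<Rightarrow> real \<Rightarrow> bool" where
  "hutch D X s \<longleftrightarrow> is_disc D \<and> D \<subseteq> sq \<and> hanging_set D s \<and> is_arc (D \<inter> bd_sq) \<and>
     X \<inter> Jside s \<subseteq> arc_int (D \<inter> Jside s) \<and> X - Jside s \<subseteq> interior D"

definition permeable :: "pt set \<Rightarrow> pt set \<Rightarrow> real \<Rightarrow> bool" where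
  "permeable X D s \<longleftrightarrow> (let A = D \<inter> Jside s in
     \<exists>\<eta>. continuous_on D \<eta> \<and> \<eta> ` D \<subseteq> D \<and>
       (\<forall>x \<in> frontier D - arc_int A. \<eta> x = x) \<and> \<eta> ` A = A \<union> X \<and>
       (\<exists>A'. is_arc A' \<and> A' \<subseteq> arc_int A \<and> X \<inter> Jside s \<subseteq> arc_int A' \<and>
             \<eta> ` (A - A') = A - (X \<inter> Jside s) \<and> \<eta> ` A' = X \<and> inj_on \<eta> (A - A')) \<and>
       \<eta> ` interior D = interior D - X \<and> inj_on \<eta> (interior D))"

definition omega_limit :: "(pt \<Rightarrow> pt) \<Rightarrow> pt \<Rightarrow> pt set" where
  "omega_limit f w = {y. \<exists>r. strict_mono r \<and> ((\<lambda>n. (f ^^ (r n)) w) \<longlonglongrightarrow> y)}"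

end

theory Submission
  imports Defs
begin

text \<open>
  Permeability supplies maps \<open>\<eta>\<close> of the hutches that collapse an arc \<open>A'\<close> of the side onto \<open>X\<close>. As
  the hutches are disjoint and shrink, these maps glue to a continuous surjection \<open>H\<close> of the square
  whose only nontrivial fibres lie in the top and bottom sides. Hence every homeomorphism \<open>g\<close> fixing
  these two sides pointwise descends to a homeomorphism \<open>\<psi>\<close> with \<open>\<psi> H = H g\<close>, and
  \<open>\<omega>\<close>-limit sets are mapped by \<open>H\<close>. It remains to prescribe, for countably many
  points, segments of the sides as limit sets under \<open>g\<close> and its inverse. For this, \<open>g\<close> raises every
  point, after a shear that gives the points different heights modulo the step, so that the
  horizontal component of \<open>g\<close> can steer every orbit separately: it pulls the orbit towards
  a target that sweeps slowly over the segment. When \<open>X\<close> consists of a floating set \<open>Y\<close> and a cable, a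
  Jordan curve argument yields a subarc of \<open>A'\<close> that \<open>\<eta>\<close> maps exactly onto \<open>Y\<close>.
\<close>

section \<open>Limit sets and perturbed contractions\<close>

text \<open>The two sides must stay fixed pointwise, since there \<open>H\<close> may identify
  points. This is the obstacle: near a side \<open>g\<close> is close to the identity, yet an orbit
  has to wander along a whole segment of that side forever. The horizontal steps must therefore tend
  to 0 with divergent sum, and the target must slow down with time, whence its oscillation in
  \<open>ln (1 + t)\<close>. A second obstacle is that one continuous function of the height has to
  serve countably many orbits. Heights advance by exactly 1 along an orbit, so an orbit sees this
  function only on a translate of the natural numbers, and disjoint translates can be given
  independent values. The function need not converge at the sides; only its product with the gain is
  extended there, by 0. The points to be steered are preimages under \<open>H\<close> of the given
  points. These preimages lie in the open square because \<open>H\<close> maps the boundary into the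
  boundary and the sets \<open>X\<close>, all of which the given points avoid.\<close>

lemma omega_limit_iff:
  "y \<in> omega_limit f w \<longleftrightarrow> (\<forall>e>0. \<forall>N. \<exists>n\<ge>N. dist ((f ^^ n) w) y < e)"
proof
  assume "y \<in> omega_limit f w"
  then obtain r where r: "strict_mono r" "(\<lambda>n. (f ^^ (r n)) w) \<longlonglongrightarrow> y"
    unfolding omega_limit_def by blast
  show "\<forall>e>0. \<forall>N. \<exists>n\<ge>N. dist ((f ^^ n) w) y < e"
  proof (intro allI impI)
    fix e :: real and N :: nat
    assume "e > 0"
    then obtain M where M: "\<And>n. n \<ge> M \<Longrightarrow> dist ((f ^^ (r n)) w) y < e"
      using r(2) unfolding lim_sequentially by blast
    have "r (max M N) \<ge> N"
      using seq_suble[OF r(1), of "max M N"] by simp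
    then show "\<exists>n\<ge>N. dist ((f ^^ n) w) y < e"
      using M[of "max M N"] by auto
  qed
next
  assume A: "\<forall>e>0. \<forall>N. \<exists>n\<ge>N. dist ((f ^^ n) w) y < e"
  define Q where "Q k n \<longleftrightarrow> dist ((f ^^ n) w) y < inverse (real (Suc k))" for k n
  have "\<exists>n>N. Q k n" for k N
    using A[rule_format, of "inverse (real (Suc k))" "Suc N"] by (auto simp: Q_def Suc_le_eq)
  then have "\<exists>r. \<forall>k. Q k (r k) \<and> r k < r (Suc k)"
    using dependent_nat_choice[of Q "\<lambda>_. (<)"] by blast
  then obtain r where r: "\<And>k. Q k (r k)" "\<And>k. r k < r (Suc k)"
    by blast
  have "(\<lambda>n. (f ^^ (r n)) w) \<longlonglongrightarrow> y"
  proof (rule metric_LIMSEQ_I)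
    fix e :: real
    assume "0 < e"
    then obtain N where "inverse (real (Suc N)) < e"
      using reals_Archimedean by blast
    moreover have "inverse (real (Suc n)) \<le> inverse (real (Suc N))" if "n \<ge> N" for n
      using that by (simp add: le_imp_inverse_le)
    ultimately have "dist ((f ^^ r n) w) y < e" if "n \<ge> N" for n
      using r(1)[of n] that unfolding Q_def by (meson order_less_le_trans order_less_trans)
    then show "\<exists>N. \<forall>n\<ge>N. dist ((f ^^ r n) w) y < e"
      by blast
  qed
  then show "y \<in> omega_limit f w"
    unfolding omega_limit_def using r(2) strict_mono_Suc_iff by blast
qed

text \<open>A limit point downstairs has to be lifted through a map that need not be injective. A
  convergent subsequence of the orbit in the compact set \<open>S\<close> provides the lift.\<close>

lemma omega_limit_semiconj:
  assumes S: "compact S" "v \<in> S" "g ` S \<subseteq> S"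
    and H: "continuous_on S H" "\<And>p. p \<in> S \<Longrightarrow> \<psi> (H p) = H (g p)"
  shows "omega_limit \<psi> (H v) = H ` omega_limit g v"
proof -
  have inS: "(g ^^ n) v \<in> S" for n
    by (induction n) (use S in auto)
  have conj: "(\<psi> ^^ n) (H v) = H ((g ^^ n) v)" for n
    by (induction n) (use inS H in auto)
  show ?thesis
  proof (intro subset_antisym subsetI)
    fix y assume "y \<in> omega_limit \<psi> (H v)"
    then obtain r where r: "strict_mono r" "(\<lambda>n. H ((g ^^ (r n)) v)) \<longlonglongrightarrow> y"
      unfolding omega_limit_def conj by blast
    obtain l q where lq: "l \<in> S" "strict_mono (q :: nat \<Rightarrow> nat)"
      "((\<lambda>n. (g ^^ (r n)) v) \<circ> q) \<longlonglongrightarrow> l"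
      using S(1) inS unfolding compact_def by meson
    have "(\<lambda>n. H ((g ^^ (r (q n))) v)) \<longlonglongrightarrow> H l"
      using continuous_on_tendsto_compose[OF H(1) lq(3) lq(1)] inS by (simp add: o_def)
    moreover have "(\<lambda>n. H ((g ^^ (r (q n))) v)) \<longlonglongrightarrow> y"
      using LIMSEQ_subseq_LIMSEQ[OF r(2) lq(2)] by (simp add: o_def)
    ultimately have "y = H l"
      using LIMSEQ_unique by blast
    moreover have "l \<in> omega_limit g v"
      unfolding omega_limit_def using lq(3) strict_mono_o[OF r(1) lq(2)]
      by (auto simp: o_def)
    ultimately show "y \<in> H ` omega_limit g v" by blast
  next
    fix y assume "y \<in> H ` omega_limit g v"
    then obtain l r where r: "y = H l" "strict_mono r" "(\<lambda>n. (g ^^ (r n)) v) \<longlonglongrightarrow> l"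
      unfolding omega_limit_def by blast
    have "l \<in> S"
      using closed_sequentially[OF compact_imp_closed[OF S(1)] _ r(3)] inS by blast
    then have "(\<lambda>n. H ((g ^^ (r n)) v)) \<longlonglongrightarrow> y"
      using continuous_on_tendsto_compose[OF H(1) r(3)] inS r(1) by simp
    then show "y \<in> omega_limit \<psi> (H v)"
      unfolding omega_limit_def conj using r(2) by blast
  qed
qed

text \<open>The bound on \<open>z (Suc n)\<close> is a convex combination of \<open>z n\<close> and
  \<open>h n\<close>. Hence later perturbations contribute no more than a bound for
  \<open>h\<close>, while the initial error is damped by the product of the factors
  \<open>1 - l k\<close>, which is at most \<open>exp\<close> of minus the sum of the
  \<open>l k\<close>.\<close>

lemma perturbed_contraction_tendsto_0:
  fixes z l d h :: "nat \<Rightarrow> real"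
  assumes z0: "\<And>n. 0 \<le> z n" and l: "\<And>n. 0 \<le> l n" "\<And>n. l n \<le> 1"
    and step: "\<And>n. z (Suc n) \<le> (1 - l n) * z n + h n * l n"
    and h: "h \<longlonglongrightarrow> 0"
    and div: "filterlim (\<lambda>n. \<Sum>k<n. l k) at_top sequentially"
  shows "z \<longlonglongrightarrow> 0"
proof (rule LIMSEQ_I)
  fix r :: real assume r: "r > 0"
  define \<eta> where "\<eta> = r / 2"
  have \<eta>: "\<eta> > 0" using r by (simp add: \<eta>_def)
  then obtain N where N: "\<And>n. n \<ge> N \<Longrightarrow> h n \<le> \<eta>"
    using LIMSEQ_D[OF h, of \<eta>] by (auto simp: abs_less_iff intro: less_imp_le)
  \<comment> \<open>Normalised so that at index \<open>N\<close> the bound below reads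
    \<open>z N \<le> \<eta> + z N\<close>.\<close>
  define C where "C = z N * exp (\<Sum>k<N. l k)"
  have C: "C \<ge> 0" using z0 by (simp add: C_def)
  have bound: "z (N + n) \<le> \<eta> + C * exp (- (\<Sum>k<N+n. l k))" for n
  proof (induction n)
    case 0
    show ?case using \<eta> by (simp add: C_def mult.assoc flip: exp_add)
  next
    case (Suc n)
    let ?S = "\<Sum>k<N+n. l k"
    have le: "1 - l (N+n) \<le> exp (- l (N+n))"
      using exp_ge_add_one_self[of "- l (N+n)"] by simp
    have "z (N + Suc n) \<le> (1 - l (N+n)) * z (N+n) + h (N+n) * l (N+n)"
      using step by simp
    also have "\<dots> \<le> (1 - l (N+n)) * (\<eta> + C * exp (- ?S)) + \<eta> * l (N+n)"
      using Suc l N by (intro add_mono mult_left_mono mult_right_mono) auto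
    also have "\<dots> = \<eta> + (1 - l (N+n)) * (C * exp (- ?S))"
      by (simp add: algebra_simps)
    also have "\<dots> \<le> \<eta> + exp (- l (N+n)) * (C * exp (- ?S))"
      using le C by (intro add_left_mono mult_right_mono) auto
    also have "\<dots> = \<eta> + C * exp (- (\<Sum>k<N + Suc n. l k))"
      by (simp add: mult.left_commute flip: exp_add)
    finally show ?case .
  qed
  have "(\<lambda>n. exp (- (\<Sum>k<n. l k))) \<longlonglongrightarrow> 0"
    using filterlim_compose[OF exp_at_bot filterlim_compose[OF filterlim_uminus_at_bot_at_top div]]
    by simp
  from tendsto_mult_left[OF this, of C] have "(\<lambda>n. C * exp (- (\<Sum>k<n. l k))) \<longlonglongrightarrow> 0"
    by simp
  from LIMSEQ_D[OF this \<eta>] obtain M where M: "\<And>n. n \<ge> M \<Longrightarrow> C * exp (- (\<Sum>k<n. l k)) < \<eta>"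
    by (auto simp: abs_less_iff)
  have "norm (z n - 0) < r" if "n \<ge> max M N" for n
  proof -
    have "z n \<le> \<eta> + C * exp (- (\<Sum>k<n. l k))"
      using bound[of "n - N"] that by simp
    also have "\<dots> < r" using M[of n] that by (simp add: \<eta>_def)
    finally show ?thesis using z0[of n] by simp
  qed
  then show "\<exists>no. \<forall>n\<ge>no. norm (z n - 0) < r" by blast
qed

section \<open>Chasing a sweeping target\<close>

text \<open>
  The gain tends to \<open>0\<close>, which makes the push extend by the identity to the boundary, but only like
  \<open>1 / \<surd>t\<close>: its sum along an orbit diverges, and it dominates the steps \<open>O(1 / t)\<close> of the target
  \<open>m + R sin (ln (1 + t))\<close>. So orbits catch up with the target and share its limit set.
\<close>

definition gain :: "real \<Rightarrow> real" where
  "gain t = max 0 t / (8 * (1 + \<bar>t\<bar>)) / sqrt (1 + \<bar>t\<bar>)"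

lemma gain_pos_eq: "0 \<le> t \<Longrightarrow> gain t = t / (8 * (1 + t)) / sqrt (1 + t)"
  unfolding gain_def by (simp only: max_absorb2 abs_of_nonneg)

lemma gain_nonneg: "0 \<le> gain t"
  unfolding gain_def by (intro divide_nonneg_nonneg) auto

lemma gain_nonpos_eq_0: "t \<le> 0 \<Longrightarrow> gain t = 0"
  by (simp add: gain_def)

text \<open>The constant 1/8 is chosen for \<open>fst_push_less\<close>: it keeps the horizontal
  pushes strictly increasing.\<close>

lemma gain_le: "gain t \<le> 1 / 8"
proof (cases "t \<le> 0")
  case False
  then have "t / (8 * (1 + t)) \<le> 1 / 8"
    by (simp add: field_simps)
  then have "t / (8 * (1 + t)) / sqrt (1 + t) \<le> (1 / 8) / 1"
    using False by (intro frac_le[OF _ \<open>t / (8 * (1 + t)) \<le> 1 / 8\<close>]) auto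
  then show ?thesis using False by (simp only: gain_pos_eq)
qed (simp add: gain_nonpos_eq_0)

lemma gain_lower: "1 / 16 / sqrt (1 + t) \<le> gain t" if "t \<ge> 1"
proof -
  have "1 / 16 \<le> t / (8 * (1 + t))" using that by (simp add: field_simps)
  then have "1 / 16 / sqrt (1 + t) \<le> t / (8 * (1 + t)) / sqrt (1 + t)"
    using that by (intro divide_right_mono) auto
  then show ?thesis using that by (simp only: gain_pos_eq)
qed

lemma continuous_on_gain: "continuous_on A gain"
  unfolding gain_def by (intro continuous_intros) auto

lemma gain_at_top: "(gain \<longlongrightarrow> 0) at_top"
proof (rule tendsto_sandwich[OF _ _ tendsto_const])
  have "filterlim (\<lambda>t::real. sqrt (1 + t)) at_top at_top"
    by (rule filterlim_compose[OF sqrt_at_top])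
       (rule filterlim_tendsto_add_at_top[OF tendsto_const filterlim_ident])
  from tendsto_divide_0[OF tendsto_const filterlim_at_top_imp_at_infinity[OF this]]
  show "((\<lambda>t::real. 1 / sqrt (1 + t)) \<longlongrightarrow> 0) at_top" .
  show "eventually (\<lambda>t. gain t \<le> 1 / sqrt (1 + t)) at_top"
    using eventually_ge_at_top[of 0]
  proof eventually_elim
    case (elim t)
    have "t / (8 * (1 + t)) \<le> 1" using elim by simp
    then have "t / (8 * (1 + t)) / sqrt (1 + t) \<le> 1 / sqrt (1 + t)"
      using elim by (intro divide_right_mono) auto
    then show ?case using elim by (simp only: gain_pos_eq)
  qed
qed (simp add: gain_nonneg)

lemma gain_at_bot: "(gain \<longlongrightarrow> 0) at_bot"
proof (rule tendsto_eventually)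
  show "eventually (\<lambda>t. gain t = 0) at_bot"
    using eventually_le_at_bot[of 0] by eventually_elim (simp add: gain_nonpos_eq_0)
qed

lemma abs_ln_diff_le: "\<bar>ln b - ln a\<bar> \<le> \<bar>b - a\<bar> / min a b" if "a > 0" "b > 0" for a b :: real
proof -
  have *: "ln v - ln u \<le> (v - u) / u" if "0 < u" "0 < v" for u v :: real
    using ln_le_minus_one[of "v / u"] that by (simp add: ln_div diff_divide_distrib)
  show ?thesis
  proof (cases "a \<le> b")
    case True
    then have "ln a \<le> ln b" using that by simp
    then show ?thesis using *[OF that] True by (simp add: min_def)
  next
    case False
    then have "ln b \<le> ln a" using that by simp
    then show ?thesis using *[OF that(2,1)] False by (simp add: min_def)
  qed
qed

lemma abs_sin_diff_le: "\<bar>sin y - sin x\<bar> \<le> \<bar>y - x\<bar>" for x y :: real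
proof -
  have *: "\<bar>sin v - sin u\<bar> \<le> \<bar>v - u\<bar>" if uv: "u < v" for u v :: real
  proof -
    obtain z where "sin v - sin u = (v - u) * cos z"
      using MVT2[OF uv, where f=sin and f'=cos] DERIV_sin by blast
    then show ?thesis
      using abs_cos_le_one[of z] by (simp add: abs_mult mult_left_le)
  qed
  show ?thesis
  proof (cases x y rule: linorder_cases)
    case greater
    then show ?thesis using *[of y x] by (simp add: abs_minus_commute)
  qed (use * in auto)
qed

definition sweep :: "real \<Rightarrow> real \<Rightarrow> real \<Rightarrow> real" where
  "sweep m R t = m + R * sin (ln (1 + t))"

lemma abs_sweep_le: "R \<ge> 0 \<Longrightarrow> \<bar>sweep m R t\<bar> \<le> \<bar>m\<bar> + R"
proof -
  assume R: "R \<ge> 0"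
  have "\<bar>sweep m R t\<bar> \<le> \<bar>m\<bar> + \<bar>R * sin (ln (1 + t))\<bar>"
    unfolding sweep_def by (rule abs_triangle_ineq)
  also have "\<bar>R * sin (ln (1 + t))\<bar> \<le> R * 1"
    using R abs_sin_le_one[of "ln (1 + t)"] unfolding abs_mult by (intro mult_mono) auto
  finally show ?thesis by simp
qed

lemma sweep_step: "\<bar>sweep m R (t + 1) - sweep m R t\<bar> \<le> R / (1 + t)" if "t \<ge> 0" "R \<ge> 0"
proof -
  have "\<bar>sweep m R (t + 1) - sweep m R t\<bar> = R * \<bar>sin (ln (1 + (t + 1))) - sin (ln (1 + t))\<bar>"
    using that by (simp add: sweep_def abs_mult flip: right_diff_distrib)
  also have "\<dots> \<le> R * \<bar>ln (1 + (t + 1)) - ln (1 + t)\<bar>"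
    using that by (intro mult_left_mono abs_sin_diff_le) auto
  also have "\<dots> \<le> R * (1 / (1 + t))"
    using abs_ln_diff_le[of "1 + t" "1 + (t + 1)"] that by (intro mult_left_mono) (auto simp: min_def)
  finally show ?thesis by simp
qed

text \<open>Each step is a convex combination of \<open>x n\<close> and the target, with weight
  \<open>gain (t + n) * (1 - (x n)^2)\<close>. The last factor could degenerate near the vertical
  edges; convexity first traps the orbit in [-M, M] with M < 1, and then the weight is at least
  \<delta> times the gain.\<close>

lemma tracking:
  fixes x :: "nat \<Rightarrow> real" and t R m :: real
  assumes t: "t \<ge> 1" and R: "R \<ge> 0" "\<bar>m\<bar> + R < 1" and x0: "\<bar>x 0\<bar> < 1"
    and step: "\<And>n. x (Suc n) = x n + gain (t + n) * (sweep m R (t + n) - x n) * (1 - (x n)\<^sup>2)"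
  shows "(\<lambda>n. x n - sweep m R (t + n)) \<longlonglongrightarrow> 0"
proof -
  define \<rho> where "\<rho> n = sweep m R (t + real n)" for n :: nat
  define lm where "lm n = gain (t + real n) * (1 - (x n)\<^sup>2)" for n
  define M where "M = max \<bar>x 0\<bar> (\<bar>m\<bar> + R)"
  define \<delta> where "\<delta> = 1 - M\<^sup>2"
  have M: "0 \<le> M" "M < 1" using x0 R by (auto simp: M_def)
  then have \<delta>: "0 < \<delta>" "\<delta> \<le> 1"
    by (simp_all add: \<delta>_def abs_square_less_1)
  have \<rho>: "\<bar>\<rho> n\<bar> \<le> M" for n
    using abs_sweep_le[OF R(1), of m "t + n"] unfolding \<rho>_def M_def by linarith
  have step': "x (Suc n) = (1 - lm n) * x n + lm n * \<rho> n" for n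
    unfolding step lm_def \<rho>_def by (simp add: algebra_simps)
  have lam: "\<delta> * gain (t + real n) \<le> lm n \<and> lm n \<le> 1" if "\<bar>x n\<bar> \<le> M" for n
  proof -
    have "(x n)\<^sup>2 \<le> M\<^sup>2" using power_mono[OF that abs_ge_zero, of 2] by simp
    then have "gain (t + n) * \<delta> \<le> lm n"
      unfolding lm_def \<delta>_def by (intro mult_left_mono) (auto simp: gain_nonneg)
    moreover have "lm n \<le> 1 * 1"
      unfolding lm_def
    proof (intro mult_mono)
      show "gain (t + real n) \<le> 1" using gain_le[of "t+n"] by linarith
      show "0 \<le> 1 - (x n)\<^sup>2" using \<open>(x n)\<^sup>2 \<le> M\<^sup>2\<close> \<delta> by (simp add: \<delta>_def)
    qed auto
    ultimately show ?thesis by (simp add: mult.commute)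
  qed
  have xM: "\<bar>x n\<bar> \<le> M" for n
  proof (induction n)
    case 0 show ?case by (simp add: M_def)
  next
    case (Suc n)
    have l: "0 \<le> lm n" "lm n \<le> 1"
      using lam[OF Suc] \<delta> gain_nonneg[of "t+n"] by (auto intro: order_trans[rotated])
    have "\<bar>x (Suc n)\<bar> \<le> (1 - lm n) * \<bar>x n\<bar> + lm n * \<bar>\<rho> n\<bar>"
      unfolding step' using l by (intro order_trans[OF abs_triangle_ineq]) (simp add: abs_mult)
    also have "\<dots> \<le> (1 - lm n) * M + lm n * M"
      using l Suc \<rho> by (intro add_mono mult_left_mono) auto
    also have "\<dots> = M" by (simp add: algebra_simps)
    finally show ?case .
  qed
  have "(\<lambda>n. \<bar>x n - \<rho> n\<bar>) \<longlonglongrightarrow> 0"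
  proof (rule perturbed_contraction_tendsto_0)
    define l where "l n = \<delta> * gain (t + real n)" for n
    \<comment> \<open>Chosen so that \<open>h n\<close> times the lower bound for \<open>l n\<close>
      is exactly the bound \<open>R / (1 + (t + n))\<close> for the step of the target. It tends to
      0 because the gain decays only like the inverse square root.\<close>
    define h where "h n = 16 * R / \<delta> / sqrt (1 + (t + real n))" for n
    show l0: "0 \<le> l n" for n using \<delta> gain_nonneg by (simp add: l_def)
    show "l n \<le> 1" for n using lam[OF xM[of n]] by (simp add: l_def)
    have llow: "\<delta> / 16 / sqrt (1 + (t + real n)) \<le> l n" for n
      using mult_left_mono[OF gain_lower[of "t+n"], of \<delta>] t \<delta> by (simp add: l_def)
    have sq_top: "filterlim (\<lambda>n. sqrt (1 + (t + real n))) at_top sequentially"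
      by (rule filterlim_compose[OF sqrt_at_top], rule filterlim_tendsto_add_at_top[OF tendsto_const],
          rule filterlim_tendsto_add_at_top[OF tendsto_const filterlim_real_sequentially])
    show "h \<longlonglongrightarrow> 0"
      unfolding h_def
      by (rule tendsto_divide_0[OF tendsto_const filterlim_at_top_imp_at_infinity[OF sq_top]])
    show "\<bar>x (Suc n) - \<rho> (Suc n)\<bar> \<le> (1 - l n) * \<bar>x n - \<rho> n\<bar> + h n * l n" for n
    proof -
      have "x (Suc n) - \<rho> (Suc n) = (1 - lm n) * (x n - \<rho> n) + (\<rho> n - \<rho> (Suc n))"
        unfolding step' by (simp add: algebra_simps)
      then have "\<bar>x (Suc n) - \<rho> (Suc n)\<bar> \<le> \<bar>1 - lm n\<bar> * \<bar>x n - \<rho> n\<bar> + \<bar>\<rho> (Suc n) - \<rho> n\<bar>"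
        using abs_triangle_ineq[of "(1 - lm n) * (x n - \<rho> n)" "\<rho> n - \<rho> (Suc n)"]
        by (simp only: abs_mult abs_minus_commute[of "\<rho> n"])
      also have "\<bar>1 - lm n\<bar> * \<bar>x n - \<rho> n\<bar> \<le> (1 - l n) * \<bar>x n - \<rho> n\<bar>"
        using lam[OF xM[of n]] by (intro mult_right_mono) (auto simp: l_def)
      also have "\<bar>\<rho> (Suc n) - \<rho> n\<bar> \<le> R / (1 + (t + n))"
        using sweep_step[of "t + n" R m] t R by (simp add: \<rho>_def algebra_simps)
      also have "R / (1 + (t + n)) = h n * (\<delta> / 16 / sqrt (1 + (t + real n)))"
        using \<delta> t by (simp add: h_def)
      also have "\<dots> \<le> h n * l n"
        using llow[of n] R t \<delta> by (intro mult_left_mono) (auto simp: h_def)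
      finally show ?thesis by simp
    qed
    show "filterlim (\<lambda>n. \<Sum>k<n. l k) at_top sequentially"
    proof (rule filterlim_at_top_mono)
      show "filterlim (\<lambda>n. (\<delta> / 16 / 2) * sqrt (real n)) at_top sequentially"
        using \<delta> by (intro filterlim_tendsto_pos_mult_at_top[OF tendsto_const]
            filterlim_compose[OF sqrt_at_top filterlim_real_sequentially]) auto
      \<comment> \<open>Once n exceeds 1 + t, each 1 + t + k with k < n is at most 4 n. So every one
        of the first n terms is at least a fixed multiple of 1 / sqrt n, and their sum grows like
        sqrt n.\<close>
      obtain N where N: "1 + t \<le> real N" using real_arch_simple by blast
      show "eventually (\<lambda>n. (\<delta> / 16 / 2) * sqrt (real n) \<le> (\<Sum>k<n. l k)) sequentially"
        using eventually_ge_at_top[of "max 1 N"]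
      proof eventually_elim
        case (elim n)
        have n: "1 + t \<le> real n" "n \<ge> 1" using elim N by auto
        have "\<delta> / 16 / (2 * sqrt n) \<le> l k" if "k < n" for k
        proof -
          have "sqrt (1 + (t + real k)) \<le> sqrt (2\<^sup>2 * real n)"
            using that n by (intro real_sqrt_le_mono) simp
          also have "\<dots> = 2 * sqrt n" by (simp add: real_sqrt_mult)
          finally have "\<delta> / 16 / (2 * sqrt n) \<le> \<delta> / 16 / sqrt (1 + (t + real k))"
            using t \<delta> n that by (intro divide_left_mono mult_pos_pos) auto
          then show ?thesis using llow[of k] by simp
        qed
        then have "(\<Sum>k<n. \<delta> / 16 / (2 * sqrt n)) \<le> (\<Sum>k<n. l k)"
          by (intro sum_mono) auto
        moreover have "(\<Sum>k<n. \<delta> / 16 / (2 * sqrt n)) = (\<delta> / 16 / 2) * sqrt n"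
        proof -
          have "real n / sqrt n = sqrt n" by (simp add: real_div_sqrt)
          then have "real n * (\<delta> / 16 / (2 * sqrt n)) = (\<delta> / 16 / 2) * sqrt n"
            by (metis divide_divide_eq_left mult.commute times_divide_eq_right)
          then show ?thesis by (simp only: sum_constant card_lessThan)
        qed
        ultimately show ?case by (simp only:)
      qed
    qed
  qed auto
  then show ?thesis
    unfolding \<rho>_def using tendsto_rabs_zero_iff by blast
qed

text \<open>The clock \<open>ln (1 + t + n)\<close> is unbounded and advances by steps that tend to
  0, so it passes arbitrarily close to \<open>\<theta> + 2 * j * pi\<close> for all large j. Hence
  every value of the sine recurs along the orbit.\<close>

lemma omega_limit_sweep:
  fixes x y :: "nat \<Rightarrow> real" and t R m :: real
  assumes t: "t \<ge> 0" and R: "R \<ge> 0"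
    and orbit: "\<And>n. (f ^^ n) w = (x n, y n)"
    and x: "(\<lambda>n. x n - sweep m R (t + n)) \<longlonglongrightarrow> 0" and y: "y \<longlonglongrightarrow> s"
  shows "omega_limit f w = {m - R..m + R} \<times> {s}"
proof (intro subset_antisym subsetI)
  fix z assume "z \<in> omega_limit f w"
  then obtain r where r: "strict_mono r" "(\<lambda>n. (x (r n), y (r n))) \<longlonglongrightarrow> z"
    unfolding omega_limit_def orbit by blast
  have "(\<lambda>n. y (r n)) \<longlonglongrightarrow> snd z"
    using tendsto_snd[OF r(2)] by simp
  moreover have "(\<lambda>n. y (r n)) \<longlonglongrightarrow> s"
    using LIMSEQ_subseq_LIMSEQ[OF y r(1)] by (simp add: o_def)
  ultimately have "snd z = s" using LIMSEQ_unique by blast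
  moreover have "fst z \<in> {m - R..m + R}"
  proof -
    have "(\<lambda>n. x (r n)) \<longlonglongrightarrow> fst z"
      using tendsto_fst[OF r(2)] by simp
    moreover have "(\<lambda>n. x (r n) - sweep m R (t + r n)) \<longlonglongrightarrow> 0"
      using LIMSEQ_subseq_LIMSEQ[OF x r(1)] by (simp add: o_def)
    ultimately have lim: "(\<lambda>n. sweep m R (t + r n)) \<longlonglongrightarrow> fst z"
      using tendsto_diff[of "\<lambda>n. x (r n)" "fst z" _ "\<lambda>n. x (r n) - sweep m R (t + r n)" 0] by simp
    have "\<bar>R * sin u\<bar> \<le> R" for u
      using R abs_sin_le_one[of u] by (simp add: abs_mult mult_left_le)
    then have "sweep m R u \<in> {m - R..m + R}" for u
      unfolding sweep_def by (auto simp: abs_le_iff) (smt (verit))+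
    then show ?thesis
      using closed_sequentially[OF closed_atLeastAtMost _ lim] by blast
  qed
  ultimately show "z \<in> {m - R..m + R} \<times> {s}"
    by (metis mem_Times_iff singletonI)
next
  fix z assume z: "z \<in> {m - R..m + R} \<times> {s}"
  obtain \<theta> where \<theta>: "fst z = m + R * sin \<theta>"
  proof (cases "R = 0")
    case True then show ?thesis using z that by fastforce
  next
    case False
    then have "sin (arcsin ((fst z - m) / R)) = (fst z - m) / R"
      using z R by (intro sin_arcsin) (auto simp: divide_simps)
    then have "fst z = m + R * sin (arcsin ((fst z - m) / R))" using False by simp
    then show ?thesis using that by blast
  qed
  show "z \<in> omega_limit f w"
    unfolding omega_limit_iff
  proof (intro allI impI)
    fix e :: real and N :: nat assume e: "e > 0"
    obtain N1 where N1: "\<And>n. n \<ge> N1 \<Longrightarrow> \<bar>x n - sweep m R (t + n)\<bar> < e / 3"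
      using LIMSEQ_D[OF x, of "e/3"] e by auto
    obtain N2 where N2: "\<And>n. n \<ge> N2 \<Longrightarrow> \<bar>y n - s\<bar> < e / 3"
      using LIMSEQ_D[OF y, of "e/3"] e by auto
    obtain N3 :: nat where N3: "3 * (R + 1) / e \<le> real N3" using real_arch_simple by blast
    define N4 where "N4 = max N (max N1 (max N2 N3))"
    obtain j :: nat where j: "real N4 + 2 + t - \<theta> \<le> real j" using real_arch_simple by blast
    define \<tau> where "\<tau> = \<theta> + 2 * real j * pi"
    have "real j * 1 \<le> real j * (2 * pi)"
      using pi_ge_two by (intro mult_left_mono) auto
    then have "real N4 + 2 + t \<le> \<tau>" using j by (simp add: \<tau>_def mult.commute mult.left_commute)
    then have big: "real N4 + 1 + t + 1 \<le> exp \<tau>" using exp_ge_add_one_self[of \<tau>] by linarith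
    \<comment> \<open>The last time with 1 + t + n at most \<open>exp \<tau>\<close>; the clock then
      misses \<tau> by at most 1 / (1 + t + n).\<close>
    define n where "n = nat \<lfloor>exp \<tau> - 1 - t\<rfloor>"
    have n: "real n \<le> exp \<tau> - 1 - t" "exp \<tau> - 1 - t < real n + 1"
      using big by (auto simp: n_def)
    then have nN: "n \<ge> N4" using big by linarith
    have "\<bar>ln (exp \<tau>) - ln (1 + (t + n))\<bar> \<le> \<bar>exp \<tau> - (1 + (t + n))\<bar> / min (1 + (t + n)) (exp \<tau>)"
      using t by (intro abs_ln_diff_le) auto
    also have "\<dots> \<le> 1 / (1 + (t + n))"
      using n t by (simp add: min_def divide_right_mono)
    finally have a: "\<bar>\<tau> - ln (1 + (t + n))\<bar> \<le> 1 / (1 + (t + n))" by simp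
    have "sin \<tau> = sin \<theta>"
      unfolding \<tau>_def by (simp add: sin_add del: cos_2npi sin_2npi) (simp add: sin_2npi cos_2npi)
    then have "\<bar>fst z - sweep m R (t + n)\<bar> = R * \<bar>sin \<tau> - sin (ln (1 + (t + n)))\<bar>"
      using R by (simp add: \<theta> sweep_def abs_mult flip: right_diff_distrib)
    also have "\<dots> \<le> R * (1 / (1 + (t + n)))"
      using R a abs_sin_diff_le[of \<tau> "ln (1 + (t + n))"] by (intro mult_left_mono) linarith+
    also have "\<dots> < e / 3"
    proof -
      have "3 * (R + 1) \<le> e * real N3" using N3 e by (simp add: field_simps)
      also have "\<dots> \<le> e * (1 + (t + n))"
        using nN t e by (intro mult_left_mono) (auto simp: N4_def)
      finally have "3 * R < e * (1 + (t + n))" by simp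
      then show ?thesis using t by (simp add: field_simps)
    qed
    finally have b: "\<bar>fst z - sweep m R (t + n)\<bar> < e / 3" .
    have "dist ((f ^^ n) w) z \<le> \<bar>x n - fst z\<bar> + \<bar>y n - snd z\<bar>"
      unfolding orbit by (cases z) (simp add: dist_Pair_Pair dist_real_def sqrt_sum_squares_le_sum_abs)
    also have "\<bar>x n - fst z\<bar> + \<bar>y n - snd z\<bar> < e"
    proof -
      have "snd z = s" using z by auto
      moreover have "\<bar>x n - sweep m R (t + n)\<bar> < e / 3" "\<bar>y n - s\<bar> < e / 3"
        using N1[of n] N2[of n] nN by (simp_all add: N4_def)
      ultimately show ?thesis using b by linarith
    qed
    finally show "\<exists>n\<ge>N. dist ((f ^^ n) w) z < e"
      using nN by (auto simp: N4_def)
  qed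
qed

section \<open>Homeomorphisms of the square with steered orbits\<close>

lemma omega_limit_shift: "omega_limit f ((f ^^ k) w) = omega_limit f w"
proof -
  have eq: "(f ^^ n) ((f ^^ k) w) = (f ^^ (n + k)) w" for n
    by (simp add: funpow_add)
  show ?thesis
  proof (intro set_eqI iffI)
    fix y assume y: "y \<in> omega_limit f ((f ^^ k) w)"
    show "y \<in> omega_limit f w"
      unfolding omega_limit_iff
    proof (intro allI impI)
      fix e :: real and N :: nat assume "e > 0"
      then obtain n where "n \<ge> N" "dist ((f ^^ (n + k)) w) y < e"
        using y unfolding omega_limit_iff eq by blast
      then show "\<exists>n\<ge>N. dist ((f ^^ n) w) y < e" by (meson trans_le_add1)
    qed
  next
    fix y assume y: "y \<in> omega_limit f w"
    show "y \<in> omega_limit f ((f ^^ k) w)"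
      unfolding omega_limit_iff eq
    proof (intro allI impI)
      fix e :: real and N :: nat assume "e > 0"
      then obtain n where n: "n \<ge> N + k" "dist ((f ^^ n) w) y < e"
        using y unfolding omega_limit_iff by blast
      then show "\<exists>n\<ge>N. dist ((f ^^ (n + k)) w) y < e"
        by (intro exI[of _ "n - k"]) auto
    qed
  qed
qed

section \<open>Horizontal pushes of the square\<close>

lemma mem_sq: "(x, y) \<in> sq \<longleftrightarrow> \<bar>x\<bar> \<le> 1 \<and> \<bar>y\<bar> \<le> 1"
  by (auto simp: sq_def JJ_def)

lemma compact_sq: "compact sq"
  unfolding sq_def JJ_def by (intro compact_Times) auto

lemma homeomorphism_sqI:
  assumes "continuous_on sq f" "f ` sq = sq" "inj_on f sq"
  obtains g where "homeomorphism sq sq f g"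
  using homeomorphism_compact[OF compact_sq assms] by blast

text \<open>With \<open>u = gain * \<rho>\<close> and \<open>e = gain\<close> this is the step of
  \<open>tracking\<close>. The coefficients are kept apart because \<rho> need not converge at the
  horizontal sides, whereas its product with the gain tends to 0 there. The factor
  \<open>1 - (fst p)^2\<close> fixes the vertical edges.\<close>

definition push :: "(real \<Rightarrow> real) \<Rightarrow> (real \<Rightarrow> real) \<Rightarrow> pt \<Rightarrow> pt" where
  "push u e p = (fst p + (u (snd p) - e (snd p) * fst p) * (1 - (fst p)\<^sup>2), snd p)"

lemma push_fixed: "u (snd p) = 0 \<Longrightarrow> e (snd p) = 0 \<Longrightarrow> push u e p = p"
  by (cases p) (simp add: push_def)

lemma fst_push_less:
  assumes ue: "\<bar>u y\<bar> \<le> e y" "e y \<le> 1 / 8" and x: "\<bar>x\<bar> \<le> 1" "\<bar>x'\<bar> \<le> 1" "x < x'"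
  shows "fst (push u e (x, y)) < fst (push u e (x', y))"
proof -
  define u0 e0 where "u0 = u y" and "e0 = e y"
  have ue0: "\<bar>u0\<bar> \<le> e0" "e0 \<le> 1/8" using ue by (auto simp: u0_def e0_def)
  have "fst (push u e (x', y)) - fst (push u e (x, y)) =
      (x' - x) * (1 - u0 * (x + x') - e0 + e0 * (x\<^sup>2 + x * x' + x'\<^sup>2))"
    by (simp add: push_def u0_def e0_def power2_eq_square algebra_simps)
  moreover have "0 < 1 - u0 * (x + x') - e0 + e0 * (x\<^sup>2 + x * x' + x'\<^sup>2)"
  proof -
    have "\<bar>u0 * (x + x')\<bar> \<le> (1/8) * 2"
      unfolding abs_mult using x ue0 by (intro mult_mono) auto
    moreover have "x\<^sup>2 + x * x' + x'\<^sup>2 = (x\<^sup>2 + x'\<^sup>2 + (x + x')\<^sup>2) / 2"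
      by (simp add: power2_sum)
    then have "0 \<le> x\<^sup>2 + x * x' + x'\<^sup>2"
      by (metis add_nonneg_nonneg divide_nonneg_nonneg zero_le_numeral zero_le_power2)
    then have "0 \<le> e0 * (x\<^sup>2 + x * x' + x'\<^sup>2)" using ue0 by auto
    ultimately show ?thesis using ue0 by linarith
  qed
  ultimately show ?thesis using x by (metis diff_gt_0_iff_gt mult_pos_pos)
qed

text \<open>Every horizontal line is mapped to itself, strictly increasingly and with fixed ends,
  hence bijectively. Continuity of the inverse comes from compactness.\<close>

lemma push_homeomorphism:
  assumes cont: "continuous_on {-1..1} u" "continuous_on {-1..1} e"
    and ue: "\<And>y. \<bar>u y\<bar> \<le> e y" "\<And>y. e y \<le> 1 / 8"
  obtains g where "homeomorphism sq sq (push u e) g"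
proof (rule homeomorphism_sqI)
  have snd_sq: "snd ` sq \<subseteq> {-1..1}" by (auto simp: sq_def JJ_def)
  have c: "continuous_on sq (\<lambda>p. u (snd p))" "continuous_on sq (\<lambda>p. e (snd p))"
    using cont snd_sq by (auto intro!: continuous_on_compose2[where f = snd] continuous_intros)
  show C: "continuous_on sq (push u e)"
    unfolding push_def by (intro continuous_intros c)
  have less: "fst (push u e (x, y)) < fst (push u e (x', y))"
    if "\<bar>x\<bar> \<le> 1" "\<bar>x'\<bar> \<le> 1" "x < x'" for x x' y
    using fst_push_less[of u y e x x'] ue that by simp
  have ends: "push u e (1, y) = (1, y)" "push u e (-1, y) = (-1, y)" for y
    by (simp_all add: push_def)
  have "push u e (x, y) \<in> sq" if "(x, y) \<in> sq" for x y
  proof -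
    have "fst (push u e (x, y)) \<le> 1"
      using less[of x 1 y] ends(1)[of y] that by (cases "x < 1") (auto simp: mem_sq)
    moreover have "-1 \<le> fst (push u e (x, y))"
      using less[of "-1" x y] ends(2)[of y] that by (cases "-1 < x") (auto simp: mem_sq)
    ultimately show ?thesis
      using that by (cases "push u e (x, y)") (auto simp: mem_sq push_def)
  qed
  moreover have "(x, y) \<in> push u e ` sq" if xy: "(x, y) \<in> sq" for x y
  proof -
    have "continuous_on {-1..1} (\<lambda>r. fst (push u e (r, y)))"
      using that by (intro continuous_intros continuous_on_compose2[OF C]) (auto simp: mem_sq)
    then obtain r where "-1 \<le> r" "r \<le> 1" "fst (push u e (r, y)) = x"
      using IVT'[of "\<lambda>r. fst (push u e (r, y))" "-1" x 1] xy by (auto simp: ends mem_sq abs_le_iff)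
    then show ?thesis
      using that by (intro image_eqI[of _ _ "(r, y)"]) (auto simp: mem_sq push_def)
  qed
  ultimately show "push u e ` sq = sq" by (auto simp: image_subset_iff)
  show "inj_on (push u e) sq"
  proof (rule inj_onI)
    fix p q assume pq: "p \<in> sq" "q \<in> sq" "push u e p = push u e q"
    then have "snd p = snd q" by (simp add: push_def)
    moreover have "fst p = fst q"
    proof (rule ccontr)
      assume "fst p \<noteq> fst q"
      then show False
        using less[of "fst p" "fst q" "snd p"] less[of "fst q" "fst p" "snd p"] pq calculation
        by (cases p; cases q; force simp: mem_sq)
    qed
    ultimately show "p = q" by (simp add: prod_eq_iff)
  qed
qed

section \<open>Vertical shears in the height coordinate\<close>

lemma tanh_artanh: "tanh (artanh y) = y" if "\<bar>y\<bar> < 1" for y :: real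
proof -
  have "(1 + y) / (1 - y) > 0" using that by (auto simp: abs_less_iff)
  then have "exp (- 2 * artanh y) = (1 - y) / (1 + y)"
    by (simp add: artanh_def exp_minus)
  moreover have "1 + y \<noteq> 0" using that by auto
  then have "(1 - (1 - y) / (1 + y)) / (1 + (1 - y) / (1 + y)) = y"
    by (simp add: divide_simps)
  ultimately show ?thesis
    by (simp only: tanh_real_altdef)
qed

lemma tanh_add_real: "tanh (s + t) = (tanh s + tanh t) / (1 + tanh s * tanh t)" for s t :: real
  by (rule tanh_add) (simp_all add: cosh_real_pos less_imp_neq[symmetric])

text \<open>In the coordinate \<open>artanh y\<close> this map adds \<open>c + l x + m y\<close> to the height.\<close>

definition lift :: "real \<Rightarrow> real \<Rightarrow> real \<Rightarrow> pt \<Rightarrow> pt" where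
  "lift c l m p = (let \<sigma> = tanh (c + l * fst p + m * snd p)
     in (fst p, (snd p + \<sigma>) / (1 + snd p * \<sigma>)))"

lemma one_plus_mult_pos: "0 < 1 + y * \<sigma>" if "\<bar>y\<bar> \<le> 1" "\<bar>\<sigma>\<bar> < 1" for y \<sigma> :: real
proof -
  have "\<bar>y * \<sigma>\<bar> \<le> 1 * \<bar>\<sigma>\<bar>" unfolding abs_mult using that by (intro mult_right_mono) auto
  then show ?thesis using that by linarith
qed

lemma lift_ends: "lift c l m (x, 1) = (x, 1)" "lift c l m (x, -1) = (x, -1)"
proof -
  have "1 + tanh r \<noteq> 0" "1 - tanh r \<noteq> 0" for r :: real
    using tanh_real_bounds[of r] by auto
  then show "lift c l m (x, 1) = (x, 1)" "lift c l m (x, -1) = (x, -1)"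
    by (simp_all add: lift_def Let_def divide_eq_eq)
qed

lemma lift_tanh: "lift c l m (x, tanh t) = (x, tanh (t + (c + l * x + m * tanh t)))"
  by (simp add: lift_def Let_def tanh_add_real)

text \<open>For inner y = tanh t the new height t + c + l x + m tanh t is strictly increasing in t
  because m is nonnegative. The ends y = 1 and y = -1 have no finite height and are compared
  separately.\<close>

lemma snd_lift_less:
  assumes m: "m \<ge> 0" and y: "\<bar>y\<bar> \<le> 1" "\<bar>y'\<bar> \<le> 1" "y < y'"
  shows "snd (lift c l m (x, y)) < snd (lift c l m (x, y'))"
proof -
  have bd: "-1 < tanh r" "tanh r < 1" for r :: real using tanh_real_bounds[of r] by auto
  have int: "snd (lift c l m (x, r)) \<in> {-1<..<1}" if "\<bar>r\<bar> < 1" for r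
    using lift_tanh[of c l m x "artanh r"] tanh_artanh[OF that] bd by simp
  consider "y = -1" "y' = 1" | "y = -1" "\<bar>y'\<bar> < 1" | "\<bar>y\<bar> < 1" "y' = 1" | "\<bar>y\<bar> < 1" "\<bar>y'\<bar> < 1"
    using y by fastforce
  then show ?thesis
  proof cases
    case 4
    define t t' where "t = artanh y" and "t' = artanh y'"
    have t: "y = tanh t" "y' = tanh t'" using 4 by (simp_all add: t_def t'_def tanh_artanh)
    then have "t < t'" using y(3) by simp
    moreover have "m * tanh t \<le> m * tanh t'" using m y(3) t by (intro mult_left_mono) auto
    ultimately show ?thesis unfolding t lift_tanh by simp
  qed (use int in \<open>force simp: lift_ends\<close>)+
qed

lemma lift_homeomorphism:
  assumes m: "m \<ge> 0"
  obtains g where "homeomorphism sq sq (lift c l m) g"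
proof (rule homeomorphism_sqI)
  have bd: "\<bar>tanh r\<bar> < 1" for r :: real using tanh_real_bounds[of r] by auto
  have pos: "1 + snd p * tanh r \<noteq> 0" if "p \<in> sq" for p :: pt and r :: real
    using one_plus_mult_pos[of "snd p" "tanh r"] bd[of r] that by (cases p) (auto simp: mem_sq)
  show C: "continuous_on sq (lift c l m)"
    unfolding lift_def Let_def using pos by (intro continuous_intros) (auto simp: cosh_real_pos less_imp_neq[symmetric])
  have "lift c l m (x, y) \<in> sq" if "(x, y) \<in> sq" for x y
  proof -
    have "snd (lift c l m (x, y)) \<le> 1"
      using snd_lift_less[OF m, of y 1 c l x] that by (cases "y < 1") (auto simp: mem_sq lift_ends)
    moreover have "-1 \<le> snd (lift c l m (x, y))"
      using snd_lift_less[OF m, of "-1" y c l x] that by (cases "-1 < y") (auto simp: mem_sq lift_ends)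
    moreover have "fst (lift c l m (x, y)) = x" by (simp add: lift_def Let_def)
    ultimately show ?thesis
      using that by (cases "lift c l m (x, y)") (auto simp: mem_sq)
  qed
  moreover have "(x, y) \<in> lift c l m ` sq" if xy: "(x, y) \<in> sq" for x y
  proof -
    have "continuous_on {-1..1} (\<lambda>r. snd (lift c l m (x, r)))"
      using that by (intro continuous_intros continuous_on_compose2[OF C]) (auto simp: mem_sq)
    then obtain r where "-1 \<le> r" "r \<le> 1" "snd (lift c l m (x, r)) = y"
      using IVT'[of "\<lambda>r. snd (lift c l m (x, r))" "-1" y 1] xy by (auto simp: lift_ends mem_sq abs_le_iff)
    then show ?thesis
      using that by (intro image_eqI[of _ _ "(x, r)"]) (auto simp: mem_sq lift_def Let_def)
  qed
  ultimately show "lift c l m ` sq = sq" by (auto simp: image_subset_iff)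
  show "inj_on (lift c l m) sq"
  proof (rule inj_onI)
    fix p q assume pq: "p \<in> sq" "q \<in> sq" "lift c l m p = lift c l m q"
    then have "fst p = fst q" by (simp add: lift_def Let_def)
    moreover have "snd p = snd q"
    proof (rule ccontr)
      assume "snd p \<noteq> snd q"
      then show False
        using snd_lift_less[OF m, of "snd p" "snd q" c l "fst p"]
          snd_lift_less[OF m, of "snd q" "snd p" c l "fst p"] pq calculation
        by (cases p; cases q; force simp: mem_sq)
    qed
    ultimately show "p = q" by (simp add: prod_eq_iff)
  qed
qed

text \<open>\<open>artanh\<close> carries no information at \<open>\<plusminus>1\<close>, so the value there is set to the limit \<open>0\<close>.\<close>

definition on_heights :: "(real \<Rightarrow> real) \<Rightarrow> real \<Rightarrow> real" where
  "on_heights f y = (if \<bar>y\<bar> < 1 then f (artanh y) else 0)"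

lemma on_heights_tanh [simp]: "on_heights f (tanh t) = f t"
  using tanh_real_bounds[of t] by (auto simp: on_heights_def artanh_tanh_real)

lemma on_heights_ends [simp]: "on_heights f 1 = 0" "on_heights f (-1) = 0"
  by (simp_all add: on_heights_def)

lemma continuous_on_on_heights:
  assumes f: "continuous_on UNIV f" "(f \<longlongrightarrow> 0) at_top" "(f \<longlongrightarrow> 0) at_bot"
  shows "continuous_on {-1..1} (on_heights f)"
proof -
  have "continuous_on {-1<..<1} (\<lambda>y. f (artanh y))"
    by (intro continuous_on_compose2[OF f(1)] continuous_intros) auto
  then have "continuous_on {-1<..<1} (on_heights f)"
    by (rule continuous_on_eq) (auto simp: on_heights_def)
  then have int: "isCont (on_heights f) y" if "\<bar>y\<bar> < 1" for y
    using that by (subst (asm) continuous_on_eq_continuous_at) (auto simp: abs_less_iff)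
  have l: "(on_heights f \<longlongrightarrow> 0) (at_left 1)"
  proof (rule Lim_transform_eventually)
    show "((\<lambda>y. f (artanh y)) \<longlongrightarrow> 0) (at_left 1)"
      by (rule filterlim_compose[OF f(2) artanh_real_at_left_1])
    show "eventually (\<lambda>y. f (artanh y) = on_heights f y) (at_left 1)"
      using eventually_at_left_real[of 0 "1::real"] by (auto elim!: eventually_mono simp: on_heights_def)
  qed
  have r: "(on_heights f \<longlongrightarrow> 0) (at_right (-1))"
  proof (rule Lim_transform_eventually)
    show "((\<lambda>y. f (artanh y)) \<longlongrightarrow> 0) (at_right (-1))"
      by (rule filterlim_compose[OF f(3) artanh_real_at_right_1])
    show "eventually (\<lambda>y. f (artanh y) = on_heights f y) (at_right (-1))"
      using eventually_at_right_real[of "-1::real" 0] by (auto elim!: eventually_mono simp: on_heights_def)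
  qed
  show ?thesis
    unfolding continuous_on_eq_continuous_within
  proof
    fix y :: real assume y: "y \<in> {-1..1}"
    consider "\<bar>y\<bar> < 1" | "y = 1" | "y = -1" using y by fastforce
    then show "continuous (at y within {-1..1}) (on_heights f)"
    proof cases
      case 1 then show ?thesis using int continuous_at_imp_continuous_at_within by blast
    next
      case 2 then show ?thesis
        using l by (simp add: continuous_within at_within_Icc_at_left)
    next
      case 3 then show ?thesis
        using r by (simp add: continuous_within at_within_Icc_at_right)
    qed
  qed
qed

text \<open>By \<open>sep\<close> different v use disjoint sets of heights, so their values do not
  conflict. If each v starts late enough, all these heights together form a closed set without limit
  points. Any function is continuous on it, and Tietze extends it with the same bound.\<close>

lemma interpolation:
  fixes \<tau> :: "'a \<Rightarrow> real" and f :: "'a \<Rightarrow> real \<Rightarrow> real"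
  assumes V: "countable V"
    and sep: "\<And>v w. v \<in> V \<Longrightarrow> w \<in> V \<Longrightarrow> v \<noteq> w \<Longrightarrow> \<tau> v - \<tau> w \<notin> \<int>"
    and f: "\<And>v s. v \<in> V \<Longrightarrow> \<bar>f v s\<bar> \<le> 1"
  obtains \<rho> K where "continuous_on UNIV \<rho>" "\<And>s. \<bar>\<rho> s\<bar> \<le> 1"
    "\<And>v k. v \<in> V \<Longrightarrow> k \<ge> K v \<Longrightarrow> \<rho> (\<tau> v + real k) = f v (\<tau> v + real k)"
proof -
  define e where "e = to_nat_on V"
  have inj: "inj_on e V" unfolding e_def using V by (rule inj_on_to_nat_on)
  \<comment> \<open>Starting at \<open>K v\<close> puts every height used for v at or above the
    number \<open>e v\<close>. So only finitely many v contribute heights below a given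
    \<open>M\<close>.\<close>
  define K where "K v = e v + nat \<lceil>\<bar>\<tau> v\<bar>\<rceil>" for v
  define P where "P = {\<tau> v + real k | v k. v \<in> V \<and> K v \<le> k}"
  have fin: "finite (P \<inter> {..<M})" for M
  proof (rule finite_subset)
    let ?V = "{v \<in> V. e v \<le> nat \<lfloor>M\<rfloor>}"
    show "finite ((\<lambda>(v, k). \<tau> v + real k) ` (SIGMA v:?V. {..nat \<lfloor>M + \<bar>\<tau> v\<bar>\<rfloor>}))"
    proof (intro finite_imageI finite_SigmaI)
      have "e ` ?V \<subseteq> {..nat \<lfloor>M\<rfloor>}" by auto
      then show "finite ?V"
        using inj by (metis (no_types, lifting) finite_atMost finite_imageD finite_subset inj_on_subset mem_Collect_eq subsetI)
    qed auto
    show "P \<inter> {..<M} \<subseteq> (\<lambda>(v, k). \<tau> v + real k) ` (SIGMA v:?V. {..nat \<lfloor>M + \<bar>\<tau> v\<bar>\<rfloor>})"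
    proof
      fix s assume "s \<in> P \<inter> {..<M}"
      then obtain v k where vk: "s = \<tau> v + real k" "v \<in> V" "K v \<le> k" "s < M"
        by (auto simp: P_def)
      have "\<bar>\<tau> v\<bar> \<le> real (nat \<lceil>\<bar>\<tau> v\<bar>\<rceil>)" by linarith
      then have "real (e v) \<le> s" using vk(1,3) unfolding K_def by linarith
      then have "e v \<le> nat \<lfloor>M\<rfloor>" using vk(4) by linarith
      moreover have "k \<le> nat \<lfloor>M + \<bar>\<tau> v\<bar>\<rfloor>" using vk(1,4) by linarith
      ultimately show "s \<in> (\<lambda>(v, k). \<tau> v + real k) ` (SIGMA v:?V. {..nat \<lfloor>M + \<bar>\<tau> v\<bar>\<rfloor>})"
        using vk by (intro image_eqI[of _ _ "(v, k)"]) auto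
    qed
  qed
  have nolim: "\<not> s islimpt P" for s
  proof
    assume "s islimpt P"
    then have "infinite (P \<inter> {..<s + 1})"
      unfolding islimpt_eq_acc_point by (metis Int_commute less_add_one lessThan_iff open_lessThan)
    then show False using fin by blast
  qed
  have clP: "closed P" using nolim by (simp add: closed_limpt)
  \<comment> \<open>On \<open>P\<close> the description is meaningful: if two elements of
    \<open>V\<close> qualified for the same s, their \<tau>-values would differ by an
    integer.\<close>
  define f0 where "f0 s = f (THE v. v \<in> V \<and> s - \<tau> v \<in> \<int>) s" for s
  have f0: "f0 (\<tau> v + real k) = f v (\<tau> v + real k)" if v: "v \<in> V" for v k
  proof -
    have "(THE w. w \<in> V \<and> (\<tau> v + real k) - \<tau> w \<in> \<int>) = v"
    proof (rule the_equality)
      fix w assume w: "w \<in> V \<and> (\<tau> v + real k) - \<tau> w \<in> \<int>"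
      then have "(\<tau> v + real k) - \<tau> w - real k \<in> \<int>" using Ints_diff Ints_of_nat by blast
      then have "\<tau> v - \<tau> w \<in> \<int>" by simp
      then show "w = v" using sep v w by blast
    qed (use v in auto)
    then show ?thesis by (simp add: f0_def)
  qed
  have "continuous_on P f0"
    unfolding continuous_on_eq_continuous_within
    using nolim by (auto intro!: continuous_trivial_limit simp: trivial_limit_within)
  moreover have "norm (f0 s) \<le> 1" if "s \<in> P" for s
    using that f0 f by (auto simp: P_def)
  ultimately obtain \<rho> where \<rho>: "continuous_on UNIV \<rho>" "\<And>s. s \<in> P \<Longrightarrow> \<rho> s = f0 s"
      "\<And>s. s \<in> UNIV \<Longrightarrow> norm (\<rho> s) \<le> 1"
    using Tietze[of P f0 UNIV 1] clP by auto
  show ?thesis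
  proof (rule that)
    show "continuous_on UNIV \<rho>" by fact
    show "\<bar>\<rho> s\<bar> \<le> 1" for s using \<rho>(3)[of s] by simp
    show "\<rho> (\<tau> v + real k) = f v (\<tau> v + real k)" if "v \<in> V" "k \<ge> K v" for v k
      using \<rho>(2)[of "\<tau> v + real k"] f0[OF that(1)] that by (auto simp: P_def)
  qed
qed

text \<open>The sign \<sigma> treats both sides at once, the height being
  \<open>\<sigma> * t\<close> at time t. Assumption \<open>A\<close> holds at all times and carries
  the orbit through its beginning, where the horizontal motion is not controlled. From some
  \<open>N\<close> on, \<open>B\<close> and the prescribed values of \<rho> give the recursion of
  \<open>tracking\<close>, and a finite beginning does not change the limit set.\<close>

lemma omega_limit_half_orbit:
  fixes g :: "pt \<Rightarrow> pt" and \<sigma> t0 m R :: real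
  assumes \<sigma>: "\<sigma> = 1 \<or> \<sigma> = -1"
    and A: "\<And>x t. \<bar>x\<bar> < 1 \<Longrightarrow> \<exists>x'. \<bar>x'\<bar> < 1 \<and> g (x, tanh (\<sigma> * t)) = (x', tanh (\<sigma> * (t + 1)))"
    and B: "\<And>x t. \<bar>x\<bar> < 1 \<Longrightarrow> t \<ge> 0 \<Longrightarrow>
      g (x, tanh (\<sigma> * t)) = (x + gain t * (\<rho> t - x) * (1 - x\<^sup>2), tanh (\<sigma> * (t + 1)))"
    and \<rho>: "\<And>k. k \<ge> K \<Longrightarrow> \<rho> (t0 + real k) = sweep m R (t0 + real k)"
    and x0: "\<bar>x0\<bar> < 1" and R: "R \<ge> 0" "\<bar>m\<bar> + R < 1"
  shows "omega_limit g (x0, tanh (\<sigma> * t0)) = {m - R..m + R} \<times> {\<sigma>}"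
proof -
  have orb: "\<exists>x. \<bar>x\<bar> < 1 \<and> (g ^^ n) (x0, tanh (\<sigma> * t0)) = (x, tanh (\<sigma> * (t0 + real n)))" for n
  proof (induction n)
    case 0 show ?case using x0 by auto
  next
    case (Suc n)
    then obtain x where x: "\<bar>x\<bar> < 1" "(g ^^ n) (x0, tanh (\<sigma> * t0)) = (x, tanh (\<sigma> * (t0 + real n)))"
      by blast
    then show ?case using A[OF x(1), of "t0 + real n"] by (auto simp: add.assoc add.commute)
  qed
  then obtain X where X: "\<And>n. \<bar>X n\<bar> < 1"
    "\<And>n. (g ^^ n) (x0, tanh (\<sigma> * t0)) = (X n, tanh (\<sigma> * (t0 + real n)))"
    by metis
  obtain N0 :: nat where "1 - t0 \<le> real N0" using real_arch_simple by blast
  then obtain N where N: "N \<ge> K" "t0 + real N \<ge> 1"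
    using that[of "max K N0"] by (auto simp: max_def algebra_simps split: if_splits)
  define x where "x n = X (N + n)" for n
  define t where "t = t0 + real N"
  have orb': "(g ^^ n) ((g ^^ N) (x0, tanh (\<sigma> * t0))) = (x n, tanh (\<sigma> * (t + real n)))" for n
  proof -
    have "(g ^^ n) ((g ^^ N) (x0, tanh (\<sigma> * t0))) = (X (n + N), tanh (\<sigma> * (t0 + real (n + N))))"
      using X(2)[of "n + N"] by (simp add: funpow_add)
    then show ?thesis by (simp add: x_def t_def add.commute add.left_commute)
  qed
  have "x (Suc n) = x n + gain (t + n) * (sweep m R (t + n) - x n) * (1 - (x n)\<^sup>2)" for n
  proof -
    have "(x (Suc n), tanh (\<sigma> * (t + real (Suc n)))) = g (x n, tanh (\<sigma> * (t + real n)))"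
      using orb'[of n] orb'[of "Suc n"] by simp
    moreover have "\<rho> (t + real n) = sweep m R (t + real n)"
      using \<rho>[of "N + n"] N by (simp add: t_def add.assoc)
    ultimately show ?thesis
      using B[of "x n" "t + real n"] X(1)[of "N + n"] N by (simp add: x_def t_def)
  qed
  then have "(\<lambda>n. x n - sweep m R (t + n)) \<longlonglongrightarrow> 0"
    using N X(1)[of N] R by (intro tracking) (auto simp: t_def x_def)
  moreover have "(\<lambda>n. tanh (\<sigma> * (t + real n))) \<longlonglongrightarrow> \<sigma>"
  proof -
    have f: "filterlim (\<lambda>n. t + real n) at_top sequentially"
      by (rule filterlim_tendsto_add_at_top[OF tendsto_const filterlim_real_sequentially])
    have "(\<lambda>n. tanh (t + real n)) \<longlonglongrightarrow> 1"
      by (rule filterlim_compose[OF tanh_real_at_top f])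
    then have "(\<lambda>n. \<sigma> * tanh (t + real n)) \<longlonglongrightarrow> \<sigma> * 1"
      by (intro tendsto_mult tendsto_const)
    moreover have "\<sigma> * tanh s = tanh (\<sigma> * s)" for s :: real using \<sigma> by auto
    ultimately show ?thesis by simp
  qed
  ultimately have "omega_limit g ((g ^^ N) (x0, tanh (\<sigma> * t0))) = {m - R..m + R} \<times> {\<sigma>}"
    using N R orb' by (intro omega_limit_sweep[where t = t]) (auto simp: t_def)
  then show ?thesis by (simp add: omega_limit_shift)
qed

text \<open>Each coincidence modulo an integer is a nonzero polynomial equation in \<open>\<tau>\<close>, hence has finitely many solutions.\<close>

lemma generic_shear:
  assumes V: "countable V"
  obtains \<tau> :: real where "\<And>v w :: pt. v \<in> V \<Longrightarrow> w \<in> V \<Longrightarrow> v \<noteq> w \<Longrightarrow>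
    (h v + \<tau> * fst v + \<tau>\<^sup>2 * snd v) - (h w + \<tau> * fst w + \<tau>\<^sup>2 * snd w) \<notin> \<int>"
proof -
  define bad where "bad v w k = {\<tau>. (h v + \<tau> * fst v + \<tau>\<^sup>2 * snd v) -
    (h w + \<tau> * fst w + \<tau>\<^sup>2 * snd w) = real_of_int k}" for v w :: pt and k
  have fin: "finite (bad v w k)" if "v \<noteq> w" for v w k
  proof -
    define p where "p = [:h v - h w - real_of_int k, fst v - fst w, snd v - snd w:]"
    have "p \<noteq> 0" using that by (auto simp: p_def prod_eq_iff)
    moreover have "bad v w k = {\<tau>. poly p \<tau> = 0}"
      by (auto simp: bad_def p_def algebra_simps power2_eq_square)
    ultimately show ?thesis by (simp add: poly_roots_finite)
  qed
  have "countable (\<Union>v\<in>V. \<Union>w\<in>V - {v}. \<Union>k. bad v w k)"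
  proof (rule countable_UN[OF V], rule countable_UN[OF countable_Diff[OF V]], rule countable_UN)
    fix v w k assume "w \<in> V - {v}"
    then show "countable (bad v w k)" by (intro countable_finite fin) auto
  qed simp
  then have "(\<Union>v\<in>V. \<Union>w\<in>V - {v}. \<Union>k. bad v w k) \<noteq> UNIV"
    by (intro notI) (simp only: uncountable_UNIV_real)
  then obtain \<tau> where "\<tau> \<notin> (\<Union>v\<in>V. \<Union>w\<in>V - {v}. \<Union>k. bad v w k)"
    by blast
  then show ?thesis
    using that[of \<tau>] by (auto simp: bad_def Ints_def)
qed

text \<open>A push fixes the vertical edges pointwise, so its inverse cannot carry a point with |x|
  < 1 onto one of them.\<close>

lemma homeomorphism_sq_push_interior:
  assumes G: "homeomorphism sq sq (push u e) G" and p: "\<bar>x\<bar> < 1" "\<bar>y\<bar> \<le> 1"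
  shows "\<exists>x'. \<bar>x'\<bar> < 1 \<and> G (x, y) = (x', y)"
proof -
  have "(x, y) \<in> sq" using p by (simp add: mem_sq)
  then have G1: "G (x, y) \<in> sq" "push u e (G (x, y)) = (x, y)"
    using G by (auto simp: homeomorphism_def)
  obtain x' y' where xy: "G (x, y) = (x', y')" by fastforce
  have "y' = y" using G1(2) by (simp add: xy push_def)
  moreover have "\<bar>x'\<bar> \<noteq> 1"
  proof
    assume "\<bar>x'\<bar> = 1"
    then have "x'\<^sup>2 = 1" by (metis one_power2 power2_abs)
    then have "x' = x" using G1(2) by (simp add: xy push_def)
    then show False using p \<open>\<bar>x'\<bar> = 1\<close> by simp
  qed
  ultimately show ?thesis using G1(1) by (auto simp: xy mem_sq)
qed

lemma push_interior:
  assumes G: "homeomorphism sq sq (push u e) G" and p: "\<bar>x\<bar> < 1" "\<bar>y\<bar> \<le> 1"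
  shows "\<bar>fst (push u e (x, y))\<bar> < 1"
proof -
  have xy: "(x, y) \<in> sq" using p by (simp add: mem_sq)
  then have sq: "push u e (x, y) \<in> sq" "G (push u e (x, y)) = (x, y)"
    using G by (auto simp: homeomorphism_def)
  have inj: "inj_on (push u e) sq" using G by (metis homeomorphism_def inj_on_inverseI)
  have "fst (push u e (x, y)) \<noteq> 1"
  proof
    assume "fst (push u e (x, y)) = 1"
    then have "push u e (x, y) = push u e (1, y)" by (simp add: push_def)
    then have "(x, y) = (1, y)" using inj xy p by (metis inj_onD mem_sq abs_one order_refl)
    then show False using p by simp
  qed
  moreover have "fst (push u e (x, y)) \<noteq> -1"
  proof
    assume "fst (push u e (x, y)) = -1"
    then have "push u e (x, y) = push u e (-1, y)" by (simp add: push_def)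
    then have "(x, y) = (-1, y)" using inj xy p by (metis inj_onD mem_sq abs_one abs_minus_cancel order_refl)
    then show False using p by simp
  qed
  moreover have "\<bar>fst (push u e (x, y))\<bar> \<le> 1"
    using sq by (cases "push u e (x, y)") (auto simp: mem_sq)
  ultimately show ?thesis by linarith
qed

lemma lift_homeomorphism_inverse:
  assumes "homeomorphism sq sq (lift c 0 0) T" "\<bar>x\<bar> \<le> 1"
  shows "T (x, tanh t) = (x, tanh (t - c))"
proof -
  have bd: "\<bar>tanh r\<bar> \<le> 1" for r :: real using tanh_real_bounds[of r] by (auto simp: abs_le_iff)
  have *: "T (lift c 0 0 p) = p" if "p \<in> sq" for p
    using assms(1) that by (auto simp: homeomorphism_def)
  show ?thesis
    using *[of "(x, tanh (t - c))"] assms(2) bd by (simp add: lift_tanh mem_sq)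
qed

text \<open>
  The homeomorphism is \<open>G2\<^sup>-\<^sup>1 T G1\<close>, where \<open>T\<close> raises the height by one and the pushes \<open>G1\<close>, \<open>G2\<close>
  act at positive and negative heights only. Points whose heights differ by no integer visit
  disjoint sets of levels, so one target function steers all orbits independently.
\<close>

definition height :: "pt \<Rightarrow> real" where "height p = artanh (snd p)"

lemma steered_homeomorphism_separated:
  fixes V :: "pt set" and m1 R1 m2 R2 :: "pt \<Rightarrow> real"
  assumes V: "countable V" "V \<subseteq> {-1<..<1} \<times> {-1<..<1}"
    and sep: "\<And>v w. v \<in> V \<Longrightarrow> w \<in> V \<Longrightarrow> v \<noteq> w \<Longrightarrow> height v - height w \<notin> \<int>"
    and R1: "\<And>v. v \<in> V \<Longrightarrow> R1 v \<ge> 0 \<and> \<bar>m1 v\<bar> + R1 v < 1"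
    and R2: "\<And>v. v \<in> V \<Longrightarrow> R2 v \<ge> 0 \<and> \<bar>m2 v\<bar> + R2 v < 1"
  obtains g g' where "homeomorphism sq sq g g'"
    "\<And>x. \<bar>x\<bar> \<le> 1 \<Longrightarrow> g (x, 1) = (x, 1) \<and> g (x, -1) = (x, -1)"
    "\<And>v. v \<in> V \<Longrightarrow> omega_limit g v = {m1 v - R1 v..m1 v + R1 v} \<times> {1}"
    "\<And>v. v \<in> V \<Longrightarrow> omega_limit g' v = {m2 v - R2 v..m2 v + R2 v} \<times> {-1}"
proof -
  have sw: "\<bar>sweep m R s\<bar> \<le> 1" if "R \<ge> 0 \<and> \<bar>m\<bar> + R < 1" for m R s
    using abs_sweep_le[of R m s] that by linarith
  obtain \<rho>1 K1 where \<rho>1: "continuous_on UNIV \<rho>1" "\<And>s. \<bar>\<rho>1 s\<bar> \<le> 1"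
    "\<And>v k. v \<in> V \<Longrightarrow> k \<ge> K1 v \<Longrightarrow> \<rho>1 (height v + real k) = sweep (m1 v) (R1 v) (height v + real k)"
    using interpolation[OF V(1), of height "\<lambda>v. sweep (m1 v) (R1 v)"] sep sw R1 by metis
  \<comment> \<open>For the backward motion time is minus the height, so the second interpolation
    runs over the negated heights.\<close>
  have sep': "- height v - - height w \<notin> \<int>" if "v \<in> V" "w \<in> V" "v \<noteq> w" for v w
    using sep[of w v] that by simp
  obtain \<rho>2 K2 where \<rho>2: "continuous_on UNIV \<rho>2" "\<And>s. \<bar>\<rho>2 s\<bar> \<le> 1"
    "\<And>v k. v \<in> V \<Longrightarrow> k \<ge> K2 v \<Longrightarrow> \<rho>2 (- height v + real k) = sweep (m2 v) (R2 v) (- height v + real k)"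
    using interpolation[OF V(1), of "\<lambda>v. - height v" "\<lambda>v. sweep (m2 v) (R2 v)"] sep' sw R2 by metis
  define e where "e = on_heights gain"
  define u where "u \<rho> = on_heights (\<lambda>t. gain t * \<rho> t)" for \<rho>
  have e_cont: "continuous_on {-1..1} e"
    unfolding e_def using continuous_on_gain gain_at_top gain_at_bot by (rule continuous_on_on_heights)
  have gain_bound: "\<bar>gain t * \<rho> t\<bar> \<le> gain t" if "\<And>s. \<bar>\<rho> s\<bar> \<le> 1" for \<rho> t
    unfolding abs_mult using that[of t] gain_nonneg[of t] by (simp add: mult_left_le)
  have u_cont: "continuous_on {-1..1} (u \<rho>)" if \<rho>: "continuous_on UNIV \<rho>" "\<And>s. \<bar>\<rho> s\<bar> \<le> 1" for \<rho>
    unfolding u_def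
  proof (rule continuous_on_on_heights)
    show "continuous_on UNIV (\<lambda>t. gain t * \<rho> t)"
      by (intro continuous_intros continuous_on_gain \<rho>)
    have "((\<lambda>t. gain t * \<rho> t) \<longlongrightarrow> 0) F" if "(gain \<longlongrightarrow> 0) F" for F
      by (rule tendsto_0_le[OF that, where K = 1]) (use gain_bound[of \<rho>, OF \<rho>(2)] gain_nonneg in auto)
    then show "((\<lambda>t. gain t * \<rho> t) \<longlongrightarrow> 0) at_top" "((\<lambda>t. gain t * \<rho> t) \<longlongrightarrow> 0) at_bot"
      using gain_at_top gain_at_bot by blast+
  qed
  have ue: "\<bar>u \<rho> y\<bar> \<le> e y" "e y \<le> 1/8" if "\<And>s. \<bar>\<rho> s\<bar> \<le> 1" for \<rho> y
    using gain_bound[OF that] gain_le by (auto simp: u_def e_def on_heights_def)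
  have ue0: "u \<rho> y = 0" "e y = 0" if "y \<le> 0 \<or> \<bar>y\<bar> \<ge> 1" for \<rho> y
  proof -
    have "\<bar>y\<bar> < 1 \<Longrightarrow> artanh y \<le> 0"
      using that tanh_artanh[of y] by (metis not_less tanh_real_nonpos_iff)
    then show "u \<rho> y = 0" "e y = 0"
      by (auto simp: u_def e_def on_heights_def gain_nonpos_eq_0)
  qed
  obtain G1 where G1: "homeomorphism sq sq (push (u \<rho>1) e) G1"
    by (rule push_homeomorphism[OF u_cont[OF \<rho>1(1,2)] e_cont ue[OF \<rho>1(2)]])
  define u2 e2 where "u2 y = u \<rho>2 (- y)" and "e2 y = e (- y)" for y
  have "continuous_on {-1..1} u2" "continuous_on {-1..1} e2"
    unfolding u2_def e2_def
    by (rule continuous_on_compose2[OF u_cont[OF \<rho>2(1,2)]] continuous_on_compose2[OF e_cont];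
        force intro!: continuous_intros)+
  then obtain G2 where G2: "homeomorphism sq sq (push u2 e2) G2"
    using push_homeomorphism[of u2 e2] ue[of \<rho>2, OF \<rho>2(2)] unfolding u2_def e2_def by blast
  obtain T where T: "homeomorphism sq sq (lift 1 0 0) T"
    using lift_homeomorphism[of 0 1 0] by auto
  \<comment> \<open>The order of the factors matters. From a height t \<ge> 0 the map
    \<open>g\<close> pushes, lifts to t + 1, and meets \<open>G2\<close> only where
    \<open>G2\<close> is the identity. From a height -t \<le> 0 the inverse \<open>g'\<close> pushes
    by \<open>push u2 e2\<close>, lowers, and meets \<open>G1\<close> only where \<open>G1\<close>
    is the identity. So both step formulas are exact from time 0 on.\<close>
  define g where "g = G2 \<circ> (lift 1 0 0 \<circ> push (u \<rho>1) e)"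
  define g' where "g' = (G1 \<circ> T) \<circ> push u2 e2"
  have hom: "homeomorphism sq sq g g'"
    unfolding g_def g'_def
    by (rule homeomorphism_compose[OF homeomorphism_compose[OF G1 T] homeomorphism_symD[OF G2]])
  have inv: "G1 p = p" if "p \<in> sq" "snd p \<le> 0 \<or> \<bar>snd p\<bar> \<ge> 1" for p
    using homeomorphism_apply1[OF G1 that(1)] push_fixed[of "u \<rho>1" p e] ue0[OF that(2)] by simp
  have inv2: "G2 p = p" if "p \<in> sq" "snd p \<ge> 0 \<or> \<bar>snd p\<bar> \<ge> 1" for p
    using homeomorphism_apply1[OF G2 that(1)] push_fixed[of u2 p e2] ue0[of "- snd p"] that(2)
    by (simp add: u2_def e2_def)
  have bd: "\<bar>tanh r\<bar> \<le> 1" for r :: real using tanh_real_bounds[of r] by (auto simp: abs_le_iff)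
  have ends: "g (x, 1) = (x, 1) \<and> g (x, -1) = (x, -1)" if "\<bar>x\<bar> \<le> 1" for x
    using that inv2[of "(x, 1)"] inv2[of "(x, -1)"]
    by (simp add: g_def push_fixed ue0 lift_ends mem_sq)
  have push1: "push (u \<rho>1) e (x, tanh t) = (x + gain t * (\<rho>1 t - x) * (1 - x\<^sup>2), tanh t)" for x t
    by (simp add: push_def u_def e_def algebra_simps)
  have push2: "push u2 e2 (x, tanh (- t)) = (x + gain t * (\<rho>2 t - x) * (1 - x\<^sup>2), tanh (- t))" for x t
    by (simp add: push_def u2_def e2_def u_def e_def algebra_simps)
  have gA: "\<exists>x'. \<bar>x'\<bar> < 1 \<and> g (x, tanh (1 * t)) = (x', tanh (1 * (t + 1)))" if "\<bar>x\<bar> < 1" for x t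
  proof -
    have "\<bar>x + gain t * (\<rho>1 t - x) * (1 - x\<^sup>2)\<bar> < 1"
      using push_interior[OF G1 that bd[of t]] by (simp add: push1)
    from homeomorphism_sq_push_interior[OF G2 this bd[of "t + 1"]]
    show ?thesis by (simp add: g_def push1 lift_tanh)
  qed
  have g'A: "\<exists>x'. \<bar>x'\<bar> < 1 \<and> g' (x, tanh (-1 * t)) = (x', tanh (-1 * (t + 1)))" if "\<bar>x\<bar> < 1" for x t
  proof -
    let ?x = "x + gain t * (\<rho>2 t - x) * (1 - x\<^sup>2)"
    have x: "\<bar>?x\<bar> < 1"
      using push_interior[OF G2 that bd[of "- t"]] push2[of x t] by simp
    have "g' (x, tanh (-1 * t)) = G1 (?x, tanh (-1 * (t + 1)))"
      using lift_homeomorphism_inverse[OF T, of ?x "- t"] push2[of x t] x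
      by (simp add: g'_def del: tanh_minus)
    with homeomorphism_sq_push_interior[OF G1 x bd[of "-1 * (t + 1)"]] show ?thesis by simp
  qed
  have gB: "g (x, tanh (1 * t)) = (x + gain t * (\<rho>1 t - x) * (1 - x\<^sup>2), tanh (1 * (t + 1)))"
    if "\<bar>x\<bar> < 1" "t \<ge> 0" for x t
  proof -
    have "\<bar>x + gain t * (\<rho>1 t - x) * (1 - x\<^sup>2)\<bar> < 1"
      using push_interior[OF G1 that(1) bd[of t]] by (simp add: push1)
    then show ?thesis
      using that(2) bd[of "t + 1"] by (simp add: g_def push1 lift_tanh inv2 mem_sq)
  qed
  have g'B: "g' (x, tanh (-1 * t)) = (x + gain t * (\<rho>2 t - x) * (1 - x\<^sup>2), tanh (-1 * (t + 1)))"
    if "\<bar>x\<bar> < 1" "t \<ge> 0" for x t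
  proof -
    let ?x = "x + gain t * (\<rho>2 t - x) * (1 - x\<^sup>2)"
    have x: "\<bar>?x\<bar> < 1"
      using push_interior[OF G2 that(1) bd[of "- t"]] push2[of x t] by simp
    have "g' (x, tanh (-1 * t)) = G1 (?x, tanh (-1 * (t + 1)))"
      using lift_homeomorphism_inverse[OF T, of ?x "- t"] push2[of x t] x
      by (simp add: g'_def del: tanh_minus)
    also have "\<dots> = (?x, tanh (-1 * (t + 1)))"
      using x that(2) bd[of "-1 * (t + 1)"] by (intro inv) (auto simp: mem_sq)
    finally show ?thesis .
  qed
  have v: "v = (fst v, tanh (height v)) \<and> \<bar>fst v\<bar> < 1" if "v \<in> V" for v
    using V(2) that by (auto simp: height_def tanh_artanh abs_less_iff prod_eq_iff)
  show ?thesis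
  proof (rule that[OF hom ends])
    fix w assume w: "w \<in> V"
    have vw: "(fst w, tanh (height w)) = w" "\<bar>fst w\<bar> < 1" using v[OF w] by auto
    have "omega_limit g (fst w, tanh (1 * height w)) = {m1 w - R1 w..m1 w + R1 w} \<times> {1}"
      by (rule omega_limit_half_orbit[OF _ gA gB \<rho>1(3)[OF w] vw(2)]) (use R1[OF w] in auto)
    then show "omega_limit g w = {m1 w - R1 w..m1 w + R1 w} \<times> {1}"
      by (simp only: mult_1 vw)
    have "omega_limit g' (fst w, tanh (-1 * - height w)) = {m2 w - R2 w..m2 w + R2 w} \<times> {-1}"
      by (rule omega_limit_half_orbit[OF _ g'A g'B \<rho>2(3)[OF w] vw(2)]) (use R2[OF w] in auto)
    then show "omega_limit g' w = {m2 w - R2 w..m2 w + R2 w} \<times> {-1}"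
      by (simp only: minus_mult_minus mult_1 vw)
  qed
qed

text \<open>The separation hypothesis is removed by conjugation with a shear of generic parameter
  \<tau>. The shear fixes the horizontal sides pointwise, so the limit segments survive the
  conjugation unchanged.\<close>

lemma steered_homeomorphism:
  fixes V :: "pt set" and a1 b1 a2 b2 :: "pt \<Rightarrow> real"
  assumes V: "countable V" "V \<subseteq> {-1<..<1} \<times> {-1<..<1}"
    and ab1: "\<And>v. v \<in> V \<Longrightarrow> -1 < a1 v \<and> a1 v \<le> b1 v \<and> b1 v < 1"
    and ab2: "\<And>v. v \<in> V \<Longrightarrow> -1 < a2 v \<and> a2 v \<le> b2 v \<and> b2 v < 1"
  obtains g g' where "homeomorphism sq sq g g'"
    "\<And>x. \<bar>x\<bar> \<le> 1 \<Longrightarrow> g (x, 1) = (x, 1) \<and> g (x, -1) = (x, -1)"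
    "\<And>v. v \<in> V \<Longrightarrow> omega_limit g v = {a1 v..b1 v} \<times> {1}"
    "\<And>v. v \<in> V \<Longrightarrow> omega_limit g' v = {a2 v..b2 v} \<times> {-1}"
proof -
  obtain \<tau> where \<tau>: "\<And>v w :: pt. v \<in> V \<Longrightarrow> w \<in> V \<Longrightarrow> v \<noteq> w \<Longrightarrow>
    (height v + \<tau> * fst v + \<tau>\<^sup>2 * snd v) - (height w + \<tau> * fst w + \<tau>\<^sup>2 * snd w) \<notin> \<int>"
    using generic_shear[OF V(1), where h = height] by blast
  \<comment> \<open>The coefficient of the second coordinate is a square, hence nonnegative, as
    \<open>lift_homeomorphism\<close> demands.\<close>
  define \<Theta> where "\<Theta> = lift 0 \<tau> (\<tau>\<^sup>2)"
  obtain \<Theta>' where \<Theta>: "homeomorphism sq sq \<Theta> \<Theta>'"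
    unfolding \<Theta>_def using lift_homeomorphism[of "\<tau>\<^sup>2" 0 \<tau>] by auto
  have Vsq: "v \<in> sq" if "v \<in> V" for v
    using V(2) that by (auto simp: sq_def JJ_def)
  have v: "\<Theta> v = (fst v, tanh (height v + \<tau> * fst v + \<tau>\<^sup>2 * snd v)) \<and> \<bar>fst v\<bar> < 1" if "v \<in> V" for v
  proof -
    obtain x y where xy: "v = (x, y)" "\<bar>x\<bar> < 1" "\<bar>y\<bar> < 1"
      using V(2) \<open>v \<in> V\<close> by (cases v) (auto simp: abs_less_iff)
    then have "\<Theta> v = lift 0 \<tau> (\<tau>\<^sup>2) (x, tanh (height v))"
      by (simp add: \<Theta>_def height_def tanh_artanh)
    also have "\<dots> = (x, tanh (height v + (\<tau> * x + \<tau>\<^sup>2 * tanh (height v))))"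
      by (simp add: lift_tanh)
    finally show ?thesis using xy by (simp add: height_def tanh_artanh add.assoc)
  qed
  have h: "height (\<Theta> v) = height v + \<tau> * fst v + \<tau>\<^sup>2 * snd v" if "v \<in> V" for v
    using v[OF that] by (simp add: height_def artanh_tanh_real)
  have inv: "\<Theta>' (\<Theta> v) = v" if "v \<in> V" for v
    using homeomorphism_apply1[OF \<Theta> Vsq[OF that]] .
  define mid rad where "mid a b q = (a (\<Theta>' q) + b (\<Theta>' q)) / 2"
    and "rad a b q = (b (\<Theta>' q) - a (\<Theta>' q)) / 2" for a b :: "pt \<Rightarrow> real" and q
  have mid: "rad a b q \<ge> 0 \<and> \<bar>mid a b q\<bar> + rad a b q < 1"
    if "q \<in> \<Theta> ` V" "\<And>v. v \<in> V \<Longrightarrow> -1 < a v \<and> a v \<le> b v \<and> b v < 1" for a b q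
    using that inv by (fastforce simp: mid_def rad_def abs_if field_simps)
  have interval: "{mid a b (\<Theta> v) - rad a b (\<Theta> v)..mid a b (\<Theta> v) + rad a b (\<Theta> v)} = {a v..b v}"
    if "v \<in> V" for a b v
    by (simp add: mid_def rad_def inv[OF that] field_simps)
  have sub: "\<Theta> ` V \<subseteq> {-1<..<1} \<times> {-1<..<1}"
    using v tanh_real_bounds by (force simp: abs_less_iff)
  have sep: "height p - height q \<notin> \<int>" if pq: "p \<in> \<Theta> ` V" "q \<in> \<Theta> ` V" "p \<noteq> q" for p q
  proof -
    obtain v w where vw: "p = \<Theta> v" "q = \<Theta> w" "v \<in> V" "w \<in> V" "v \<noteq> w"
      using pq by blast
    then show ?thesis using \<tau>[OF vw(3-5)] h by simp
  qed
  obtain f f' where f: "homeomorphism sq sq f f'"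
    "\<And>x. \<bar>x\<bar> \<le> 1 \<Longrightarrow> f (x, 1) = (x, 1) \<and> f (x, -1) = (x, -1)"
    "\<And>q. q \<in> \<Theta> ` V \<Longrightarrow> omega_limit f q = {mid a1 b1 q - rad a1 b1 q..mid a1 b1 q + rad a1 b1 q} \<times> {1}"
    "\<And>q. q \<in> \<Theta> ` V \<Longrightarrow> omega_limit f' q = {mid a2 b2 q - rad a2 b2 q..mid a2 b2 q + rad a2 b2 q} \<times> {-1}"
    by (rule steered_homeomorphism_separated[OF countable_image[OF V(1)] sub sep
      mid[where a = a1 and b = b1, OF _ ab1] mid[where a = a2 and b = b2, OF _ ab2]], assumption+)
      (rule that, assumption, blast+)
  define g where "g = \<Theta>' \<circ> (f \<circ> \<Theta>)"
  define g' where "g' = (\<Theta>' \<circ> f') \<circ> \<Theta>"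
  have hom: "homeomorphism sq sq g g'"
    unfolding g_def g'_def
    by (rule homeomorphism_compose[OF homeomorphism_compose[OF \<Theta> f(1)] homeomorphism_symD[OF \<Theta>]])
  have im: "\<Theta>' ` sq = sq" "\<Theta> ` sq = sq" "f ` sq = sq" "f' ` sq = sq"
    using \<Theta> f(1) by (auto simp: homeomorphism_def)
  have fix': "\<Theta>' (x, 1) = (x, 1) \<and> \<Theta>' (x, -1) = (x, -1)" if "\<bar>x\<bar> \<le> 1" for x
    using homeomorphism_apply1[OF \<Theta>, of "(x, 1)"] homeomorphism_apply1[OF \<Theta>, of "(x, -1)"] that
    by (simp add: \<Theta>_def lift_ends mem_sq)
  have conj: "omega_limit (\<Theta>' \<circ> k \<circ> \<Theta>) v = {a..b} \<times> {s}"
    if "v \<in> V" "k ` sq \<subseteq> sq" "omega_limit k (\<Theta> v) = {a..b} \<times> {s}" "s = 1 \<or> s = -1"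
      "-1 < a" "b < 1" for k v a b s
  proof -
    have "omega_limit (\<Theta>' \<circ> k \<circ> \<Theta>) (\<Theta>' (\<Theta> v)) = \<Theta>' ` omega_limit k (\<Theta> v)"
    proof (rule omega_limit_semiconj[OF compact_sq])
      show "\<Theta> v \<in> sq" using Vsq[OF that(1)] im by blast
      show "continuous_on sq \<Theta>'" using \<Theta> by (simp add: homeomorphism_def)
      show "(\<Theta>' \<circ> k \<circ> \<Theta>) (\<Theta>' p) = \<Theta>' (k p)" if "p \<in> sq" for p
        using homeomorphism_apply2[OF \<Theta> that] by simp
    qed fact
    also have "\<dots> = {a..b} \<times> {s}"
    proof -
      have "\<Theta>' p = p" if "p \<in> {a..b} \<times> {s}" for p
        using that fix' \<open>s = 1 \<or> s = -1\<close> \<open>-1 < a\<close> \<open>b < 1\<close> by (auto simp: abs_le_iff)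
      then show ?thesis unfolding that(3) by (simp add: image_cong)
    qed
    finally show ?thesis by (simp only: inv[OF that(1)])
  qed
  show ?thesis
  proof (rule that[OF hom])
    show "g (x, 1) = (x, 1) \<and> g (x, -1) = (x, -1)" if "\<bar>x\<bar> \<le> 1" for x
      using f(2)[OF that] fix'[OF that] by (simp add: g_def \<Theta>_def lift_ends)
  next
    fix v assume v: "v \<in> V"
    have "omega_limit f (\<Theta> v) = {a1 v..b1 v} \<times> {1}"
      using f(3)[of "\<Theta> v"] v interval[OF v] by simp
    then show "omega_limit g v = {a1 v..b1 v} \<times> {1}"
      using conj[of v f] v im ab1[OF v] by (simp add: g_def o_assoc)
    have "omega_limit f' (\<Theta> v) = {a2 v..b2 v} \<times> {-1}"
      using f(4)[of "\<Theta> v"] v interval[OF v] by simp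
    then show "omega_limit g' v = {a2 v..b2 v} \<times> {-1}"
      using conj[of v f'] v im ab2[OF v] by (simp add: g'_def)
  qed
qed

section \<open>Discs attached to a side of the square\<close>

lemma mem_bd_sq: "(x, y) \<in> bd_sq \<longleftrightarrow> (x, y) \<in> sq \<and> (\<bar>x\<bar> = 1 \<or> \<bar>y\<bar> = 1)"
proof -
  have "interior sq = {-1<..<1} \<times> {-1<..<1}"
    by (simp add: sq_def JJ_def interior_Times)
  moreover have "closed sq"
    by (simp add: sq_def JJ_def closed_Times)
  ultimately have "bd_sq = sq - {-1<..<1} \<times> {-1<..<1}"
    by (simp add: bd_sq_def frontier_def closure_closed)
  moreover have "r \<in> {-1<..<1} \<longleftrightarrow> \<bar>r\<bar> \<noteq> 1" if "r \<in> JJ" for r :: real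
    using that by (auto simp: JJ_def)
  ultimately show ?thesis
    by (auto simp only: sq_def mem_Times_iff Diff_iff fst_conv snd_conv)
qed

lemma interior_sq: "interior sq = sq - bd_sq"
  unfolding bd_sq_def frontier_def using interior_subset closure_subset by blast

lemma Jside_subset_bd_sq: "s = 1 \<or> s = -1 \<Longrightarrow> Jside s \<subseteq> bd_sq"
  by (auto simp: Jside_def mem_bd_sq sq_def JJ_def)

lemma horizontal_arc:
  fixes g :: "real \<Rightarrow> pt"
  assumes g: "arc g" "path_image g \<subseteq> UNIV \<times> {s}"
  obtains \<alpha> \<beta> where "\<alpha> < \<beta>" "path_image g = {\<alpha>..\<beta>} \<times> {s}"
    "{pathstart g, pathfinish g} = {(\<alpha>, s), (\<beta>, s)}"
proof -
  define F where "F = fst \<circ> g"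
  have gF: "g t = (F t, s)" if "t \<in> {0..1}" for t
    using g(2) that by (fastforce simp: F_def path_image_def prod_eq_iff)
  have cont: "continuous_on {0..1} F"
    unfolding F_def using g(1) by (auto simp: arc_def path_def o_def intro: continuous_on_fst)
  have inj: "inj_on F {0..1}"
    using g(1) gF by (force simp: arc_def inj_on_def)
  have "F 0 \<noteq> F 1" using inj by (force simp: inj_on_def)
  have btw: "F t \<in> {min (F 0) (F 1)..max (F 0) (F 1)}" if "t \<in> {0..1}" for t
  proof (cases "t = 0 \<or> t = 1")
    case False
    then show ?thesis
      using continuous_inj_imp_mono[of 0 t 1 F] that cont inj by auto
  qed auto
  have img: "F ` {0..1} = {min (F 0) (F 1)..max (F 0) (F 1)}"
  proof (intro subset_antisym subsetI)
    fix y assume y: "y \<in> {min (F 0) (F 1)..max (F 0) (F 1)}"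
    have "is_interval (F ` {0..1})"
      by (simp add: is_interval_connected_1 connected_continuous_image cont)
    then show "y \<in> F ` {0..1}"
      using y mem_is_interval_1_I[of "F ` {0..1}" "min (F 0) (F 1)" "max (F 0) (F 1)" y]
      by (auto simp: min_def max_def split: if_splits)
  qed (use btw in auto)
  show ?thesis
  proof (rule that)
    show "min (F 0) (F 1) < max (F 0) (F 1)" using \<open>F 0 \<noteq> F 1\<close> by auto
    have "path_image g = (\<lambda>t. (F t, s)) ` {0..1}"
      unfolding path_image_def using gF by (intro image_cong) auto
    also have "\<dots> = F ` {0..1} \<times> {s}" by auto
    finally show "path_image g = {min (F 0) (F 1)..max (F 0) (F 1)} \<times> {s}"
      by (simp only: img)
    show "{pathstart g, pathfinish g} = {(min (F 0) (F 1), s), (max (F 0) (F 1), s)}"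
      using gF[of 0] gF[of 1] by (auto simp: pathstart_def pathfinish_def min_def max_def)
  qed
qed

text \<open>\<open>arc_int\<close> removes the end points of some chosen parametrisation. For an arc
  in a horizontal line every parametrisation has the two ends of the segment as end points, so the
  choice does not matter.\<close>

lemma is_arc_horizontal:
  assumes A: "is_arc A" "A \<subseteq> UNIV \<times> {s}"
  obtains \<alpha> \<beta> where "\<alpha> < \<beta>" "A = {\<alpha>..\<beta>} \<times> {s}" "arc_int A = {\<alpha><..<\<beta>} \<times> {s}"
proof -
  define g where "g = (SOME g::real \<Rightarrow> pt. arc g \<and> path_image g = A)"
  have g: "arc g \<and> path_image g = A"
    unfolding g_def by (rule someI_ex[OF A(1)[unfolded is_arc_def]])
  then have "arc g" "path_image g \<subseteq> UNIV \<times> {s}" using A(2) by auto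
  then obtain \<alpha> \<beta> where ab: "\<alpha> < \<beta>" "path_image g = {\<alpha>..\<beta>} \<times> {s}"
    "{pathstart g, pathfinish g} = {(\<alpha>, s), (\<beta>, s)}"
    by (rule horizontal_arc)
  have "arc_int A = A - {(\<alpha>, s), (\<beta>, s)}"
    unfolding arc_int_def Let_def g_def[symmetric] ab(3) ..
  also have "A = {\<alpha>..\<beta>} \<times> {s}" using g ab(2) by simp
  also have "{\<alpha>..\<beta>} \<times> {s} - {(\<alpha>, s), (\<beta>, s)} = {\<alpha><..<\<beta>} \<times> {s}" by auto
  finally show ?thesis by (intro that[OF ab(1)]) (use ab g in auto)
qed

text \<open>Invariance of domain, applied to the homeomorphism and to its inverse, identifies the
  image of the open ball with the topological interior.\<close>

lemma disc_parametrization: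
  assumes "is_disc D"
  obtains h h' where "homeomorphism (cball (0::pt) 1) D h h'"
    "h ` ball 0 1 = interior D" "h ` sphere 0 1 = frontier D"
proof -
  have "cball (0::pt) 1 homeomorphic D"
    using assms by (subst homeomorphic_sym) (simp only: is_disc_def)
  then obtain h h' where h: "homeomorphism (cball (0::pt) 1) D h h'"
    unfolding homeomorphic_def by blast
  have inj: "inj_on h (cball 0 1)" "inj_on h' D"
    using h by (metis homeomorphism_def inj_on_inverseI)+
  have clD: "closed D"
    using h by (metis compact_cball compact_continuous_image compact_imp_closed homeomorphism_def)
  have "open (h ` ball 0 1)"
    using h inj by (intro invariance_of_domain)
      (auto simp: homeomorphism_def intro: continuous_on_subset inj_on_subset)
  then have 1: "h ` ball 0 1 \<subseteq> interior D"
    using h by (intro interior_maximal) (auto simp: homeomorphism_def)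
  have "open (h' ` interior D)"
    using h inj interior_subset[of D] by (intro invariance_of_domain)
      (auto simp: homeomorphism_def intro: continuous_on_subset inj_on_subset)
  then have "h' ` interior D \<subseteq> interior (cball 0 1)"
    using h interior_subset[of D] by (intro interior_maximal) (auto simp: homeomorphism_def)
  then have "h' ` interior D \<subseteq> ball 0 1" by simp
  have 2: "interior D \<subseteq> h ` ball 0 1"
  proof
    fix x assume x: "x \<in> interior D"
    then have "h (h' x) = x"
      using homeomorphism_apply2[OF h] interior_subset by blast
    then show "x \<in> h ` ball 0 1"
      using \<open>h' ` interior D \<subseteq> ball 0 1\<close> x by (metis imageI subsetD)
  qed
  have int: "h ` ball 0 1 = interior D" using 1 2 by blast
  have "h ` sphere 0 1 = h ` (cball 0 1 - ball 0 1)"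
    by (intro arg_cong[where f = "image h"]) auto
  also have "\<dots> = h ` cball 0 1 - h ` ball 0 1"
    using inj(1) by (intro inj_on_image_set_diff[of _ "cball 0 1"]) auto
  also have "\<dots> = frontier D"
    using h int clD by (simp add: homeomorphism_def frontier_def closure_closed)
  finally show ?thesis using that h int by blast
qed

lemma disc_closure_interior:
  assumes "is_disc D" shows "closure (interior D) = D"
proof -
  obtain h h' where h: "homeomorphism (cball (0::pt) 1) D h h'" "h ` ball 0 1 = interior D"
    using disc_parametrization[OF assms] by metis
  have clD: "closed D"
    using h(1) by (metis compact_cball compact_continuous_image compact_imp_closed homeomorphism_def)
  have "h ` closure (ball 0 1) \<subseteq> closure (h ` ball 0 1)"
    using h(1) by (intro image_closure_subset) (auto simp: homeomorphism_def intro: closure_subset[THEN subsetD])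
  then have "D \<subseteq> closure (interior D)"
    using h by (simp add: homeomorphism_def)
  then show ?thesis
    using clD by (meson closure_minimal interior_subset subset_antisym)
qed

text \<open>The boundary circle without the point of the left end is homeomorphic to the real line.
  Read there, the open segment is an injective continuous image of an open interval, hence open by
  invariance of domain in dimension one.\<close>

lemma openin_frontier_disc_segment:
  assumes D: "is_disc D" and A: "{\<alpha>..\<beta>} \<times> {s} \<subseteq> frontier D"
  shows "openin (top_of_set (frontier D)) ({\<alpha><..<\<beta>} \<times> {s})"
proof (cases "\<alpha> < \<beta>")
  case True
  obtain h h' where h: "homeomorphism (cball (0::pt) 1) D h h'"
    "h ` ball 0 1 = interior D" "h ` sphere 0 1 = frontier D"
    using disc_parametrization[OF D] by metis
  have clD: "closed D" by (subst disc_closure_interior[OF D, symmetric]) (rule closed_closure)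
  have hs: "homeomorphism (sphere (0::pt) 1) (frontier D) h h'"
    by (rule homeomorphism_of_subsets[OF h(1) sphere_cball frontier_subset_closed[OF clD] h(3)])
  define b where "b = h' (\<alpha>, s)"
  have b: "b \<in> sphere 0 1"
  proof -
    have "(\<alpha>, s) \<in> frontier D" using A True by auto
    then show ?thesis using hs unfolding homeomorphism_def b_def by blast
  qed
  have "(sphere 0 1 - {b}) homeomorphic (UNIV :: real set)"
    by (rule homeomorphic_punctured_sphere_affine) (use b in auto)
  then obtain k k' where k: "homeomorphism (sphere 0 1 - {b}) (UNIV :: real set) k k'"
    by (auto simp: homeomorphic_def)
  define F where "F x = k (h' (x, s))" for x
  have in_fr: "(x, s) \<in> frontier D" if "x \<in> {\<alpha>..\<beta>}" for x using A that by auto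
  have hh': "h (h' (x, s)) = (x, s)" if "x \<in> {\<alpha>..\<beta>}" for x
    by (rule homeomorphism_apply2[OF hs in_fr[OF that]])
  have h'in: "h' (x, s) \<in> sphere 0 1 - {b}" if "x \<in> {\<alpha><..<\<beta>}" for x
  proof -
    have "h' (x, s) \<noteq> h' (\<alpha>, s)"
      using hh'[of x] hh'[of \<alpha>] that True by (metis atLeastAtMost_iff greaterThanLessThan_iff less_imp_le less_irrefl order_refl prod.inject)
    moreover have "h' (x, s) \<in> sphere 0 1"
      using hs in_fr[of x] that by (force simp: homeomorphism_def)
    ultimately show ?thesis by (simp add: b_def)
  qed
  have "open (F ` {\<alpha><..<\<beta>})"
  proof (rule invariance_of_domain)
    have 1: "continuous_on {\<alpha><..<\<beta>} (\<lambda>x. h' (x, s))"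
      using hs in_fr by (auto simp: homeomorphism_def intro!: continuous_on_compose2[of "frontier D" h'] continuous_intros)
    have 2: "continuous_on (sphere 0 1 - {b}) k"
      using k unfolding homeomorphism_def by blast
    have 3: "(\<lambda>x. h' (x, s)) ` {\<alpha><..<\<beta>} \<subseteq> sphere 0 1 - {b}"
      using h'in by blast
    show "continuous_on {\<alpha><..<\<beta>} F"
      unfolding F_def by (rule continuous_on_compose2[OF 2 1 3])
    show "inj_on F {\<alpha><..<\<beta>}"
    proof (rule inj_onI)
      fix x y assume xy: "x \<in> {\<alpha><..<\<beta>}" "y \<in> {\<alpha><..<\<beta>}" "F x = F y"
      then have "h' (x, s) = h' (y, s)"
        using homeomorphism_apply1[OF k h'in] unfolding F_def by metis
      moreover have "h (h' (x, s)) = (x, s)" "h (h' (y, s)) = (y, s)"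
        using xy(1,2) by (simp_all add: hh')
      ultimately show "x = y" by (metis prod.inject)
    qed
  qed auto
  then have "openin (top_of_set (sphere 0 1 - {b})) (k' ` F ` {\<alpha><..<\<beta>})"
    using homeomorphism_imp_open_map[OF homeomorphism_symD[OF k]] by simp
  moreover have "k' ` F ` {\<alpha><..<\<beta>} = (\<lambda>x. h' (x, s)) ` {\<alpha><..<\<beta>}"
    unfolding image_image F_def using homeomorphism_apply1[OF k h'in] by (intro image_cong) auto
  moreover have "openin (top_of_set (sphere 0 1)) (sphere 0 1 - {b})"
    by (simp add: openin_delete)
  ultimately have "openin (top_of_set (sphere 0 1)) ((\<lambda>x. h' (x, s)) ` {\<alpha><..<\<beta>})"
    using openin_trans by metis
  then have "openin (top_of_set (frontier D)) (h ` (\<lambda>x. h' (x, s)) ` {\<alpha><..<\<beta>})"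
    using homeomorphism_imp_open_map[OF hs] by simp
  moreover have "h ` (\<lambda>x. h' (x, s)) ` {\<alpha><..<\<beta>} = (\<lambda>x. (x, s)) ` {\<alpha><..<\<beta>}"
    unfolding image_image by (intro image_cong) (simp_all add: hh')
  moreover have "(\<lambda>x. (x, s)) ` {\<alpha><..<\<beta>} = {\<alpha><..<\<beta>} \<times> {s}" by auto
  ultimately show ?thesis by simp
qed auto

lemma hutch_side:
  assumes s: "s = 1 \<or> s = -1" and hutch: "hutch D X s"
  obtains \<alpha> \<beta> where "\<alpha> < \<beta>" "-1 < \<alpha>" "\<beta> < 1" "D \<inter> Jside s = {\<alpha>..\<beta>} \<times> {s}"
    "D \<inter> bd_sq = {\<alpha>..\<beta>} \<times> {s}" "arc_int (D \<inter> Jside s) = {\<alpha><..<\<beta>} \<times> {s}"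
proof -
  have D: "is_arc (D \<inter> bd_sq)" "D \<inter> bd_sq \<subseteq> Jside_open s"
    using hutch by (auto simp: hutch_def hanging_set_def)
  have eq: "D \<inter> Jside s = D \<inter> bd_sq"
    using D(2) Jside_subset_bd_sq[OF s] by (auto simp: Jside_open_def Jside_def JJ_def)
  have "D \<inter> bd_sq \<subseteq> UNIV \<times> {s}" using D(2) by (auto simp: Jside_open_def)
  from is_arc_horizontal[OF D(1) this] obtain \<alpha> \<beta> where ab: "\<alpha> < \<beta>" "D \<inter> bd_sq = {\<alpha>..\<beta>} \<times> {s}"
    "arc_int (D \<inter> bd_sq) = {\<alpha><..<\<beta>} \<times> {s}" .
  moreover have "(\<alpha>, s) \<in> Jside_open s" "(\<beta>, s) \<in> Jside_open s"
    using ab D(2) by auto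
  ultimately show ?thesis using that[of \<alpha> \<beta>] by (simp add: eq Jside_open_def)
qed

lemma interior_hutch_subset: "hutch D X s \<Longrightarrow> interior D \<inter> bd_sq = {}"
  using interior_mono[of D sq] interior_sq by (auto simp: hutch_def)

text \<open>Near an inner point of the side arc the frontier of D lies in the side of the square.
  The half ball \<open>H\<close> is therefore connected, disjoint from that frontier, and meets D,
  so it lies in D. This makes the glued map continuous along the side arc, where a relative
  neighbourhood belongs to a single hutch.\<close>

lemma hutch_neighbourhood:
  assumes s: "s = 1 \<or> s = -1" and hutch: "hutch D X s"
    and side: "D \<inter> bd_sq = {\<alpha>..\<beta>} \<times> {s}" and x: "\<alpha> < x" "x < \<beta>"
  obtains r where "r > 0" "ball (x, s) r \<inter> sq \<subseteq> D"
proof -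
  have D: "is_disc D" "D \<subseteq> sq" using hutch by (auto simp: hutch_def)
  have clD: "closed D" using disc_closure_interior[OF D(1)] by (metis closed_closure)
  have A: "{\<alpha>..\<beta>} \<times> {s} \<subseteq> frontier D"
    using side interior_hutch_subset[OF hutch] clD by (auto simp: frontier_def closure_closed)
  obtain r where r: "r > 0" "ball (x, s) r \<inter> frontier D \<subseteq> {\<alpha><..<\<beta>} \<times> {s}"
    using openin_frontier_disc_segment[OF D(1) A] x
    unfolding openin_contains_ball by (metis SigmaI greaterThanLessThan_iff singletonI)
  define H where "H = ball (x, s) r \<inter> interior sq"
  have "convex sq" unfolding sq_def JJ_def by (intro convex_Times) auto
  then have "connected H"
    unfolding H_def by (intro convex_connected convex_Int convex_interior) auto
  moreover have "H \<inter> frontier D = {}"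
  proof -
    have "{\<alpha><..<\<beta>} \<times> {s} \<subseteq> bd_sq" using side by force
    then show ?thesis using r(2) interior_sq by (auto simp: H_def)
  qed
  moreover have "H \<inter> D \<noteq> {}"
  proof -
    have "(x, s) \<in> closure (interior D)"
      using side x by (subst disc_closure_interior[OF D(1)]) auto
    then obtain y where "y \<in> interior D" "y \<in> ball (x, s) r"
      using r(1) by (meson centre_in_ball closure_iff_nhds_not_empty disjoint_iff open_ball order_refl)
    then show ?thesis
      using interior_mono[OF D(2)] interior_subset[of D] by (auto simp: H_def)
  qed
  ultimately have "H \<subseteq> D"
    using connected_Int_frontier[of H D] by auto
  have "ball (x, s) r \<inter> sq \<subseteq> ball (x, s) r \<inter> closure (interior sq)"
    using convex_closure_interior[OF \<open>convex sq\<close>] \<open>H \<inter> D \<noteq> {}\<close> closure_subset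
    by (auto simp: H_def)
  also have "\<dots> \<subseteq> closure H"
    unfolding H_def by (rule open_Int_closure_subset) auto
  also have "\<dots> \<subseteq> D" using \<open>H \<subseteq> D\<close> clD by (rule closure_minimal)
  finally show ?thesis using that r(1) by blast
qed

section \<open>Chords of the disc and Jordan curves\<close>

text \<open>The cross product of q - a and c - a; its sign tells on which side of the line through a
  and c the point q lies.\<close>

definition side :: "pt \<Rightarrow> pt \<Rightarrow> pt \<Rightarrow> real" where
  "side a c q = (fst q - fst a) * (snd c - snd a) - (snd q - snd a) * (fst c - fst a)"

lemma side_simps [simp]: "side a c a = 0" "side a c c = 0"
  by (simp_all add: side_def)

lemma side_affine: "side a c ((1 - t) *\<^sub>R p + t *\<^sub>R q) = (1 - t) * side a c p + t * side a c q"
  by (simp add: side_def algebra_simps)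

lemma continuous_on_side [continuous_intros]: "continuous_on S k \<Longrightarrow> continuous_on S (\<lambda>x. side a c (k x))"
  unfolding side_def by (intro continuous_intros)

lemma side_eq_0D:
  assumes "side a c q = 0" "a \<noteq> c"
  obtains t where "q = (1 - t) *\<^sub>R a + t *\<^sub>R c"
proof (cases "fst c = fst a")
  case True
  then have ne: "snd c - snd a \<noteq> 0" using assms(2) by (simp add: prod_eq_iff)
  define t where "t = (snd q - snd a) / (snd c - snd a)"
  have "t * (snd c - snd a) = snd q - snd a" using ne by (simp add: t_def)
  moreover have "fst q = fst a" using assms(1) True ne by (simp add: side_def)
  ultimately show ?thesis
    using that[of t] True by (simp add: prod_eq_iff algebra_simps)
next
  case False
  then have ne: "fst c - fst a \<noteq> 0" by simp
  define t where "t = (fst q - fst a) / (fst c - fst a)"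
  have "t * (fst c - fst a) = fst q - fst a" using ne by (simp add: t_def)
  moreover have "(fst c - fst a) * (t * (snd c - snd a)) = (fst c - fst a) * (snd q - snd a)"
  proof -
    have "(fst c - fst a) * (t * (snd c - snd a)) = (fst q - fst a) * (snd c - snd a)"
      using calculation by (metis mult.assoc mult.commute)
    also have "\<dots> = (fst c - fst a) * (snd q - snd a)"
      using assms(1) by (simp add: side_def mult.commute)
    finally show ?thesis .
  qed
  then have "t * (snd c - snd a) = snd q - snd a" using ne by (rule mult_left_cancel[THEN iffD1, rotated])
  ultimately show ?thesis
    using that[of t] by (simp add: prod_eq_iff algebra_simps)
qed

text \<open>The power of a point on the line through a and c with respect to the unit
  sphere.\<close>

lemma norm_chord:
  fixes a c :: "'a :: real_inner"
  assumes "norm a = 1" "norm c = 1"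
  shows "(norm ((1 - t) *\<^sub>R a + t *\<^sub>R c))\<^sup>2 = 1 - t * (1 - t) * (norm (c - a))\<^sup>2"
proof -
  have "a \<bullet> a = 1" "c \<bullet> c = 1" using assms by (simp_all add: dot_square_norm)
  then show ?thesis
    by (simp add: power2_norm_eq_inner inner_add_left inner_add_right inner_diff_left
      inner_diff_right inner_commute[of c a] algebra_simps)
qed

lemma side_eq_0_sphere:
  assumes "norm a = 1" "norm c = 1" "a \<noteq> c" "norm q = 1" "side a c q = 0"
  shows "q = a \<or> q = c"
proof -
  obtain t where t: "q = (1 - t) *\<^sub>R a + t *\<^sub>R c" using side_eq_0D assms(3,5) by blast
  have "t * (1 - t) * (norm (c - a))\<^sup>2 = 0"
    using norm_chord[OF assms(1,2), of t] assms(4) t by simp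
  then show ?thesis using t assms(3) by auto
qed

lemma side_eq_0_ball:
  assumes "norm a = 1" "norm c = 1" "a \<noteq> c" "norm q < 1" "side a c q = 0"
  shows "q \<in> closed_segment a c"
proof -
  obtain t where t: "q = (1 - t) *\<^sub>R a + t *\<^sub>R c" using side_eq_0D assms(3,5) by blast
  have "(norm q)\<^sup>2 < 1" using assms(4) by (simp add: abs_square_less_1)
  then have "t * (1 - t) * (norm (c - a))\<^sup>2 > 0"
    using norm_chord[OF assms(1,2), of t] t by simp
  then have "t * (1 - t) > 0" by (simp add: zero_less_mult_iff)
  then have "0 \<le> t" "t \<le> 1" by (auto simp: zero_less_mult_iff)
  then show ?thesis using t by (auto simp: closed_segment_def)
qed

lemma open_segment_sphere_subset_ball:
  fixes a c :: "'a :: real_inner"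
  assumes "norm a = 1" "norm c = 1"
  shows "open_segment a c \<subseteq> ball 0 1"
proof
  fix q assume "q \<in> open_segment a c"
  then obtain t where t: "q = (1 - t) *\<^sub>R a + t *\<^sub>R c" "0 < t" "t < 1" "a \<noteq> c"
    by (auto simp: in_segment)
  then have "t * (1 - t) * (norm (c - a))\<^sup>2 > 0" by simp
  then have "(norm q)\<^sup>2 < 1" using norm_chord[OF assms, of t] t(1) by simp
  then show "q \<in> ball 0 1" by (simp add: abs_square_less_1)
qed

text \<open>The condition on t is a quadratic equation with root 1, and the other linear factor is
  negative for all t > 0.\<close>

lemma ray_meets_sphere_once:
  fixes p q :: "'a :: real_inner"
  assumes "norm q < 1" "norm p = 1" "norm ((1 - t) *\<^sub>R q + t *\<^sub>R p) = 1" "t > 0"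
  shows "t = 1"
proof -
  have pp: "p \<bullet> p = 1" and qq: "q \<bullet> q < 1"
    using assms(1,2) by (simp_all add: dot_square_norm abs_square_less_1)
  have "((1 - t) *\<^sub>R q + t *\<^sub>R p) \<bullet> ((1 - t) *\<^sub>R q + t *\<^sub>R p) = 1"
    using assms(3) by (simp add: dot_square_norm)
  then have "(1 - t)\<^sup>2 * (q \<bullet> q) + 2 * t * (1 - t) * (p \<bullet> q) + t\<^sup>2 = 1"
    using pp by (simp add: inner_add_left inner_add_right inner_commute[of q p] power2_eq_square algebra_simps)
  then have "(1 - t) * ((1 - t) * (q \<bullet> q) + 2 * t * (p \<bullet> q) - (1 + t)) = 0"
    by (simp add: power2_eq_square algebra_simps)
  moreover have "(1 - t) * (q \<bullet> q) + 2 * t * (p \<bullet> q) - (1 + t) < 0"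
  proof -
    have "0 \<le> (p - q) \<bullet> (p - q)" by simp
    then have "2 * (p \<bullet> q) \<le> 1 + q \<bullet> q"
      using pp by (simp add: inner_diff_left inner_diff_right inner_commute[of q p])
    then have "t * (2 * (p \<bullet> q)) \<le> t * (1 + q \<bullet> q)" using assms(4) by (intro mult_left_mono) auto
    then show ?thesis using qq by (simp add: algebra_simps)
  qed
  ultimately show ?thesis by auto
qed

text \<open>Otherwise the path from a to c runs entirely on the side of p. The line through p and
  the midpoint M of the chord separates a from c, so the path meets it, and does so on the ray from
  M through p. That ray leaves the disc only at p, which contradicts injectivity.\<close>

lemma circle_path_separated:
  fixes k :: "real \<Rightarrow> pt"
  assumes cont: "continuous_on {\<alpha>..\<beta>} k" and inj: "inj_on k {\<alpha>..\<beta>}"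
    and sph: "\<And>x. x \<in> {\<alpha>..\<beta>} \<Longrightarrow> norm (k x) = 1"
    and x: "\<alpha> \<le> x1" "x1 < x2" "x2 < x3" "x3 < x4" "x4 \<le> \<beta>"
  shows "side (k x1) (k x3) (k x2) * side (k x1) (k x3) (k x4) < 0"
proof (rule ccontr)
  define a c p M where "a = k x1" and "c = k x3" and "p = k x4" and "M = (1 / 2) *\<^sub>R (a + c)"
  assume "\<not> ?thesis"
  then have nn: "0 \<le> side a c (k x2) * side a c p" by (simp add: a_def c_def p_def)
  have mem: "x1 \<in> {\<alpha>..\<beta>}" "x3 \<in> {\<alpha>..\<beta>}" "x4 \<in> {\<alpha>..\<beta>}" using x by auto
  have n: "norm a = 1" "norm c = 1" "norm p = 1"
    by (simp_all only: sph mem a_def c_def p_def)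
  have ne: "a \<noteq> c" using inj_onD[OF inj _ mem(1,2)] x by (auto simp: a_def c_def)
  have nz: "side a c (k x) \<noteq> 0" if "x \<in> {\<alpha>..\<beta>}" "x \<noteq> x1" "x \<noteq> x3" for x
    using side_eq_0_sphere[OF n(1,2) ne sph[OF that(1)]] that
      inj_onD[OF inj _ that(1) mem(1)] inj_onD[OF inj _ that(1) mem(2)]
    by (auto simp: a_def c_def)
  have pos: "0 < side a c (k x2) * side a c p"
    using nn nz[of x2] nz[of x4] x by (auto simp: p_def less_le)
  \<comment> \<open>The circle meets the line through a and c only in these two points, so by
    injectivity \<open>side\<close> has no zero between x1 and x3 and keeps its sign.\<close>
  have sgn: "0 < side a c (k x) * side a c p" if y: "x1 < x" "x < x3" for x
  proof (rule ccontr)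
    assume "\<not> ?thesis"
    then have le: "side a c (k x) * side a c p \<le> 0" by simp
    have "continuous_on (closed_segment x x2) (\<lambda>x. side a c (k x) * side a c p)"
      using x y by (intro continuous_intros continuous_on_subset[OF cont])
        (auto simp: closed_segment_eq_real_ivl split: if_splits)
    then have "connected ((\<lambda>x. side a c (k x) * side a c p) ` closed_segment x x2)"
      by (intro connected_continuous_image) auto
    then have "0 \<in> (\<lambda>x. side a c (k x) * side a c p) ` closed_segment x x2"
      using le less_imp_le[OF pos] ends_in_segment[of x x2]
      by (intro connectedD_interval[where z = 0 and x = "side a c (k x) * side a c p"
            and y = "side a c (k x2) * side a c p"]) auto
    then obtain z where z: "z \<in> closed_segment x x2" "side a c (k z) * side a c p = 0"
      by auto
    then have "x1 < z" "z < x3"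
      using x y by (auto simp: closed_segment_eq_real_ivl split: if_splits)
    then show False using nz[of z] nz[of x4] z(2) x by (auto simp: p_def)
  qed
  have "(norm M)\<^sup>2 = 1 - (1/2) * (1 - 1/2) * (norm (c - a))\<^sup>2"
    using norm_chord[OF n(1,2), of "1/2"] by (simp add: M_def scaleR_add_right)
  then have "(norm M)\<^sup>2 < 1" using ne by simp
  then have nM: "norm M < 1" by (simp add: abs_square_less_1)
  have sM: "side M p a = side a c p / 2" "side M p c = - side a c p / 2" "side a c M = 0"
    by (simp_all add: side_def M_def field_simps)
  have "continuous_on {x1..x3} (\<lambda>x. side M p (k x))"
    using x by (intro continuous_intros continuous_on_subset[OF cont]) auto
  then have con: "connected ((\<lambda>x. side M p (k x)) ` {x1..x3})"
    by (intro connected_continuous_image) auto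
  have ends: "side M p a \<in> (\<lambda>x. side M p (k x)) ` {x1..x3}"
      "side M p c \<in> (\<lambda>x. side M p (k x)) ` {x1..x3}"
    using x by (auto simp: a_def c_def)
  have "0 \<in> (\<lambda>x. side M p (k x)) ` {x1..x3}"
  proof (cases "side a c p \<le> 0")
    case True
    then have "side M p a \<le> 0" "0 \<le> side M p c" using sM by simp_all
    then show ?thesis by (rule connectedD_interval[OF con ends])
  next
    case False
    then have "side M p c \<le> 0" "0 \<le> side M p a" using sM by simp_all
    then show ?thesis by (rule connectedD_interval[OF con ends(2,1)])
  qed
  then obtain z where z: "z \<in> {x1..x3}" "side M p (k z) = 0" by auto
  have "side a c p \<noteq> 0" using pos by auto
  then have zs: "x1 < z" "z < x3"
    using z sM by (auto simp: a_def c_def less_le)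
  have "M \<noteq> p" using nM n(3) by auto
  then obtain t where t: "k z = (1 - t) *\<^sub>R M + t *\<^sub>R p"
    using side_eq_0D[OF z(2)] by blast
  then have "side a c (k z) = t * side a c p" by (simp add: side_affine sM(3))
  then have "0 < t * (side a c p)\<^sup>2"
    using sgn[OF zs] by (simp add: power2_eq_square mult.assoc)
  then have "t > 0" by (simp add: zero_less_mult_iff)
  moreover have "norm (k z) = 1" using sph[of z] zs x by simp
  ultimately have "t = 1"
    using ray_meets_sphere_once[OF nM n(3)] t by metis
  then have "k z = k x4" using t by (simp add: p_def)
  then show False using inj_onD[OF inj _ _ mem(3), of z] zs x by auto
qed

lemma no_crossing:
  fixes f :: "pt \<Rightarrow> complex"
  assumes cont: "continuous_on (cball 0 1) f" and inj: "inj_on f (ball 0 1)"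
    and n: "norm a = 1" "norm c = 1" "norm a1 = 1" "norm b1 = 1"
    and sides: "side a c a1 * side a c b1 < 0"
    and g: "arc g" "pathstart g = f c" "pathfinish g = f a" "path_image g \<inter> f ` ball 0 1 = {}"
    and Y: "connected Y" "f a1 \<in> Y" "f b1 \<in> Y" "Y \<inter> path_image g = {}" "Y \<inter> f ` ball 0 1 = {}"
  shows False
proof -
  have ne: "a \<noteq> c" using sides by (auto simp: side_def)
  have fac: "f a \<in> path_image g" "f c \<in> path_image g" "f a \<noteq> f c"
    using g arc_distinct_ends[of g] by (metis pathfinish_in_path_image pathstart_in_path_image)+
  have seg: "x \<in> ball 0 1 \<or> x = a \<or> x = c" if "x \<in> closed_segment a c" for x
    using open_segment_sphere_subset_ball[OF n(1,2)] that by (auto simp: open_segment_def)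
  have seg_sub: "closed_segment a c \<subseteq> cball 0 1"
    using n by (intro closed_segment_subset) auto
  have inj_seg: "inj_on f (closed_segment a c)"
  proof (rule inj_onI)
    fix x y assume xy: "x \<in> closed_segment a c" "y \<in> closed_segment a c" "f x = f y"
    then show "x = y"
      using seg[OF xy(1)] seg[OF xy(2)] inj_onD[OF inj xy(3)] fac g(4) by (metis disjoint_iff imageI)
  qed
  define \<gamma> where "\<gamma> = f \<circ> linepath a c"
  have arc: "arc \<gamma>"
    unfolding \<gamma>_def arc_def
  proof
    show "path (f \<circ> linepath a c)"
      using continuous_on_subset[OF cont seg_sub] by (intro path_continuous_image) auto
    have "inj_on f (linepath a c ` {0..1})"
      using inj_seg by (simp add: linepath_image_01)
    then show "inj_on (f \<circ> linepath a c) {0..1}"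
      using arc_linepath[OF ne] by (intro comp_inj_on) (auto simp: arc_def)
  qed
  have im: "path_image \<gamma> = f ` closed_segment a c" "pathstart \<gamma> = f a" "pathfinish \<gamma> = f c"
    by (simp_all add: \<gamma>_def path_image_compose pathstart_compose pathfinish_compose)
  define \<Gamma> where "\<Gamma> = \<gamma> +++ g"
  have "path_image \<gamma> \<inter> path_image g \<subseteq> {pathstart \<gamma>, pathstart g}"
    using seg g(4) unfolding im g(2) by blast
  then have "simple_path \<Gamma>"
    unfolding \<Gamma>_def using arc g im by (intro simple_path_join_loop) auto
  moreover have "pathfinish \<Gamma> = pathstart \<Gamma>"
    using g(3) im by (simp add: \<Gamma>_def)
  moreover define C where "C = path_image \<Gamma>"
  ultimately have J: "open (inside C)" "open (outside C)" "inside C \<inter> outside C = {}"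
      "inside C \<union> outside C = - C" "frontier (inside C) = C" "frontier (outside C) = C"
    using Jordan_inside_outside[of \<Gamma>] by blast+
  have C: "C = f ` closed_segment a c \<union> path_image g"
    unfolding C_def \<Gamma>_def using g(2) im by (simp add: path_image_join)
  \<comment> \<open>The sign of \<sigma> selects one of the two open half discs.\<close>
  have half: "f ` {x \<in> ball 0 1. \<sigma> * side a c x > 0} \<subseteq> inside C \<or>
      f ` {x \<in> ball 0 1. \<sigma> * side a c x > 0} \<subseteq> outside C" for \<sigma> :: real
  proof -
    let ?B = "{x \<in> ball 0 1. \<sigma> * side a c x > 0}"
    have "convex ?B"
    proof (rule convexI)
      fix x y :: pt and u v :: real
      assume xy: "x \<in> ?B" "y \<in> ?B" "0 \<le> u" "0 \<le> v" "u + v = 1"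
      then have u: "u = 1 - v" by simp
      have "u *\<^sub>R x + v *\<^sub>R y \<in> ball 0 1"
        using convexD[OF convex_ball, of x "0::pt" 1 y u v] xy by auto
      moreover have "0 < u * (\<sigma> * side a c x) + v * (\<sigma> * side a c y)"
      proof (cases "u = 0")
        case False
        then show ?thesis using xy by (intro add_pos_nonneg) auto
      qed (use xy in auto)
      then have "\<sigma> * side a c (u *\<^sub>R x + v *\<^sub>R y) > 0"
        unfolding u side_affine by (simp add: algebra_simps)
      ultimately show "u *\<^sub>R x + v *\<^sub>R y \<in> ?B" by simp
    qed
    then have "connected (f ` ?B)"
      by (intro connected_continuous_image continuous_on_subset[OF cont] convex_connected) auto
    moreover have "f ` ?B \<inter> C = {}"
    proof -
      have "f x \<noteq> f y" if xy: "x \<in> ?B" "y \<in> closed_segment a c" for x y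
      proof
        assume eq: "f x = f y"
        then have "y \<in> ball 0 1" using seg[OF xy(2)] fac g(4) xy(1) by (metis (no_types, lifting) disjoint_iff imageI mem_Collect_eq)
        then have "x = y" using inj_onD[OF inj eq] xy by simp
        moreover have "side a c y = 0"
          using xy(2) by (auto simp: closed_segment_def side_affine)
        ultimately show False using xy(1) by simp
      qed
      then show ?thesis using g(4) unfolding C by blast
    qed
    ultimately show ?thesis
      using J(1-4) connectedD[of "f ` ?B" "inside C" "outside C"] by blast
  qed
  define m where "m = midpoint a c"
  have m: "m \<in> ball 0 1" "m \<in> closed_segment a c"
  proof -
    have "m \<in> open_segment a c" using ne by (simp add: m_def)
    then show "m \<in> ball 0 1" "m \<in> closed_segment a c"
      using open_segment_sphere_subset_ball[OF n(1,2)] by (auto simp: open_segment_def)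
  qed
  have op: "open (f ` ball 0 1)"
    by (rule invariance_of_domain_gen) (use cont inj in \<open>auto intro: continuous_on_subset\<close>)
  have meets: "\<exists>x\<in>ball 0 1. f x \<in> S" if "frontier S = C" for S
  proof -
    have "f m \<in> closure S" using m(2) that C by (auto simp: frontier_def)
    then have "f ` ball 0 1 \<inter> S \<noteq> {}"
      using open_Int_closure_eq_empty[OF op, of S] m(1) by blast
    then show ?thesis by blast
  qed
  have offC: "side a c x \<noteq> 0" if "x \<in> ball 0 1" "f x \<notin> C" for x
    using side_eq_0_ball[OF n(1,2) ne, of x] that by (auto simp: C)
  obtain xi where xi: "xi \<in> ball 0 1" "f xi \<in> inside C" using meets[OF J(5)] by blast
  obtain xo where xo: "xo \<in> ball 0 1" "f xo \<in> outside C" using meets[OF J(6)] by blast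
  have s: "side a c xi \<noteq> 0" "side a c xo \<noteq> 0"
    using offC xi xo J(4) by blast+
  define \<sigma> where "\<sigma> = side a c xi"
  have hi: "f ` {x \<in> ball 0 1. \<sigma> * side a c x > 0} \<subseteq> inside C"
  proof -
    have "xi \<in> {x \<in> ball 0 1. \<sigma> * side a c x > 0}"
      using xi s by (auto simp: \<sigma>_def zero_less_mult_iff)
    then show ?thesis using half[of \<sigma>] xi(2) J(3) by blast
  qed
  have "\<not> \<sigma> * side a c xo > 0" using hi xo J(3) by blast
  moreover have "\<sigma> * side a c xo \<noteq> 0" using s by (simp add: \<sigma>_def)
  ultimately have "(- \<sigma>) * side a c xo > 0" by linarith
  then have ho: "f ` {x \<in> ball 0 1. (- \<sigma>) * side a c x > 0} \<subseteq> outside C"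
    using half[of "- \<sigma>"] xo J(3) by blast
  have clos: "f q \<in> closure (f ` {x \<in> ball 0 1. \<tau> * side a c x > 0})"
    if q: "norm q = 1" "\<tau> * side a c q > 0" for q \<tau>
  proof -
    \<comment> \<open>The point q is approached along the segment from the midpoint m of the chord.
      As \<open>side\<close> vanishes at m, it keeps the sign it has at q. The denominator n + 2
      keeps both weights strictly between 0 and 1 already for n = 0.\<close>
    define x where "x n = (1 - (1 - 1 / real (n + 2))) *\<^sub>R m + (1 - 1 / real (n + 2)) *\<^sub>R q" for n :: nat
    have sm: "side a c m = 0"
      by (simp add: m_def midpoint_def side_def field_simps)
    have t: "0 < 1 - 1 / real (n + 2)" "1 - 1 / real (n + 2) < 1" for n by auto
    have "x n \<in> {x \<in> ball 0 1. \<tau> * side a c x > 0}" for n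
    proof -
      have "norm (x n) \<le> (1 - (1 - 1 / real (n + 2))) * norm m + (1 - 1 / real (n + 2)) * norm q"
        unfolding x_def using t[of n] by (intro norm_triangle_le) auto
      also have "\<dots> < (1 - (1 - 1 / real (n + 2))) * 1 + (1 - 1 / real (n + 2)) * 1"
        using t[of n] m(1) q(1) by (intro add_less_le_mono mult_strict_left_mono) auto
      finally have "norm (x n) < 1" by simp
      moreover have "\<tau> * side a c (x n) = (1 - 1 / real (n + 2)) * (\<tau> * side a c q)"
        unfolding x_def side_affine sm by simp
      then have "\<tau> * side a c (x n) > 0" using t(1)[of n] q(2) by (metis mult_pos_pos)
      ultimately show ?thesis by simp
    qed
    moreover have "x \<longlonglongrightarrow> q"
    proof -
      have lim: "(\<lambda>n. 1 / real (n + 2)) \<longlonglongrightarrow> 0"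
        by (rule LIMSEQ_ignore_initial_segment[OF lim_1_over_n])
      have "x \<longlonglongrightarrow> (1 - (1 - 0)) *\<^sub>R m + (1 - 0) *\<^sub>R q"
        unfolding x_def by (intro tendsto_add tendsto_scaleR tendsto_diff tendsto_const lim)
      then show ?thesis by simp
    qed
    then have "(\<lambda>n. f (x n)) \<longlonglongrightarrow> f q"
      using calculation q(1) by (intro continuous_on_tendsto_compose[OF cont])
        (auto intro!: always_eventually less_imp_le)
    ultimately show ?thesis
      unfolding closure_sequential by (intro exI[of _ "\<lambda>n. f (x n)"]) blast
  qed
  have YC: "Y \<inter> C = {}"
  proof -
    have "f ` closed_segment a c \<subseteq> f ` ball 0 1 \<union> path_image g" using seg fac by blast
    then show ?thesis using Y(4,5) unfolding C by blast
  qed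
  have clI: "closure (inside C) \<subseteq> inside C \<union> C" "closure (outside C) \<subseteq> outside C \<union> C"
    using J by (metis closure_Un_frontier order_refl)+
  have "f q \<in> inside C" if q: "norm q = 1" "\<sigma> * side a c q > 0" "f q \<in> Y" for q
    using clos[OF q(1,2)] closure_mono[OF hi] clI(1) YC q(3) by blast
  moreover have "f q \<in> outside C" if q: "norm q = 1" "(- \<sigma>) * side a c q > 0" "f q \<in> Y" for q
    using clos[OF q(1,2)] closure_mono[OF ho] clI(2) YC q(3) by blast
  moreover have "(\<sigma> * side a c a1 > 0 \<and> (- \<sigma>) * side a c b1 > 0) \<or>
     ((- \<sigma>) * side a c a1 > 0 \<and> \<sigma> * side a c b1 > 0)"
  proof -
    have "\<sigma> \<noteq> 0" using s by (simp add: \<sigma>_def)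
    then show ?thesis
      using sides by (auto simp: mult_less_0_iff zero_less_mult_iff linorder_neq_iff)
  qed
  ultimately have "Y \<inter> inside C \<noteq> {}" "Y \<inter> outside C \<noteq> {}"
    using n Y(2,3) by blast+
  moreover have "Y \<subseteq> inside C \<union> outside C" using YC J(4) by blast
  ultimately show False
    using connectedD[OF Y(1) J(1,2)] J(3) by blast
qed

section \<open>Collapsing a hutch\<close>

text \<open>
  Permeability with the arcs \<open>A\<close> and \<open>A'\<close> given by their end points:
  \<open>A = {\<alpha>..\<beta>} \<times> {s}\<close> and \<open>A' = {a..b} \<times> {s}\<close>.
\<close>

definition collapse :: "(pt \<Rightarrow> pt) \<Rightarrow> pt set \<Rightarrow> pt set \<Rightarrow> real \<Rightarrow> real \<Rightarrow> real \<Rightarrow> real \<Rightarrow> real \<Rightarrow> bool" where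
  "collapse \<eta> X D s \<alpha> \<beta> a b \<longleftrightarrow>
     -1 < \<alpha> \<and> \<alpha> < a \<and> a < b \<and> b < \<beta> \<and> \<beta> < 1 \<and>
     D \<inter> bd_sq = {\<alpha>..\<beta>} \<times> {s} \<and> D \<inter> Jside s = {\<alpha>..\<beta>} \<times> {s} \<and>
     continuous_on D \<eta> \<and> (\<forall>p \<in> frontier D - {\<alpha><..<\<beta>} \<times> {s}. \<eta> p = p) \<and>
     \<eta> ` ({\<alpha>..\<beta>} \<times> {s}) = {\<alpha>..\<beta>} \<times> {s} \<union> X \<and>
     \<eta> ` ({a..b} \<times> {s}) = X \<and> X \<inter> Jside s \<subseteq> {a<..<b} \<times> {s} \<and>
     \<eta> ` ({\<alpha>..\<beta>} \<times> {s} - {a..b} \<times> {s}) = {\<alpha>..\<beta>} \<times> {s} - (X \<inter> Jside s) \<and>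
     X - Jside s \<subseteq> interior D \<and>
     \<eta> ` interior D = interior D - X \<and> inj_on \<eta> (interior D)"

lemma permeable_collapse:
  assumes s: "s = 1 \<or> s = -1" and hutch: "hutch D X s" and perm: "permeable X D s"
  obtains \<eta> \<alpha> \<beta> a b where "collapse \<eta> X D s \<alpha> \<beta> a b"
proof -
  obtain \<alpha> \<beta> where ab: "\<alpha> < \<beta>" "-1 < \<alpha>" "\<beta> < 1" "D \<inter> Jside s = {\<alpha>..\<beta>} \<times> {s}"
    "D \<inter> bd_sq = {\<alpha>..\<beta>} \<times> {s}" "arc_int (D \<inter> Jside s) = {\<alpha><..<\<beta>} \<times> {s}"
    by (rule hutch_side[OF s hutch])
  have ai: "arc_int ({\<alpha>..\<beta>} \<times> {s}) = {\<alpha><..<\<beta>} \<times> {s}"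
    using ab(4,6) by simp
  obtain \<eta> A' where \<eta>: "continuous_on D \<eta>" "\<forall>p \<in> frontier D - {\<alpha><..<\<beta>} \<times> {s}. \<eta> p = p"
     "\<eta> ` ({\<alpha>..\<beta>} \<times> {s}) = {\<alpha>..\<beta>} \<times> {s} \<union> X"
     "\<eta> ` interior D = interior D - X" "inj_on \<eta> (interior D)"
     and A': "is_arc A'" "A' \<subseteq> {\<alpha><..<\<beta>} \<times> {s}" "X \<inter> Jside s \<subseteq> arc_int A'"
     "\<eta> ` ({\<alpha>..\<beta>} \<times> {s} - A') = {\<alpha>..\<beta>} \<times> {s} - (X \<inter> Jside s)" "\<eta> ` A' = X"
    using perm unfolding permeable_def Let_def ab(4) ai
    by (elim exE conjE) (rule that; assumption)
  have "A' \<subseteq> UNIV \<times> {s}" using A'(2) by auto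
  then obtain a b where a: "a < b" "A' = {a..b} \<times> {s}" "arc_int A' = {a<..<b} \<times> {s}"
    by (rule is_arc_horizontal[OF A'(1)])
  have "(a, s) \<in> A'" "(b, s) \<in> A'" using a by auto
  then have "\<alpha> < a" "b < \<beta>" using A'(2) by auto
  moreover have "X - Jside s \<subseteq> interior D" using hutch by (simp add: hutch_def)
  ultimately have "collapse \<eta> X D s \<alpha> \<beta> a b"
    using ab(2-5) \<eta> A'(3-5) a unfolding collapse_def by simp
  then show ?thesis by (rule that)
qed

context
  fixes \<eta> X D s \<alpha> \<beta> a b
  assumes C: "collapse \<eta> X D s \<alpha> \<beta> a b" and s: "s = 1 \<or> s = -1" and hutch: "hutch D X s"
begin

lemma collapseD:
  shows "-1 < \<alpha>" "\<alpha> < a" "a < b" "b < \<beta>" "\<beta> < 1"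
    and "D \<inter> bd_sq = {\<alpha>..\<beta>} \<times> {s}" "D \<inter> Jside s = {\<alpha>..\<beta>} \<times> {s}"
    and "continuous_on D \<eta>" "\<forall>p \<in> frontier D - {\<alpha><..<\<beta>} \<times> {s}. \<eta> p = p"
    and "\<eta> ` ({\<alpha>..\<beta>} \<times> {s}) = {\<alpha>..\<beta>} \<times> {s} \<union> X"
    and "\<eta> ` ({a..b} \<times> {s}) = X" "X \<inter> Jside s \<subseteq> {a<..<b} \<times> {s}"
    and "\<eta> ` ({\<alpha>..\<beta>} \<times> {s} - {a..b} \<times> {s}) = {\<alpha>..\<beta>} \<times> {s} - (X \<inter> Jside s)"
    and "X - Jside s \<subseteq> interior D"
    and "\<eta> ` interior D = interior D - X" "inj_on \<eta> (interior D)"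
  using C unfolding collapse_def by - (elim conjE, assumption)+

lemma hutch_closed: "closed D"
  using hutch disc_closure_interior[of D] closed_closure unfolding hutch_def by metis

lemma collapse_side_frontier: "{\<alpha>..\<beta>} \<times> {s} \<subseteq> frontier D"
  using collapseD(6) interior_hutch_subset[OF hutch] hutch_closed
  by (auto simp: frontier_def closure_closed)

lemma collapse_decomp:
  "D = interior D \<union> (frontier D - {\<alpha>..\<beta>} \<times> {s}) \<union> {\<alpha>..\<beta>} \<times> {s}"
  using collapse_side_frontier hutch_closed interior_subset[of D]
  by (auto simp: frontier_def closure_closed)

lemma collapse_X: "X \<subseteq> interior D \<union> {\<alpha>..\<beta>} \<times> {s}"
proof -
  have "{a<..<b} \<times> {s} \<subseteq> {\<alpha>..\<beta>} \<times> {s}" using collapseD(2,4) by auto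
  then show ?thesis using collapseD(12,14) by blast
qed

lemma collapse_id: "p \<in> frontier D - {\<alpha>..\<beta>} \<times> {s} \<Longrightarrow> \<eta> p = p"
  using collapseD(9) by auto

lemma collapse_int_frontier: "interior D \<inter> frontier D = {}"
  by (auto simp: frontier_def)

lemma collapse_image: "\<eta> ` D = D"
proof -
  have "\<eta> ` D = \<eta> ` interior D \<union> \<eta> ` (frontier D - {\<alpha>..\<beta>} \<times> {s}) \<union> \<eta> ` ({\<alpha>..\<beta>} \<times> {s})"
    using collapse_decomp by (metis image_Un)
  also have "\<eta> ` (frontier D - {\<alpha>..\<beta>} \<times> {s}) = frontier D - {\<alpha>..\<beta>} \<times> {s}"
    using collapse_id by force
  also have "\<eta> ` interior D = interior D - X" by (rule collapseD)
  also have "\<eta> ` ({\<alpha>..\<beta>} \<times> {s}) = {\<alpha>..\<beta>} \<times> {s} \<union> X" by (rule collapseD)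
  also have "interior D - X \<union> (frontier D - {\<alpha>..\<beta>} \<times> {s}) \<union> ({\<alpha>..\<beta>} \<times> {s} \<union> X) =
      interior D \<union> (frontier D - {\<alpha>..\<beta>} \<times> {s}) \<union> {\<alpha>..\<beta>} \<times> {s}"
    using collapse_X by blast
  finally show ?thesis using collapse_decomp by simp
qed

text \<open>The interior, the frontier outside the side arc, and the side arc have pairwise disjoint
  images. On the first of them \<eta> is injective, on the second it is the identity.\<close>

lemma collapse_fibres:
  assumes pq: "p \<in> D" "q \<in> D" "\<eta> p = \<eta> q"
  shows "p = q \<or> p \<in> {\<alpha>..\<beta>} \<times> {s} \<and> q \<in> {\<alpha>..\<beta>} \<times> {s}"
proof -
  let ?A = "{\<alpha>..\<beta>} \<times> {s}"
  have I: "\<eta> x \<in> interior D - X" if "x \<in> interior D" for x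
    using collapseD(15) that by blast
  have F: "\<eta> x \<in> frontier D - ?A" if "x \<in> frontier D - ?A" for x
    using collapse_id[OF that] that by simp
  have A: "\<eta> x \<in> ?A \<union> X" if "x \<in> ?A" for x
    using collapseD(10) that by blast
  have inj: "x = y" if "x \<in> interior D" "y \<in> interior D" "\<eta> x = \<eta> y" for x y
    using inj_onD[OF collapseD(16)] that by blast
  have disj: "(interior D - X) \<inter> (frontier D - ?A) = {}" "(interior D - X) \<inter> (?A \<union> X) = {}"
      "(frontier D - ?A) \<inter> (?A \<union> X) = {}"
    using collapse_int_frontier collapse_X collapse_side_frontier by blast+
  have d: False if "\<eta> p \<in> S" "\<eta> q \<in> T" "S \<inter> T = {} \<or> T \<inter> S = {}" for S T
    using that pq(3) by auto
  have cover: "x \<in> interior D \<or> x \<in> frontier D - ?A \<or> x \<in> ?A" if "x \<in> D" for x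
    using collapse_decomp that by blast
  from cover[OF pq(1)] cover[OF pq(2)] show ?thesis
  proof (elim disjE)
    assume "p \<in> interior D" "q \<in> interior D" then show ?thesis using inj pq(3) by blast
  next
    assume "p \<in> interior D" "q \<in> frontier D - ?A"
    from d[OF I[OF this(1)] F[OF this(2)]] disj(1) show ?thesis by simp
  next
    assume "p \<in> interior D" "q \<in> ?A"
    from d[OF I[OF this(1)] A[OF this(2)]] disj(2) show ?thesis by simp
  next
    assume "p \<in> frontier D - ?A" "q \<in> interior D"
    from d[OF F[OF this(1)] I[OF this(2)]] disj(1) show ?thesis by simp
  next
    assume "p \<in> frontier D - ?A" "q \<in> frontier D - ?A"
    from collapse_id[OF this(1)] collapse_id[OF this(2)] have "p = q" using pq(3) by argo
    then show ?thesis ..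
  next
    assume "p \<in> frontier D - ?A" "q \<in> ?A"
    from d[OF F[OF this(1)] A[OF this(2)]] disj(3) show ?thesis by simp
  next
    assume "p \<in> ?A" "q \<in> interior D"
    from d[OF A[OF this(1)] I[OF this(2)]] disj(2) show ?thesis by simp
  next
    assume "p \<in> ?A" "q \<in> frontier D - ?A"
    from d[OF A[OF this(1)] F[OF this(2)]] disj(3) show ?thesis by simp
  qed simp
qed

section \<open>The boundary path over a floating set with a cable\<close>

lemma continuous_on_collapse_side: "S \<subseteq> {\<alpha>..\<beta>} \<Longrightarrow> continuous_on S (\<lambda>t. \<eta> (t, s))"
  using collapseD(7)
  by (intro continuous_on_compose2[OF collapseD(8), of S "\<lambda>t. (t, s)"] continuous_intros) auto

text \<open>Parameters outside {a..b} cover the side arc except z. Those beyond b have values to the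
  right of z, by the intermediate value theorem from the fixed end \<beta>. So everything to the
  left of z comes from {\<alpha>..a}, whose compact image then contains z as well, and only the
  parameter a can yield it.\<close>

lemma collapse_start:
  assumes z: "X \<inter> Jside s = {(z, s)}"
  shows "\<eta> (a, s) = (z, s)"
proof -
  define F where "F t = fst (\<eta> (t, s))" for t
  have ord: "\<alpha> < a" "a < z" "z < b" "b < \<beta>"
    using collapseD(2-4,12) z by auto
  have ends: "\<eta> (\<alpha>, s) = (\<alpha>, s)" "\<eta> (\<beta>, s) = (\<beta>, s)"
  proof -
    have "\<eta> p = p" if "p \<in> frontier D - {\<alpha><..<\<beta>} \<times> {s}" for p
      using collapseD(9) that by blast
    moreover have "(\<alpha>, s) \<in> frontier D" "(\<beta>, s) \<in> frontier D"
      using collapse_side_frontier ord by auto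
    ultimately show "\<eta> (\<alpha>, s) = (\<alpha>, s)" "\<eta> (\<beta>, s) = (\<beta>, s)" by auto
  qed
  have img: "\<eta> ` ({\<alpha>..\<beta>} \<times> {s} - {a..b} \<times> {s}) = {\<alpha>..\<beta>} \<times> {s} - {(z, s)}"
    using collapseD(13) z by simp
  have val: "\<eta> (t, s) = (F t, s) \<and> F t \<noteq> z" if "t \<in> {\<alpha>..\<beta>}" "t \<notin> {a..b}" for t
  proof -
    have "\<eta> (t, s) \<in> {\<alpha>..\<beta>} \<times> {s} - {(z, s)}"
      unfolding img[symmetric] using that by auto
    then show ?thesis by (cases "\<eta> (t, s)") (auto simp: F_def)
  qed
  have cont: "continuous_on S F" if "S \<subseteq> {\<alpha>..\<beta>}" for S
    unfolding F_def by (intro continuous_on_fst continuous_on_collapse_side that)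
  have right: "F t > z" if t: "b < t" "t \<le> \<beta>" for t
  proof (rule ccontr)
    assume "\<not> ?thesis"
    moreover have "F \<beta> = \<beta>" using ends by (simp add: F_def)
    moreover have "continuous_on {t..\<beta>} F" using t ord by (intro cont) auto
    ultimately obtain x where x: "t \<le> x" "x \<le> \<beta>" "F x = z"
      using IVT'[of F t z \<beta>] t ord by auto
    then show False using val[of x] t ord by auto
  qed
  have "{\<alpha>..<z} \<times> {s} \<subseteq> \<eta> ` ({\<alpha>..a} \<times> {s})"
  proof
    fix p assume "p \<in> {\<alpha>..<z} \<times> {s}"
    then obtain y where y: "p = (y, s)" "\<alpha> \<le> y" "y < z" by auto
    then have "p \<in> \<eta> ` ({\<alpha>..\<beta>} \<times> {s} - {a..b} \<times> {s})"
      unfolding img using ord by auto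
    then obtain r where "p = \<eta> r" "r \<in> {\<alpha>..\<beta>} \<times> {s}" "r \<notin> {a..b} \<times> {s}" by blast
    then obtain t where t: "p = \<eta> (t, s)" "t \<in> {\<alpha>..\<beta>}" "t \<notin> {a..b}"
      by (cases r) simp
    have "t < a"
    proof (rule ccontr)
      assume "\<not> t < a"
      then have "F t > z" using t by (intro right) auto
      moreover have "F t = y" unfolding F_def using t(1) y(1) by (metis fst_conv)
      ultimately show False using y(3) by simp
    qed
    then show "p \<in> \<eta> ` ({\<alpha>..a} \<times> {s})" using t by auto
  qed
  moreover have "compact (\<eta> ` ({\<alpha>..a} \<times> {s}))"
  proof (rule compact_continuous_image)
    show "continuous_on ({\<alpha>..a} \<times> {s}) \<eta>"
      using collapseD(7) ord by (intro continuous_on_subset[OF collapseD(8)]) auto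
  qed (intro compact_Times; simp)
  ultimately have "closure ({\<alpha>..<z} \<times> {s}) \<subseteq> \<eta> ` ({\<alpha>..a} \<times> {s})"
    by (intro closure_minimal compact_imp_closed)
  moreover have "(z, s) \<in> closure ({\<alpha>..<z} \<times> {s})"
    using ord by (simp add: closure_Times)
  ultimately obtain t where t: "t \<in> {\<alpha>..a}" "(z, s) = \<eta> (t, s)" by auto
  have "t = a"
  proof (rule ccontr)
    assume "t \<noteq> a"
    then have "F t \<noteq> z" using val[of t] t(1) ord by auto
    moreover have "F t = z" unfolding F_def using t(2) by (metis fst_conv)
    ultimately show False by simp
  qed
  then show ?thesis using t(2) by simp
qed

lemma hanging_side_cable:
  assumes Y: "floating_set Y" and XY: "X = Y \<union> path_image g"
    and g: "arc g" "pathstart g \<in> Jside_open s" "pathfinish g \<in> Y"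
      "(path_image g - {pathstart g, pathfinish g}) \<inter> (bd_sq \<union> Y) = {}"
  shows "X \<inter> Jside s = {pathstart g}" "pathstart g \<notin> Y"
proof -
  have "Jside_open s \<subseteq> Jside s" by (auto simp: Jside_open_def Jside_def JJ_def)
  then have st: "pathstart g \<in> Jside s" "pathstart g \<in> X"
    using g(2) XY by auto
  have Yb: "Y \<inter> Jside s = {}" using Y Jside_subset_bd_sq[OF s] by (auto simp: floating_set_def)
  then show "pathstart g \<notin> Y" using st by blast
  have "p = pathstart g" if "p \<in> X" "p \<in> Jside s" for p
    using that Yb g(3,4) XY Jside_subset_bd_sq[OF s] by blast
  then show "X \<inter> Jside s = {pathstart g}" using st by blast
qed

text \<open>
  If the boundary path \<open>\<eta>\<close> left \<open>Y\<close> along the cable and came back, the image of the chord from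
  \<open>a\<close> to \<open>c\<close> would close up along the cable to a Jordan curve that separates
  \<open>\<eta> (a1, s)\<close> from \<open>\<eta> (b1, s)\<close>, although it misses the connected set \<open>Y\<close>.
\<close>

lemma collapse_no_excursion_aux:
  assumes Y: "floating_set Y" and XY: "X = Y \<union> path_image g"
    and g: "arc g" "pathstart g \<in> Jside_open s" "pathfinish g \<in> Y"
      "(path_image g - {pathstart g, pathfinish g}) \<inter> (bd_sq \<union> Y) = {}"
    and x: "a < a1" "a1 < c" "c < b1" "b1 \<le> b"
    and eta: "\<eta> (a1, s) \<in> Y" "\<eta> (b1, s) \<in> Y" "\<eta> (c, s) \<noteq> pathstart g"
  shows "\<eta> (c, s) \<in> Y"
proof (rule ccontr)
  assume nY: "\<eta> (c, s) \<notin> Y"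
  note side = hanging_side_cable[OF Y XY g]
  have ord: "\<alpha> < a" "b < \<beta>" using collapseD(2-4) by auto
  obtain z where z: "pathstart g = (z, s)" using g(2) by (auto simp: Jside_open_def)
  have start: "\<eta> (a, s) = pathstart g"
    using collapse_start[of z] side(1) z by simp
  have "\<eta> (c, s) \<in> X"
    unfolding collapseD(11)[symmetric] using x by (intro imageI) auto
  then have "\<eta> (c, s) \<in> path_image g" using XY nY by blast
  then obtain t where t: "t \<in> {0..1}" "g t = \<eta> (c, s)" by (auto simp: path_image_def)
  have t01: "0 < t" "t < 1"
    using t eta(3) nY g(3) by (auto simp: less_le pathstart_def pathfinish_def)
  \<comment> \<open>The cable is run backwards from \<open>\<eta> (c, s)\<close> to its foot, which
    is \<open>\<eta> (a, s)\<close> by \<open>collapse_start\<close>. So \<gamma> joins the two ends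
    of the image of the chord.\<close>
  define \<gamma> where "\<gamma> = subpath t 0 g"
  have arc\<gamma>: "arc \<gamma>" unfolding \<gamma>_def using g(1) t01 by (intro arc_subpath_arc) auto
  have im\<gamma>: "path_image \<gamma> = g ` {0..t}"
    unfolding \<gamma>_def using t01 by (simp add: path_image_subpath_gen closed_segment_eq_real_ivl)
  have "g ` {0..t} \<subseteq> path_image g"
    unfolding path_image_def using t01 by (intro image_mono) auto
  then have \<gamma>X: "path_image \<gamma> \<subseteq> X" unfolding im\<gamma> XY by blast
  have \<gamma>Y: "path_image \<gamma> \<inter> Y = {}"
  proof -
    have "g u \<notin> Y" if u: "u \<in> {0..t}" for u
    proof (cases "u = 0")
      case True then show ?thesis using side(2) by (simp add: pathstart_def)
    next
      case False
      then have "g u \<noteq> g 0" "g u \<noteq> g 1"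
        using arcD[OF g(1), of u 0] arcD[OF g(1), of u 1] u t01 by auto
      moreover have "g u \<in> path_image g" using u t01 by (auto simp: path_image_def)
      ultimately show ?thesis using g(4) by (auto simp: pathstart_def pathfinish_def)
    qed
    then show ?thesis unfolding im\<gamma> by blast
  qed
  obtain h h' where h: "homeomorphism (cball (0::pt) 1) D h h'"
    "h ` ball 0 1 = interior D" "h ` sphere 0 1 = frontier D"
    using disc_parametrization[of D] hutch unfolding hutch_def by metis
  define k where "k x = h' (x, s)" for x
  have inD: "(x, s) \<in> frontier D" "(x, s) \<in> D" if "x \<in> {\<alpha>..\<beta>}" for x
    using collapse_side_frontier collapse_decomp that by auto
  have hk: "h (k x) = (x, s)" if "x \<in> {\<alpha>..\<beta>}" for x
    unfolding k_def by (rule homeomorphism_apply2[OF h(1) inD(2)[OF that]])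
  have h'h: "h' (h p) = p" if "p \<in> cball 0 1" for p
    by (rule homeomorphism_apply1[OF h(1) that])
  have knorm: "norm (k x) = 1" if x: "x \<in> {\<alpha>..\<beta>}" for x
  proof -
    obtain p where p: "p \<in> sphere 0 1" "(x, s) = h p" using inD(1)[OF x] h(3) by blast
    then have "k x = p" unfolding k_def using h'h[of p] by simp
    then show ?thesis using p by simp
  qed
  have kcont: "continuous_on {\<alpha>..\<beta>} k"
    unfolding k_def
  proof (rule continuous_on_compose2[where g = h'])
    show "continuous_on D h'" using h(1) by (simp add: homeomorphism_def)
  qed (use inD in \<open>auto intro!: continuous_intros\<close>)
  have kinj: "inj_on k {\<alpha>..\<beta>}"
    by (rule inj_onI) (metis hk prod.inject)
  \<comment> \<open>The plane is read as the complex plane, where \<open>no_crossing\<close> applies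
    the Jordan curve theorem.\<close>
  define \<phi> where "\<phi> p = Complex (fst p) (snd p)" for p :: pt
  have \<phi>: "continuous_on S \<phi>" "inj_on \<phi> S" for S
    unfolding \<phi>_def by (auto intro!: continuous_intros inj_onI simp: complex_eq_iff prod_eq_iff continuous_on_Complex)
  define f where "f = \<phi> \<circ> (\<eta> \<circ> h)"
  have hcont: "continuous_on (cball 0 1) h" "h ` cball 0 1 = D" using h(1) by (auto simp: homeomorphism_def)
  have fcont: "continuous_on (cball 0 1) f"
    unfolding f_def using hcont collapseD(8) \<phi>
    by (intro continuous_on_compose) auto
  have hinj: "inj_on h (ball 0 1)"
    by (rule inj_on_inverseI[where g = h']) (simp add: h'h)
  have finj: "inj_on f (ball 0 1)"
    unfolding f_def using hinj h(2) collapseD(16) \<phi>(2)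
    by (intro comp_inj_on) auto
  have fball: "f ` ball 0 1 = \<phi> ` (interior D - X)"
    unfolding f_def by (simp only: image_comp[symmetric] h(2) collapseD(15))
  have fk: "f (k x) = \<phi> (\<eta> (x, s))" if "x \<in> {\<alpha>..\<beta>}" for x
    unfolding f_def by (simp add: hk[OF that])
  have mem: "a \<in> {\<alpha>..\<beta>}" "c \<in> {\<alpha>..\<beta>}" "a1 \<in> {\<alpha>..\<beta>}" "b1 \<in> {\<alpha>..\<beta>}" using x ord by auto
  have \<phi>disj: "\<phi> ` A \<inter> \<phi> ` B = {}" if "A \<inter> B = {}" for A B
    using that \<phi>(2)[of UNIV] by (metis image_Int image_empty)
  show False
  proof (rule no_crossing[OF fcont finj, where a = "k a" and c = "k c" and ?a1.0 = "k a1"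
        and ?b1.0 = "k b1" and g = "\<phi> \<circ> \<gamma>" and Y = "\<phi> ` Y"])
    show "norm (k a) = 1" "norm (k c) = 1" "norm (k a1) = 1" "norm (k b1) = 1"
      using knorm mem by auto
    show "side (k a) (k c) (k a1) * side (k a) (k c) (k b1) < 0"
      using x ord by (intro circle_path_separated[OF kcont kinj knorm]) auto
    show "arc (\<phi> \<circ> \<gamma>)"
      using arc\<gamma> \<phi> unfolding arc_def by (auto intro!: path_continuous_image comp_inj_on)
    show "pathstart (\<phi> \<circ> \<gamma>) = f (k c)" "pathfinish (\<phi> \<circ> \<gamma>) = f (k a)"
      using t(2) start fk mem by (simp_all add: pathstart_compose pathfinish_compose \<gamma>_def pathstart_def pathfinish_def subpath_def)
    show "path_image (\<phi> \<circ> \<gamma>) \<inter> f ` ball 0 1 = {}"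
      unfolding path_image_compose fball using \<gamma>X by (intro \<phi>disj) blast
    show "connected (\<phi> ` Y)"
      using Y \<phi>(1) by (intro connected_continuous_image) (auto simp: floating_set_def)
    show "f (k a1) \<in> \<phi> ` Y" "f (k b1) \<in> \<phi> ` Y" using fk mem eta by auto
    show "\<phi> ` Y \<inter> path_image (\<phi> \<circ> \<gamma>) = {}"
      unfolding path_image_compose using \<gamma>Y by (intro \<phi>disj) blast
    show "\<phi> ` Y \<inter> f ` ball 0 1 = {}"
      unfolding fball using XY by (intro \<phi>disj) blast
  qed
qed

text \<open>It remains to admit the foot of the cable as a value, where the piece of cable used
  before would shrink to a point. A connected path from Y to the foot takes, at some earlier
  parameter c', a value that is neither in Y nor the foot; the previous lemma excludes this.\<close>

lemma collapse_no_excursion: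
  assumes Y: "floating_set Y" and XY: "X = Y \<union> path_image g"
    and g: "arc g" "pathstart g \<in> Jside_open s" "pathfinish g \<in> Y"
      "(path_image g - {pathstart g, pathfinish g}) \<inter> (bd_sq \<union> Y) = {}"
    and x: "a < a1" "a1 < c" "c < b1" "b1 \<le> b"
    and eta: "\<eta> (a1, s) \<in> Y" "\<eta> (b1, s) \<in> Y"
  shows "\<eta> (c, s) \<in> Y"
proof (cases "\<eta> (c, s) = pathstart g")
  case True
  have ord: "\<alpha> < a" "b < \<beta>" using collapseD(2-4) by auto
  have "connected ((\<lambda>t. \<eta> (t, s)) ` {a1..c})"
    using x ord by (intro connected_continuous_image continuous_on_collapse_side) auto
  moreover have "closed Y" using Y by (auto simp: floating_set_def compact_imp_closed)
  moreover have "pathstart g \<notin> Y" by (rule hanging_side_cable[OF Y XY g])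
  moreover have "\<eta> (a1, s) \<in> (\<lambda>t. \<eta> (t, s)) ` {a1..c}" "pathstart g \<in> (\<lambda>t. \<eta> (t, s)) ` {a1..c}"
    using x True by (auto intro: image_eqI[of _ _ c])
  ultimately have "\<not> (\<lambda>t. \<eta> (t, s)) ` {a1..c} \<subseteq> Y \<union> {pathstart g}"
    using eta(1) connected_closedD[of "(\<lambda>t. \<eta> (t, s)) ` {a1..c}" Y "{pathstart g}"] by blast
  then obtain p where "p \<in> (\<lambda>t. \<eta> (t, s)) ` {a1..c}" "p \<notin> Y" "p \<noteq> pathstart g"
    by blast
  then obtain c' where c': "a1 \<le> c'" "c' \<le> c" "\<eta> (c', s) \<notin> Y" "\<eta> (c', s) \<noteq> pathstart g"
    by auto
  then have "a1 < c'" "c' < b1" using eta x by (auto simp: less_le)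
  then show ?thesis using collapse_no_excursion_aux[OF Y XY g x(1) _ _ x(4) eta, of c'] c' by blast
qed (use collapse_no_excursion_aux[OF assms] in blast)

text \<open>The first and the last parameter in {a..b} with value in Y bound the segment, since the
  path cannot leave Y in between. They coincide if Y is hit only once, so the segment may be a
  single point.\<close>

lemma collapse_onto_floating:
  assumes Y: "floating_set Y" and cable: "cable L Y s" and XY: "X = Y \<union> L"
  obtains a1 b1 where "\<alpha> < a1" "a1 \<le> b1" "b1 < \<beta>" "\<eta> ` ({a1..b1} \<times> {s}) = Y"
proof -
  obtain g where L: "path_image g = L" and g: "arc g" "pathstart g \<in> Jside_open s" "pathfinish g \<in> Y"
      "(path_image g - {pathstart g, pathfinish g}) \<inter> (bd_sq \<union> Y) = {}"
    using cable unfolding cable_def by metis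
  have XY': "X = Y \<union> path_image g" using XY L by simp
  note side = hanging_side_cable[OF Y XY' g]
  have ord: "\<alpha> < a" "b < \<beta>" "a < b" using collapseD(2-4) by auto
  define T where "T = {t \<in> {a..b}. \<eta> (t, s) \<in> Y}"
  have "closed Y" "Y \<noteq> {}" using Y by (auto simp: floating_set_def compact_imp_closed)
  have "closed T"
  proof -
    have "T = {a..b} \<inter> (\<lambda>t. \<eta> (t, s)) -` Y" by (auto simp: T_def)
    then show ?thesis
      using ord \<open>closed Y\<close> by (auto intro!: continuous_closed_preimage continuous_on_collapse_side)
  qed
  then have "compact T"
    by (rule compact_eq_bounded_closed[THEN iffD2, OF conjI, rotated])
      (rule bounded_subset[of "{a..b}"], auto simp: T_def)
  have img: "\<eta> ` ({a..b} \<times> {s}) = X" by (rule collapseD)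
  have YT: "\<exists>t\<in>T. \<eta> (t, s) = y" if "y \<in> Y" for y
  proof -
    have "y \<in> \<eta> ` ({a..b} \<times> {s})" unfolding img using that XY by simp
    then show ?thesis using that by (auto simp: T_def)
  qed
  then have "T \<noteq> {}" using \<open>Y \<noteq> {}\<close> by blast
  obtain a1 where a1: "a1 \<in> T" "\<And>t. t \<in> T \<Longrightarrow> a1 \<le> t"
    using compact_attains_inf[OF \<open>compact T\<close> \<open>T \<noteq> {}\<close>] by blast
  obtain b1 where b1: "b1 \<in> T" "\<And>t. t \<in> T \<Longrightarrow> t \<le> b1"
    using compact_attains_sup[OF \<open>compact T\<close> \<open>T \<noteq> {}\<close>] by blast
  \<comment> \<open>The crossing argument needs four distinct parameters a < a1 < c < b1. The first
    inequality is strict because a is mapped to the foot of the cable, which is not in Y.\<close>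
  have "a \<noteq> a1"
  proof
    assume "a = a1"
    moreover obtain z where z: "pathstart g = (z, s)" using g(2) by (auto simp: Jside_open_def)
    then have "\<eta> (a, s) = pathstart g" using collapse_start[of z] side(1) by simp
    ultimately show False using a1(1) side(2) by (simp add: T_def)
  qed
  then have "a < a1" "b1 \<le> b" using a1(1) b1(1) by (auto simp: T_def)
  have eta: "\<eta> (a1, s) \<in> Y" "\<eta> (b1, s) \<in> Y" using a1(1) b1(1) by (auto simp: T_def)
  have "\<eta> (t, s) \<in> Y" if "t \<in> {a1..b1}" for t
  proof (cases "t = a1 \<or> t = b1")
    case False
    then show ?thesis
      using that collapse_no_excursion[OF Y XY' g \<open>a < a1\<close> _ _ \<open>b1 \<le> b\<close> eta, of t] by auto
  qed (use eta in auto)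
  moreover have "y \<in> \<eta> ` ({a1..b1} \<times> {s})" if "y \<in> Y" for y
    using YT[OF that] a1(2) b1(2) by force
  ultimately have "\<eta> ` ({a1..b1} \<times> {s}) = Y" by auto
  then show ?thesis
    using that[of a1 b1] ord \<open>a < a1\<close> \<open>b1 \<le> b\<close> a1(2)[OF b1(1)] by auto
qed

end

section \<open>Gluing and descending to the quotient\<close>

text \<open>Continuity is clear where a relative neighbourhood lies in one hutch. At any other point
  p the map is the identity, and a nearby q either lies in one of finitely many large hutches, whose
  maps are continuous, or is moved by no more than the diameter of a small hutch.\<close>

lemma glue_collapses:
  fixes D X :: "'i \<Rightarrow> pt set"
  assumes col: "\<And>i. collapse (\<eta> i) (X i) (D i) (s i) (\<alpha> i) (\<beta> i) (a i) (b i)"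
    and s: "\<And>i. s i = 1 \<or> s i = -1" and hutch: "\<And>i. hutch (D i) (X i) (s i)"
    and disj: "\<And>i j. i \<noteq> j \<Longrightarrow> D i \<inter> D j = {}"
    and small: "\<And>e. e > 0 \<Longrightarrow> finite {i. diameter (D i) \<ge> e}"
  shows "\<exists>H. continuous_on sq H \<and> H ` sq = sq \<and> (\<forall>i. \<forall>p\<in>D i. H p = \<eta> i p) \<and>
    (\<forall>p\<in>sq. \<forall>q\<in>sq. H p = H q \<longrightarrow> p = q \<or> \<bar>snd p\<bar> = 1 \<and> \<bar>snd q\<bar> = 1) \<and>
    (\<forall>p\<in>bd_sq. H p \<in> bd_sq \<union> (\<Union>i. X i))"
proof -
  define H where "H p = (if \<exists>i. p \<in> D i then \<eta> (THE i. p \<in> D i) p else p)" for p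
  have HD: "H p = \<eta> i p" if "p \<in> D i" for i p
  proof -
    have "(THE i. p \<in> D i) = i"
    proof (rule the_equality)
      fix j assume "p \<in> D j" then show "j = i" using disj[of i j] that by blast
    qed fact
    then show ?thesis using that by (auto simp: H_def)
  qed
  have Hout: "H p = p" if "\<And>i. p \<notin> D i" for p using that by (simp add: H_def)
  have img: "\<eta> i ` D i = D i" for i by (rule collapse_image[OF col s hutch])
  have HDin: "H p \<in> D i" if "p \<in> D i" for i p using HD[OF that] img[of i] that by blast
  have Dsq: "D i \<subseteq> sq" for i using hutch[of i] by (simp add: hutch_def)
  have clD: "closed (D i)" for i by (rule hutch_closed[OF col s hutch])
  have bdD: "bounded (D i)" for i
    using Dsq bounded_subset compact_imp_bounded[OF compact_sq] by blast
  have A: "D i \<inter> bd_sq = {\<alpha> i..\<beta> i} \<times> {s i}" for i by (rule collapseD(6)[OF col s hutch])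
  have tends: "(H \<longlongrightarrow> H p) (at p within sq)" if p: "p \<in> sq" for p
  proof (cases "\<exists>i r. r > 0 \<and> ball p r \<inter> sq \<subseteq> D i")
    case True
    then obtain i r where r: "r > 0" "ball p r \<inter> sq \<subseteq> D i" by blast
    then have "p \<in> D i" using p by auto
    have "(\<eta> i \<longlongrightarrow> \<eta> i p) (at p within D i)"
      using collapseD(8)[OF col s hutch, of i] \<open>p \<in> D i\<close> by (simp add: continuous_on_def)
    then have "(\<eta> i \<longlongrightarrow> \<eta> i p) (at p within (ball p r \<inter> sq))"
      by (rule tendsto_within_subset[OF _ r(2)])
    moreover have "eventually (\<lambda>q. \<eta> i q = H q) (at p within (ball p r \<inter> sq))"
      unfolding eventually_at_filter using HD[of _ i] r(2) by (intro always_eventually) auto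
    ultimately have "(H \<longlongrightarrow> H p) (at p within (ball p r \<inter> sq))"
      using HD[OF \<open>p \<in> D i\<close>] by (simp add: Lim_transform_eventually)
    moreover have "at p within (ball p r \<inter> sq) = at p within sq"
      using r(1) by (intro at_within_nhd[of p "ball p r"]) auto
    ultimately show ?thesis by simp
  next
    case False
    \<comment> \<open>If p lies in a hutch at all, it is neither interior nor an inner point of the
      side arc, so it lies on the part of the frontier where \<eta> is the identity.\<close>
    have Hp: "H p = p"
    proof (cases "\<exists>i. p \<in> D i")
      case True
      then obtain i where i: "p \<in> D i" by blast
      have "p \<notin> interior (D i)"
        using False unfolding mem_interior by blast
      moreover have "p \<notin> {\<alpha> i<..<\<beta> i} \<times> {s i}"
      proof
        assume "p \<in> {\<alpha> i<..<\<beta> i} \<times> {s i}"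
        then obtain x where x: "p = (x, s i)" "\<alpha> i < x" "x < \<beta> i" by auto
        obtain r where "r > 0" "ball (x, s i) r \<inter> sq \<subseteq> D i"
          by (rule hutch_neighbourhood[OF s hutch A x(2,3)])
        then show False using False x(1) by blast
      qed
      ultimately have "p \<in> frontier (D i) - {\<alpha> i<..<\<beta> i} \<times> {s i}"
        using i by (auto simp: frontier_def closure_closed clD)
      then have "\<eta> i p = p" using collapseD(9)[OF col s hutch] by blast
      then show ?thesis using HD[OF i] by simp
    qed (use Hout in auto)
    show ?thesis
      unfolding Hp
    proof (rule tendstoI)
      fix e :: real assume e: "e > 0"
      define F where "F = {i. diameter (D i) \<ge> e / 2}"
      have "eventually (\<lambda>q. q \<in> D i \<longrightarrow> dist (H q) p < e) (at p within sq)" for i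
      proof (cases "p \<in> D i")
        case True
        have "(\<eta> i \<longlongrightarrow> \<eta> i p) (at p within D i)"
          using collapseD(8)[OF col s hutch, of i] True by (simp add: continuous_on_def)
        then have "eventually (\<lambda>q. dist (\<eta> i q) (\<eta> i p) < e) (at p within D i)"
          using e by (rule tendstoD)
        then show ?thesis
          unfolding eventually_at_filter
          by (rule eventually_mono) (use HD[of _ i] HD[OF True] Hp in auto)
      next
        case False
        have "eventually (\<lambda>q. q \<in> - D i) (nhds p)"
          using False clD[of i] by (intro eventually_nhds_in_open) auto
        then show ?thesis
          unfolding eventually_at_filter by (rule eventually_mono) auto
      qed
      then have "eventually (\<lambda>q. \<forall>i\<in>F. q \<in> D i \<longrightarrow> dist (H q) p < e) (at p within sq)"
        using small[of "e / 2"] e by (intro eventually_ball_finite) (auto simp: F_def)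
      moreover have "eventually (\<lambda>q. dist q p < e / 2) (at p within sq)"
        using e by (intro tendstoD[OF tendsto_ident_at]) auto
      ultimately show "eventually (\<lambda>q. dist (H q) p < e) (at p within sq)"
      proof eventually_elim
        case (elim q)
        show ?case
        proof (cases "\<exists>i. q \<in> D i")
          case True
          then obtain i where i: "q \<in> D i" by blast
          show ?thesis
          proof (cases "i \<in> F")
            case True then show ?thesis using elim(1) i by blast
          next
            case False
            have "dist (H q) q \<le> diameter (D i)"
              by (rule diameter_bounded_bound[OF bdD HDin[OF i] i])
            then have "dist (H q) q < e / 2" using False by (simp add: F_def)
            then show ?thesis using elim(2) dist_triangle[of "H q" p q] by linarith
          qed
        next
          case False
          then show ?thesis using Hout[of q] elim(2) e by simp
        qed
      qed
    qed
  qed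
  have onto: "H ` sq = sq"
  proof (intro subset_antisym subsetI)
    fix y assume "y \<in> H ` sq"
    then obtain p where p: "y = H p" "p \<in> sq" by blast
    show "y \<in> sq"
    proof (cases "\<exists>i. p \<in> D i")
      case True then show ?thesis using HDin Dsq p(1) by blast
    qed (use Hout p in auto)
  next
    fix y assume y: "y \<in> sq"
    show "y \<in> H ` sq"
    proof (cases "\<exists>i. y \<in> D i")
      case True
      then obtain i p where p: "y = \<eta> i p" "p \<in> D i" using img by blast
      then have "y = H p" "p \<in> sq" using HD[OF p(2)] Dsq[of i] by auto
      then show ?thesis by (rule image_eqI)
    next
      case False
      then show ?thesis using Hout[of y] y by (intro image_eqI[of _ _ y]) auto
    qed
  qed
  have fib: "p = q \<or> \<bar>snd p\<bar> = 1 \<and> \<bar>snd q\<bar> = 1" if "p \<in> sq" "q \<in> sq" "H p = H q" for p q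
  proof (cases "\<exists>i. p \<in> D i \<or> q \<in> D i")
    case True
    then obtain i where i: "p \<in> D i \<or> q \<in> D i" by blast
    \<comment> \<open>Every hutch is mapped into itself and all other points are fixed, so points
      with a common value in a hutch lie in that hutch together.\<close>
    have "r \<in> D i" if "H r \<in> D i" for r
    proof (cases "\<exists>j. r \<in> D j")
      case True
      then obtain j where j: "r \<in> D j" by blast
      then have "H r \<in> D j" by (rule HDin)
      then have "i = j" using that disj[of i j] by blast
      then show ?thesis using j by simp
    qed (use Hout that in auto)
    then have pq: "p \<in> D i" "q \<in> D i" using i HDin that(3) by metis+
    then have "p = q \<or> p \<in> {\<alpha> i..\<beta> i} \<times> {s i} \<and> q \<in> {\<alpha> i..\<beta> i} \<times> {s i}"
      using that(3) HD by (intro collapse_fibres[OF col s hutch]) auto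
    then show ?thesis using s[of i] by auto
  next
    case False
    then show ?thesis using Hout that(3) by metis
  qed
  have bd: "H p \<in> bd_sq \<union> (\<Union>i. X i)" if "p \<in> bd_sq" for p
  proof (cases "\<exists>i. p \<in> D i")
    case True
    then obtain i where i: "p \<in> D i" by blast
    then have "p \<in> {\<alpha> i..\<beta> i} \<times> {s i}" using A that by blast
    then have "\<eta> i p \<in> {\<alpha> i..\<beta> i} \<times> {s i} \<union> X i"
      using collapseD(10)[OF col s hutch] by blast
    then show ?thesis using HD[OF i] A[of i] by auto
  next
    case False
    then show ?thesis using Hout[of p] that by auto
  qed
  have "continuous_on sq H" using tends by (simp add: continuous_on_def)
  then show ?thesis
    by (intro exI[of _ H] conjI allI ballI impI) (assumption | rule onto HD fib bd)+
qed

text \<open>A continuous surjection of the compact square onto itself is a quotient map, so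
  continuity may be tested after composing with \<open>H\<close>. The choice of a preimage is
  harmless: distinct preimages of one point lie on the sides, where g is the identity.\<close>

lemma descend_to_quotient:
  assumes H: "continuous_on sq H" "H ` sq = sq"
    and fib: "\<And>p q. p \<in> sq \<Longrightarrow> q \<in> sq \<Longrightarrow> H p = H q \<Longrightarrow> p = q \<or> \<bar>snd p\<bar> = 1 \<and> \<bar>snd q\<bar> = 1"
    and g: "continuous_on sq g" "g ` sq \<subseteq> sq" "\<And>p. p \<in> sq \<Longrightarrow> \<bar>snd p\<bar> = 1 \<Longrightarrow> g p = p"
  shows "\<exists>\<psi>. continuous_on sq \<psi> \<and> (\<forall>q\<in>sq. \<psi> (H q) = H (g q))"
proof -
  define \<psi> where "\<psi> p = H (g (SOME q. q \<in> sq \<and> H q = p))" for p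
  have \<psi>: "\<psi> (H q) = H (g q)" if q: "q \<in> sq" for q
  proof -
    define r where "r = (SOME r. r \<in> sq \<and> H r = H q)"
    have r: "r \<in> sq \<and> H r = H q" unfolding r_def by (rule someI[of _ q]) (use q in simp)
    then have "H (g r) = H (g q)"
      using fib[of r q] g(3)[of r] g(3)[of q] q by auto
    then show ?thesis by (simp add: \<psi>_def r_def)
  qed
  have "continuous_on sq (H \<circ> g)"
    using g H continuous_on_subset by (intro continuous_on_compose) blast+
  have "openin (top_of_set sq) (sq \<inter> \<psi> -` T)" if "open T" for T
  proof -
    have "q \<in> sq \<inter> H -` (sq \<inter> \<psi> -` T) \<longleftrightarrow> q \<in> sq \<inter> (H \<circ> g) -` T" for q
    proof (cases "q \<in> sq")
      case True
      then have "H q \<in> sq" using H(2) by blast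
      then show ?thesis using \<psi>[OF True] True by simp
    qed simp
    then have "sq \<inter> H -` (sq \<inter> \<psi> -` T) = sq \<inter> (H \<circ> g) -` T" by blast
    moreover have "openin (top_of_set sq) (sq \<inter> (H \<circ> g) -` T)"
      using \<open>continuous_on sq (H \<circ> g)\<close> that by (rule continuous_openin_preimage_gen)
    ultimately show ?thesis
      using Abstract_Topology_2.continuous_imp_quotient_map[OF H compact_sq, of "sq \<inter> \<psi> -` T"] by simp
  qed
  then have "continuous_on sq \<psi>" by (simp add: continuous_openin_preimage_eq)
  then show ?thesis using \<psi> by blast
qed

section \<open>Assembling the homeomorphism\<close>

lemma hutch_target:
  assumes s: "s = 1 \<or> s = -1" and hutch: "hutch D X s" and col: "collapse \<eta> X D s \<alpha> \<beta> a b"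
    and cab: "n \<in> N \<Longrightarrow> floating_set Y \<and> cable L Y s \<and> X = Y \<union> L"
  shows "\<exists>p q. -1 < p \<and> p \<le> q \<and> q < 1 \<and> {p..q} \<times> {s} \<subseteq> D \<and>
    \<eta> ` ({p..q} \<times> {s}) = (if n \<in> N then Y else X)"
proof -
  note C = collapseD[OF col s hutch]
  have sub: "{p..q} \<times> {s} \<subseteq> D" if "\<alpha> \<le> p" "q \<le> \<beta>" for p q
    using C(6) that by force
  show ?thesis
  proof (cases "n \<in> N")
    case True
    have "floating_set Y" "cable L Y s" "X = Y \<union> L" using cab[OF True] by auto
    from collapse_onto_floating[OF col s hutch this] obtain p q where
      "\<alpha> < p" "p \<le> q" "q < \<beta>" "\<eta> ` ({p..q} \<times> {s}) = Y" .
    then show ?thesis using True C(1,5) sub[of p q] by (intro exI[of _ p] exI[of _ q]) auto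
  next
    case False
    then show ?thesis using C(1-5,11) sub[of a b] by (intro exI[of _ a] exI[of _ b]) auto
  qed
qed

theorem theorem4p7:
  fixes X1 X2 D1 D2 Y1 L1 Y2 L2 W :: "nat \<Rightarrow> pt set"
    and N' N'' :: "nat set"
  assumes hang1: "\<forall>n. hanging_set (X1 n) 1 \<and> hutch (D1 n) (X1 n) 1 \<and> permeable (X1 n) (D1 n) 1"
    and hang2: "\<forall>n. hanging_set (X2 n) (-1) \<and> hutch (D2 n) (X2 n) (-1) \<and> permeable (X2 n) (D2 n) (-1)"
    and diam1: "(\<lambda>n. diameter (D1 n)) \<longlonglongrightarrow> 0"
    and diam2: "(\<lambda>n. diameter (D2 n)) \<longlonglongrightarrow> 0"
    and disj11: "\<forall>m n. m \<noteq> n \<longrightarrow> D1 m \<inter> D1 n = {}"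
    and disj22: "\<forall>m n. m \<noteq> n \<longrightarrow> D2 m \<inter> D2 n = {}"
    and disj12: "\<forall>m n. D1 m \<inter> D2 n = {}"
    and cab1: "\<forall>n\<in>N'. floating_set (Y1 n) \<and> cable (L1 n) (Y1 n) 1 \<and> X1 n = Y1 n \<union> L1 n"
    and cab2: "\<forall>n\<in>N''. floating_set (Y2 n) \<and> cable (L2 n) (Y2 n) (-1) \<and> X2 n = Y2 n \<union> L2 n"
    and Wdisj: "\<forall>m n. m \<noteq> n \<longrightarrow> W m \<inter> W n = {}"
    and Wcount: "\<forall>n. countable (W n)"
    and Wsub: "\<forall>n. W n \<subseteq> ({-1<..<1} \<times> {-1<..<1}) - (\<Union>k. X1 k \<union> X2 k)"
    and Wdense: "\<forall>n. sq \<subseteq> closure (W n)"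
  shows "\<exists>\<psi> \<psi>'. homeomorphism sq sq \<psi> \<psi>' \<and>
     (\<forall>n. n \<notin> N' \<longrightarrow> (\<forall>w\<in>W n. omega_limit \<psi> w = X1 n)) \<and>
     (\<forall>n\<in>N'. \<forall>w\<in>W n. omega_limit \<psi> w = Y1 n) \<and>
     (\<forall>n. n \<notin> N'' \<longrightarrow> (\<forall>w\<in>W n. omega_limit \<psi>' w = X2 n)) \<and>
     (\<forall>n\<in>N''. \<forall>w\<in>W n. omega_limit \<psi>' w = Y2 n)"
proof -
  \<comment> \<open>Both families are merged into one, indexed by pairs; the second component is
    \<open>True\<close> for the side at height 1.\<close>
  define D where "D i = (if snd i then D1 (fst i) else D2 (fst i))" for i :: "nat \<times> bool"
  define X where "X i = (if snd i then X1 (fst i) else X2 (fst i))" for i :: "nat \<times> bool"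
  define Y where "Y i = (if snd i then Y1 (fst i) else Y2 (fst i))" for i :: "nat \<times> bool"
  define L where "L i = (if snd i then L1 (fst i) else L2 (fst i))" for i :: "nat \<times> bool"
  define s :: "nat \<times> bool \<Rightarrow> real" where "s i = (if snd i then 1 else -1)" for i
  define NN where "NN = {i :: nat \<times> bool. if snd i then fst i \<in> N' else fst i \<in> N''}"
  have s: "s i = 1 \<or> s i = -1" for i by (simp add: s_def)
  have hutch: "hutch (D i) (X i) (s i)" and perm: "permeable (X i) (D i) (s i)" for i
    using hang1 hang2 by (simp_all add: D_def X_def s_def)
  have cab: "floating_set (Y i) \<and> cable (L i) (Y i) (s i) \<and> X i = Y i \<union> L i" if "i \<in> NN" for i
    using that cab1 cab2 by (auto simp: NN_def X_def Y_def L_def s_def split: if_splits)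
  have disj: "D i \<inter> D j = {}" if "i \<noteq> j" for i j
    using that disj11[rule_format, of "fst i" "fst j"] disj22[rule_format, of "fst i" "fst j"]
      disj12[rule_format, of "fst i" "fst j"] disj12[rule_format, of "fst j" "fst i"]
    by (cases "snd i"; cases "snd j") (simp_all add: D_def prod_eq_iff Int_commute)
  have small: "finite {i. diameter (D i) \<ge> e}" if e: "e > 0" for e
  proof -
    have "finite {n. diameter (E n) \<ge> e}" if "(\<lambda>n. diameter (E n)) \<longlonglongrightarrow> 0" for E :: "nat \<Rightarrow> pt set"
    proof -
      have "eventually (\<lambda>n. diameter (E n) < e) sequentially"
        using that e by (rule order_tendstoD(2))
      then have "finite {n. \<not> diameter (E n) < e}"
        unfolding cofinite_eq_sequentially[symmetric] eventually_cofinite .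
      then show ?thesis by (simp add: not_less)
    qed
    then have fin: "finite {n. diameter (D1 n) \<ge> e}" "finite {n. diameter (D2 n) \<ge> e}"
      using diam1 diam2 by blast+
    have "{i. diameter (D i) \<ge> e} \<subseteq>
        {n. diameter (D1 n) \<ge> e} \<times> {True} \<union> {n. diameter (D2 n) \<ge> e} \<times> {False}"
      by (auto simp: D_def)
    then show ?thesis using fin by (auto intro: finite_subset)
  qed
  have "\<exists>\<eta> \<alpha> \<beta> a b. collapse \<eta> (X i) (D i) (s i) \<alpha> \<beta> a b" for i
    by (rule permeable_collapse[OF s hutch perm]) blast
  then obtain \<eta> \<alpha> \<beta> a b where col: "\<And>i. collapse (\<eta> i) (X i) (D i) (s i) (\<alpha> i) (\<beta> i) (a i) (b i)"
    by metis
  have "\<exists>H. continuous_on sq H \<and> H ` sq = sq \<and> (\<forall>i. \<forall>p\<in>D i. H p = \<eta> i p) \<and>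
    (\<forall>p\<in>sq. \<forall>q\<in>sq. H p = H q \<longrightarrow> p = q \<or> \<bar>snd p\<bar> = 1 \<and> \<bar>snd q\<bar> = 1) \<and>
    (\<forall>p\<in>bd_sq. H p \<in> bd_sq \<union> (\<Union>i. X i))"
    by (rule glue_collapses[OF col s hutch disj small])
  then obtain H where H0: "continuous_on sq H" "H ` sq = sq"
    "\<forall>i. \<forall>p\<in>D i. H p = \<eta> i p"
    "\<forall>p\<in>sq. \<forall>q\<in>sq. H p = H q \<longrightarrow> p = q \<or> \<bar>snd p\<bar> = 1 \<and> \<bar>snd q\<bar> = 1"
    "\<forall>p\<in>bd_sq. H p \<in> bd_sq \<union> (\<Union>i. X i)"
    by (elim exE conjE)
  note H = H0(1,2) H0(3)[rule_format] H0(4)[rule_format] H0(5)[rule_format]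
  \<comment> \<open>The limit set prescribed by the theorem. Its lift is a segment of the side that
    \<open>H\<close> maps onto it, and this segment is what the orbit upstairs has to accumulate
    on.\<close>
  define Z where "Z i = (if i \<in> NN then Y i else X i)" for i
  have "\<exists>p q. -1 < p \<and> p \<le> q \<and> q < 1 \<and> {p..q} \<times> {s i} \<subseteq> D i \<and> \<eta> i ` ({p..q} \<times> {s i}) = Z i" for i
    unfolding Z_def by (rule hutch_target[OF s hutch col cab])
  then obtain p q where pq: "\<And>i. -1 < p i \<and> p i \<le> q i \<and> q i < 1"
      "\<And>i. {p i..q i} \<times> {s i} \<subseteq> D i" "\<And>i. \<eta> i ` ({p i..q i} \<times> {s i}) = Z i"
    by metis
  have HZ: "H ` ({p i..q i} \<times> {s i}) = Z i" for i
    using H(3)[of _ i] pq(2,3)[of i] by (metis (no_types, lifting) image_cong subsetD)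

  define WW where "WW = (\<Union>n. W n)"
  define v where "v w = (SOME p. p \<in> sq \<and> H p = w)" for w
  have WW: "w \<in> {-1<..<1} \<times> {-1<..<1} \<and> w \<notin> (\<Union>i. X i)" if wW: "w \<in> WW" for w
  proof -
    have "(\<Union>i. X i) \<subseteq> (\<Union>k. X1 k \<union> X2 k)"
    proof (intro UN_least)
      show "X i \<subseteq> (\<Union>k. X1 k \<union> X2 k)" for i by (cases "snd i") (auto simp: X_def)
    qed
    moreover obtain n where "w \<in> W n" using wW unfolding WW_def by blast
    then have "w \<in> {-1<..<1} \<times> {-1<..<1} - (\<Union>k. X1 k \<union> X2 k)" using Wsub by blast
    ultimately show ?thesis by blast
  qed
  have v: "v w \<in> sq \<and> H (v w) = w" if "w \<in> WW" for w
  proof -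
    have "w \<in> H ` sq" using WW[OF that] H(2) by (auto simp: sq_def JJ_def)
    then obtain p where "p \<in> sq \<and> H p = w" by blast
    then show ?thesis unfolding v_def by (rule someI)
  qed
  have vint: "v w \<in> {-1<..<1} \<times> {-1<..<1}" if "w \<in> WW" for w
  proof -
    have "w \<notin> bd_sq" using WW[OF that] by (cases w) (auto simp: mem_bd_sq)
    then have "v w \<notin> bd_sq" using H(5)[of "v w"] v[OF that] WW[OF that] by auto
    then have "v w \<in> interior sq" using v[OF that] interior_sq by blast
    then show ?thesis by (simp add: sq_def JJ_def interior_Times)
  qed
  define idx where "idx w = (THE n. w \<in> W n)" for w
  have idx: "idx w = n" if "w \<in> W n" for w n
    unfolding idx_def using that Wdisj by (intro the_equality) blast+
  have "countable (v ` WW)" unfolding WW_def using Wcount by auto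
  moreover have "v ` WW \<subseteq> {-1<..<1} \<times> {-1<..<1}" using vint by blast
  \<comment> \<open>The targets must be functions of the points to be steered. Since
    \<open>H (v w) = w\<close>, the index belonging to \<open>u = v w\<close> is recovered as
    \<open>idx (H u)\<close>.\<close>
  ultimately obtain g g' where g: "homeomorphism sq sq g g'"
    "\<And>x. \<bar>x\<bar> \<le> 1 \<Longrightarrow> g (x, 1) = (x, 1) \<and> g (x, -1) = (x, -1)"
    "\<And>u. u \<in> v ` WW \<Longrightarrow> omega_limit g u = {p (idx (H u), True)..q (idx (H u), True)} \<times> {1}"
    "\<And>u. u \<in> v ` WW \<Longrightarrow> omega_limit g' u = {p (idx (H u), False)..q (idx (H u), False)} \<times> {-1}"
    by (rule steered_homeomorphism[where ?a1.0 = "\<lambda>u. p (idx (H u), True)" and ?b1.0 = "\<lambda>u. q (idx (H u), True)"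
          and ?a2.0 = "\<lambda>u. p (idx (H u), False)" and ?b2.0 = "\<lambda>u. q (idx (H u), False)", OF _ _ pq(1) pq(1)])
      (rule that, assumption, blast+)
  have gfix: "g r = r" if "r \<in> sq" "\<bar>snd r\<bar> = 1" for r
    using that g(2)[of "fst r"] by (cases r) (auto simp: mem_sq abs_if split: if_splits)
  have g'fix: "g' r = r" if "r \<in> sq" "\<bar>snd r\<bar> = 1" for r
    using homeomorphism_apply1[OF g(1) that(1)] gfix[OF that] by simp
  have gcont: "continuous_on sq g" "g ` sq = sq" "continuous_on sq g'" "g' ` sq = sq"
    using g(1) by (auto simp: homeomorphism_def)
  have "\<exists>\<psi>. continuous_on sq \<psi> \<and> (\<forall>r\<in>sq. \<psi> (H r) = H (g r))"
    by (rule descend_to_quotient[OF H(1,2,4) gcont(1) eq_refl[OF gcont(2)] gfix])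
  then obtain \<psi> where \<psi>: "continuous_on sq \<psi>" "\<And>r. r \<in> sq \<Longrightarrow> \<psi> (H r) = H (g r)"
    by blast
  have "\<exists>\<psi>'. continuous_on sq \<psi>' \<and> (\<forall>r\<in>sq. \<psi>' (H r) = H (g' r))"
    by (rule descend_to_quotient[OF H(1,2,4) gcont(3) eq_refl[OF gcont(4)] g'fix])
  then obtain \<psi>' where \<psi>': "continuous_on sq \<psi>'" "\<And>r. r \<in> sq \<Longrightarrow> \<psi>' (H r) = H (g' r)"
    by blast
  \<comment> \<open>Both compositions are the identity on values of \<open>H\<close>, and these are
    all points of the square. The sets \<alpha> of \<psi> are thereby limit sets of \<psi>', the map
    induced by \<open>g'\<close>.\<close>
  have hom: "homeomorphism sq sq \<psi> \<psi>'"
  proof (rule homeomorphismI)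
    have gin: "g r \<in> sq" "g' r \<in> sq" if "r \<in> sq" for r using gcont that by blast+
    have Hin: "H r \<in> sq" if "r \<in> sq" for r using H(2) that by blast
    have ex: "\<exists>r\<in>sq. y = H r" if "y \<in> sq" for y using H(2) that by blast
    show "\<psi> ` sq \<subseteq> sq"
    proof (rule image_subsetI)
      fix y assume "y \<in> sq"
      from ex[OF this] obtain r where "r \<in> sq" "y = H r" by blast
      then show "\<psi> y \<in> sq" using \<psi>(2) gin(1) Hin by simp
    qed
    show "\<psi>' ` sq \<subseteq> sq"
    proof (rule image_subsetI)
      fix y assume "y \<in> sq"
      from ex[OF this] obtain r where "r \<in> sq" "y = H r" by blast
      then show "\<psi>' y \<in> sq" using \<psi>'(2) gin(2) Hin by simp
    qed
    show "\<psi>' (\<psi> y) = y" "\<psi> (\<psi>' y) = y" if "y \<in> sq" for y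
    proof -
      from ex[OF that] obtain r where r: "y = H r" "r \<in> sq" by blast
      show "\<psi>' (\<psi> y) = y"
        using \<psi>(2)[OF r(2)] \<psi>'(2)[OF gin(1)[OF r(2)]] homeomorphism_apply1[OF g(1) r(2)] r(1) by simp
      show "\<psi> (\<psi>' y) = y"
        using \<psi>'(2)[OF r(2)] \<psi>(2)[OF gin(2)[OF r(2)]] homeomorphism_apply2[OF g(1) r(2)] r(1) by simp
    qed
  qed fact+
  have om: "omega_limit \<psi> w = Z (n, True) \<and> omega_limit \<psi>' w = Z (n, False)" if w: "w \<in> W n" for n w
  proof -
    have wW: "w \<in> WW" using w by (auto simp: WW_def)
    note vw = v[OF wW, THEN conjunct1] v[OF wW, THEN conjunct2]
    have vi: "v w \<in> v ` WW" using wW by blast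
    have "omega_limit \<psi> (H (v w)) = H ` omega_limit g (v w)"
      by (rule omega_limit_semiconj[OF compact_sq vw(1) eq_refl[OF gcont(2)] H(1) \<psi>(2)])
    also have "\<dots> = Z (n, True)"
      using g(3)[OF vi] HZ[of "(n, True)"] by (simp add: vw(2) idx[OF w] s_def)
    finally have 1: "omega_limit \<psi> w = Z (n, True)" by (simp only: vw(2))
    have "omega_limit \<psi>' (H (v w)) = H ` omega_limit g' (v w)"
      by (rule omega_limit_semiconj[OF compact_sq vw(1) eq_refl[OF gcont(4)] H(1) \<psi>'(2)])
    also have "\<dots> = Z (n, False)"
      using g(4)[OF vi] HZ[of "(n, False)"] by (simp add: vw(2) idx[OF w] s_def)
    finally have 2: "omega_limit \<psi>' w = Z (n, False)" by (simp only: vw(2))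
    from 1 2 show ?thesis ..
  qed
  show ?thesis
    using om by (intro exI[of _ \<psi>] exI[of _ \<psi>'] conjI hom) (auto simp: Z_def NN_def X_def Y_def)
qed

end
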